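(* Let $G$ be a finite group and $p$ a prime number dividing $|G|$. Let $R$ be a commutative ring with unit in which all the prime divisors of $|G|$ except $p$ are invertible, and in which $p$ is not invertible. Then the Mackey algebra $\mu_R(G)$ is a symmetric $R$-algebra if and only if $p^2\nmid |G|$.
   Context: Conventions: for $g\in G$ and $H\leqslant G$, ${}^gH=gHg^{-1}$ and $H^g=g^{-1}Hg$. Symmetric algebra: an $R$-algebra $A$ is symmetric if it is a finitely generated projective $R$-module and there is an $R$-bilinear form $b$ on $A$ with $b(xy,z)=b(x,yz)$ and $b(x,y)=b(y,x)$ for all $x,y,z\in A$, which is non-degenerate, i.e. $x\mapsto b(x,-)$ is an isomorphism of $R$-modules $A\to \mathrm{Hom}_R(A,R)$. Mackey algebra: $\mu_R(G)$ is the unital associative $R$-algebra with generators $t^K_H$, $r^K_H$, $c_{g,H}$ for $H\leqslant K\leqslant G$, $g\in G$, and relations: $\sum_{H\leqslant G}t^H_H=1$; $t^H_H=r^H_H=c_{h,H}$ for $h\in H$; $t^L_Kt^K_H=t^L_H$ and $r^K_Hr^L_K=r^L_H$ for $H\leqslant K\leqslant L$; $c_{g',{}^gH}c_{g,H}=c_{g'g,H}$; $t^{{}^gK}_{{}^gH}c_{g,H}=c_{g,K}t^K_H$ and $r^{{}^gK}_{{}^gH}c_{g,K}=c_{g,H}r^K_H$ for $H\leqslant K$; $r^H_Lt^H_K=\sum_{h\in[L\backslash H/K]}t^L_{L\cap{}^hK}\,c_{h,L^h\cap K}\,r^K_{L^h\cap K}$ for $L,K\leqslant H$; all other products of generators are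 zero. *)

theory Defs
  imports
    "HOL-Computational_Algebra.Primes"
    "HOL-Algebra.QuotRing"
    "Jordan_Normal_Form.Missing_VectorSpace"
begin

section \<open>Modules\<close>

text \<open>
  The fields \<^const>\<open>monoid.mult\<close> and \<^const>\<open>monoid.one\<close> are irrelevant for modules; where a module
  is not a ring they are filled with zero, following \<^const>\<open>direct_sum\<close>.
\<close>

definition regular_module :: "('r, 'm) ring_scheme \<Rightarrow> ('r, 'r) module" where
  "regular_module R =
    \<lparr>carrier = carrier R, mult = mult R, one = one R, zero = zero R, add = add R, smult = mult R\<rparr>"

definition module_iso ::
  "('r, 'm) ring_scheme \<Rightarrow> ('r, 'a, 'k) module_scheme \<Rightarrow> ('r, 'b, 'l) module_scheme \<Rightarrow> ('a \<Rightarrow> 'b) set"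
where
  "module_iso R M N = {f \<in> module_hom R M N. bij_betw f (carrier M) (carrier N)}"

text \<open>The free module on \<open>X\<close>: finitely supported functions on \<open>X\<close>, extended by zero outside \<open>X\<close>.\<close>

definition free_module :: "('r, 'm) ring_scheme \<Rightarrow> 'x set \<Rightarrow> ('r, 'x \<Rightarrow> 'r) module" where
  "free_module R X =
    \<lparr>carrier = {f. (\<forall>x. f x \<in> carrier R) \<and> finite {x. f x \<noteq> \<zero>\<^bsub>R\<^esub>} \<and> (\<forall>x. x \<notin> X \<longrightarrow> f x = \<zero>\<^bsub>R\<^esub>)},
     mult = (\<lambda>f g x. \<zero>\<^bsub>R\<^esub>),
     one = (\<lambda>x. \<zero>\<^bsub>R\<^esub>),
     zero = (\<lambda>x. \<zero>\<^bsub>R\<^esub>),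
     add = (\<lambda>f g x. f x \<oplus>\<^bsub>R\<^esub> g x),
     smult = (\<lambda>a f x. a \<otimes>\<^bsub>R\<^esub> f x)\<rparr>"

text \<open>
  The dual \<open>Hom\<^sub>R(M, R)\<close>. Linear maps are made undefined outside the carrier of \<open>M\<close>,
  so that equality of maps is equality on the carrier.
\<close>

definition dual_module ::
  "('r, 'm) ring_scheme \<Rightarrow> ('r, 'a, 'k) module_scheme \<Rightarrow> ('r, 'a \<Rightarrow> 'r) module"
where
  "dual_module R M =
    \<lparr>carrier = module_hom R M (regular_module R) \<inter> extensional (carrier M),
     mult = (\<lambda>f g. \<lambda>x\<in>carrier M. \<zero>\<^bsub>R\<^esub>),
     one = (\<lambda>x\<in>carrier M. \<zero>\<^bsub>R\<^esub>),
     zero = (\<lambda>x\<in>carrier M. \<zero>\<^bsub>R\<^esub>),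
     add = (\<lambda>f g. \<lambda>x\<in>carrier M. f x \<oplus>\<^bsub>R\<^esub> g x),
     smult = (\<lambda>a f. \<lambda>x\<in>carrier M. a \<otimes>\<^bsub>R\<^esub> f x)\<rparr>"

definition finitely_generated_module ::
  "('r, 'm) ring_scheme \<Rightarrow> ('r, 'a, 'k) module_scheme \<Rightarrow> bool"
where
  "finitely_generated_module R M \<longleftrightarrow>
    module R M \<and> (\<exists>S. finite S \<and> S \<subseteq> carrier M \<and> module.span R M S = carrier M)"

text \<open>
  A module is projective if it is a direct summand of a free module. Fixing the types of \<open>X\<close> and \<open>Q\<close>
  loses nothing: a projective \<open>P\<close> is a summand of the free module on any generating set of \<open>P\<close>,
  and the complement may be taken to be a submodule of that free module.
\<close>

definition projective_module ::
  "('r, 'm) ring_scheme \<Rightarrow> ('r, 'a, 'k) module_scheme \<Rightarrow> bool"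
where
  "projective_module R P \<longleftrightarrow>
    module R P \<and>
    (\<exists>(X :: 'a set) (Q :: ('r, 'a \<Rightarrow> 'r) module).
      module R Q \<and> module_iso R (direct_sum P Q) (free_module R X) \<noteq> {})"


section \<open>Symmetric algebras\<close>

text \<open>\<^locale>\<open>algebra\<close> only covers commutative algebras.\<close>

locale assoc_algebra = module R A + A?: ring A for R (structure) and A (structure) +
  assumes smult_mult_left:
      "\<lbrakk>a \<in> carrier R; x \<in> carrier A; y \<in> carrier A\<rbrakk>
        \<Longrightarrow> (a \<odot>\<^bsub>A\<^esub> x) \<otimes>\<^bsub>A\<^esub> y = a \<odot>\<^bsub>A\<^esub> (x \<otimes>\<^bsub>A\<^esub> y)"
    and smult_mult_right:
      "\<lbrakk>a \<in> carrier R; x \<in> carrier A; y \<in> carrier A\<rbrakk>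
        \<Longrightarrow> x \<otimes>\<^bsub>A\<^esub> (a \<odot>\<^bsub>A\<^esub> y) = a \<odot>\<^bsub>A\<^esub> (x \<otimes>\<^bsub>A\<^esub> y)"

definition bilinear_form ::
  "('r, 'm) ring_scheme \<Rightarrow> ('r, 'a, 'k) module_scheme \<Rightarrow> ('a \<Rightarrow> 'a \<Rightarrow> 'r) \<Rightarrow> bool"
where
  "bilinear_form R M b \<longleftrightarrow>
    (\<forall>x\<in>carrier M. (\<lambda>y. b x y) \<in> module_hom R M (regular_module R)) \<and>
    (\<forall>y\<in>carrier M. (\<lambda>x. b x y) \<in> module_hom R M (regular_module R))"

definition nondegenerate_form ::
  "('r, 'm) ring_scheme \<Rightarrow> ('r, 'a, 'k) module_scheme \<Rightarrow> ('a \<Rightarrow> 'a \<Rightarrow> 'r) \<Rightarrow> bool"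
where
  "nondegenerate_form R M b \<longleftrightarrow>
    (\<lambda>x. \<lambda>y\<in>carrier M. b x y) \<in> module_iso R M (dual_module R M)"

definition symmetric_algebra ::
  "('r, 'm) ring_scheme \<Rightarrow> ('r, 'a, 'k) module_scheme \<Rightarrow> bool"
where
  "symmetric_algebra R A \<longleftrightarrow>
    assoc_algebra R A \<and> finitely_generated_module R A \<and> projective_module R A \<and>
    (\<exists>b. bilinear_form R A b \<and>
      (\<forall>x\<in>carrier A. \<forall>y\<in>carrier A. \<forall>z\<in>carrier A. b (x \<otimes>\<^bsub>A\<^esub> y) z = b x (y \<otimes>\<^bsub>A\<^esub> z)) \<and>
      (\<forall>x\<in>carrier A. \<forall>y\<in>carrier A. b x y = b y x) \<and>
      nondegenerate_form R A b)"


section \<open>Algebras given by generators and relations\<close>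

text \<open>The free unital associative algebra on \<open>X\<close>: the free module on words over \<open>X\<close>, with the
  product extending concatenation of words.\<close>

definition free_algebra :: "('r, 'm) ring_scheme \<Rightarrow> 'x set \<Rightarrow> ('r, 'x list \<Rightarrow> 'r) module" where
  "free_algebra R X = (free_module R (lists X))
    \<lparr>mult := (\<lambda>f g w. \<Oplus>\<^bsub>R\<^esub>i\<in>{..length w}. f (take i w) \<otimes>\<^bsub>R\<^esub> g (drop i w)),
     one := (\<lambda>w. if w = [] then \<one>\<^bsub>R\<^esub> else \<zero>\<^bsub>R\<^esub>)\<rparr>"

definition letter :: "('r, 'm) ring_scheme \<Rightarrow> 'x \<Rightarrow> 'x list \<Rightarrow> 'r" where
  "letter R x = (\<lambda>w. if w = [x] then \<one>\<^bsub>R\<^esub> else \<zero>\<^bsub>R\<^esub>)"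

definition quotient_algebra ::
  "('r, 'a, 'k) module_scheme \<Rightarrow> 'a set \<Rightarrow> ('r, 'a set) module"
where
  "quotient_algebra A I =
    ring.extend (A Quot I) (module.fields (\<lambda>a C. \<Union>x\<in>C. I +>\<^bsub>A\<^esub> (a \<odot>\<^bsub>A\<^esub> x)))"

definition presented_algebra ::
  "('r, 'm) ring_scheme \<Rightarrow> 'x set \<Rightarrow> (('x list \<Rightarrow> 'r) \<Rightarrow> ('x list \<Rightarrow> 'r) \<Rightarrow> bool) \<Rightarrow>
    ('r, ('x list \<Rightarrow> 'r) set) module"
where
  "presented_algebra R X rel =
    quotient_algebra (free_algebra R X)
      (genideal (free_algebra R X) {u \<ominus>\<^bsub>free_algebra R X\<^esub> v | u v. rel u v})"


section \<open>The Mackey algebra\<close>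

definition conj_subgroup :: "('g, 'n) monoid_scheme \<Rightarrow> 'g \<Rightarrow> 'g set \<Rightarrow> 'g set" where
  "conj_subgroup G g H = g <#\<^bsub>G\<^esub> (H #>\<^bsub>G\<^esub> inv\<^bsub>G\<^esub> g)"

text \<open>\<open>D\<close> is a set of representatives of the double cosets \<open>L\H/K\<close>.\<close>

definition double_coset_reps ::
  "('g, 'n) monoid_scheme \<Rightarrow> 'g set \<Rightarrow> 'g set \<Rightarrow> 'g set \<Rightarrow> 'g set \<Rightarrow> bool"
where
  "double_coset_reps G L H K D \<longleftrightarrow>
    D \<subseteq> H \<and> (\<forall>x\<in>H. \<exists>!h. h \<in> D \<and> x \<in> (L #>\<^bsub>G\<^esub> h) <#>\<^bsub>G\<^esub> K)"

text \<open>
  \<open>Tr K H\<close>, \<open>Res K H\<close> and \<open>Con g H\<close> stand for \<open>t\<^sup>K\<^sub>H\<close>, \<open>r\<^sup>K\<^sub>H\<close> and \<open>c\<^bsub>g,H\<^esub>\<close>;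
  in the first two the larger group comes first.
\<close>

datatype 'g mackey_gen = Tr "'g set" "'g set" | Res "'g set" "'g set" | Con 'g "'g set"

definition mackey_gens :: "('g, 'n) monoid_scheme \<Rightarrow> 'g mackey_gen set" where
  "mackey_gens G =
    {Tr K H | K H. subgroup H G \<and> subgroup K G \<and> H \<subseteq> K} \<union>
    {Res K H | K H. subgroup H G \<and> subgroup K G \<and> H \<subseteq> K} \<union>
    {Con g H | g H. g \<in> carrier G \<and> subgroup H G}"

text \<open>
  Each generator is regarded as an arrow between subgroups: \<open>t\<^sup>K\<^sub>H : H \<rightarrow> K\<close>, \<open>r\<^sup>K\<^sub>H : K \<rightarrow> H\<close> and
  \<open>c\<^bsub>g,H\<^esub> : H \<rightarrow> gHg\<inverse>\<close>, composed from right to left.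
\<close>

primrec gen_source :: "'g mackey_gen \<Rightarrow> 'g set" where
  "gen_source (Tr K H) = H"
| "gen_source (Res K H) = K"
| "gen_source (Con g H) = H"

primrec gen_target :: "('g, 'n) monoid_scheme \<Rightarrow> 'g mackey_gen \<Rightarrow> 'g set" where
  "gen_target G (Tr K H) = K"
| "gen_target G (Res K H) = H"
| "gen_target G (Con g H) = conj_subgroup G g H"

context
  fixes R :: "('r, 'm) ring_scheme" and G :: "('g, 'n) monoid_scheme"
begin

abbreviation (input) "F \<equiv> free_algebra R (mackey_gens G)"
abbreviation (input) "t K H \<equiv> letter R (Tr K H)"
abbreviation (input) "r K H \<equiv> letter R (Res K H)"
abbreviation (input) "c g H \<equiv> letter R (Con g H)"

text \<open>
  In the Mackey formula any system of double coset representatives is allowed; by the other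
  relations the right-hand side does not depend on it.

  The vanishing of ``all other products of generators'' is the vanishing of the products of
  non-composable arrows. The composable products \<open>t\<^sup>K\<^sub>H r\<^sup>L\<^sub>H\<close> are not rewritten by any
  relation, but they are not meant to vanish.
\<close>

inductive mackey_rel :: "('g mackey_gen list \<Rightarrow> 'r) \<Rightarrow> ('g mackey_gen list \<Rightarrow> 'r) \<Rightarrow> bool" where
  unit: "mackey_rel (\<Oplus>\<^bsub>F\<^esub>H\<in>{H. subgroup H G}. t H H) \<one>\<^bsub>F\<^esub>"
| tr_res_refl: "subgroup H G \<Longrightarrow> mackey_rel (t H H) (r H H)"
| tr_con_refl: "\<lbrakk>subgroup H G; h \<in> H\<rbrakk> \<Longrightarrow> mackey_rel (t H H) (c h H)"
| tr_tr: "\<lbrakk>subgroup H G; subgroup K G; subgroup L G; H \<subseteq> K; K \<subseteq> L\<rbrakk>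
    \<Longrightarrow> mackey_rel (t L K \<otimes>\<^bsub>F\<^esub> t K H) (t L H)"
| res_res: "\<lbrakk>subgroup H G; subgroup K G; subgroup L G; H \<subseteq> K; K \<subseteq> L\<rbrakk>
    \<Longrightarrow> mackey_rel (r K H \<otimes>\<^bsub>F\<^esub> r L K) (r L H)"
| con_con: "\<lbrakk>subgroup H G; g \<in> carrier G; g' \<in> carrier G\<rbrakk>
    \<Longrightarrow> mackey_rel (c g' (conj_subgroup G g H) \<otimes>\<^bsub>F\<^esub> c g H) (c (g' \<otimes>\<^bsub>G\<^esub> g) H)"
| tr_con: "\<lbrakk>subgroup H G; subgroup K G; H \<subseteq> K; g \<in> carrier G\<rbrakk>
    \<Longrightarrow> mackey_rel (t (conj_subgroup G g K) (conj_subgroup G g H) \<otimes>\<^bsub>F\<^esub> c g H)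
                   (c g K \<otimes>\<^bsub>F\<^esub> t K H)"
| res_con: "\<lbrakk>subgroup H G; subgroup K G; H \<subseteq> K; g \<in> carrier G\<rbrakk>
    \<Longrightarrow> mackey_rel (r (conj_subgroup G g K) (conj_subgroup G g H) \<otimes>\<^bsub>F\<^esub> c g K)
                   (c g H \<otimes>\<^bsub>F\<^esub> r K H)"
| mackey: "\<lbrakk>subgroup H G; subgroup K G; subgroup L G; K \<subseteq> H; L \<subseteq> H; double_coset_reps G L H K D\<rbrakk>
    \<Longrightarrow> mackey_rel (r H L \<otimes>\<^bsub>F\<^esub> t H K)
          (\<Oplus>\<^bsub>F\<^esub>h\<in>D. t L (L \<inter> conj_subgroup G h K)
                   \<otimes>\<^bsub>F\<^esub> c h (conj_subgroup G (inv\<^bsub>G\<^esub> h) L \<inter> K)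
                   \<otimes>\<^bsub>F\<^esub> r K (conj_subgroup G (inv\<^bsub>G\<^esub> h) L \<inter> K))"
| other: "\<lbrakk>x \<in> mackey_gens G; y \<in> mackey_gens G; gen_source x \<noteq> gen_target G y\<rbrakk>
    \<Longrightarrow> mackey_rel (letter R x \<otimes>\<^bsub>F\<^esub> letter R y) \<zero>\<^bsub>F\<^esub>"

definition mackey_algebra :: "('r, ('g mackey_gen list \<Rightarrow> 'r) set) module" where
  "mackey_algebra = presented_algebra R (mackey_gens G) mackey_rel"

end

end

theory Submission
  imports "HOL-Algebra.Sylow" "HOL-Algebra.Multiplicative_Group" Defs
begin

text \<open>
  The Mackey algebra is the algebra of spans of the transitive \<open>G\<close>-sets \<open>G / H\<close>. The span with left
  leg \<open>H\<close>, right leg \<open>K\<close> and apex \<open>A \<le> H \<inter> gKg\<^sup>-\<^sup>1\<close> is \<open>t\<^sup>H\<^sub>A c\<^sub>g r\<^sup>K\<close>; it depends only on the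
  \<open>H\<close>-orbit of the pair \<open>(A, g K)\<close>, and such classes form a basis. In terms of \<open>\<bar>A\<bar> t\<^sup>H\<^sub>A c\<^sub>g r\<^sup>K\<close>
  every sum over double cosets becomes a sum over a group, which makes the relations and the products
  transparent.

  A linear form \<open>\<phi>\<close> on the Burnside ring of \<open>G\<close> gives the trace with value \<open>\<phi>(G / A)\<close> on the span
  \<open>(H, A, g K)\<close> if \<open>g K = H\<close>, and zero otherwise. The pairing of \<open>H\<close>-\<open>K\<close>-spans with \<open>K\<close>-\<open>H\<close>-spans splits
  over the double cosets \<open>H g K\<close> into the forms \<open>(X, Y) \<mapsto> \<phi>(Ind (X \<times> Y))\<close> on the Burnside rings of
  \<open>L = H \<inter> gKg\<^sup>-\<^sup>1\<close>. If \<open>p\<^sup>2\<close> does not divide \<open>\<bar>G\<bar>\<close>, then \<open>\<phi>\<close> can be chosen with all of these forms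
  unimodular. If \<open>p\<^sup>2\<close> divides \<open>\<bar>G\<bar>\<close>, take \<open>L\<close> of order \<open>p\<^sup>2\<close>: whatever \<open>\<phi>\<close> is, its form on the
  Burnside ring of \<open>L\<close> is degenerate modulo \<open>p\<close>.
\<close>


section \<open>Free algebras\<close>

text \<open>A presentation bounds the algebra only from above; the obstacle is linear independence
  of the spans. No model algebra is built: the generators act on invariant integer functions, and
  checking the relations there gives enough linear forms on the quotient. Integers are used so that
  group orders, which may not be invertible in R, can be cancelled.

  The form \<phi> is (1/p) times the sum over D \<le> G of \<open>weight D\<close> times the number
  of D-fixed points. If D has a normal p-complement J, the fixed point numbers of J and D agree
  modulo p, so the weights 1 and -1 give integral quotients of differences by p. Weight p cancels
  1/p on the other D of order divisible by p, and the subgroups of order prime to p without such a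
  partner are permuted in orbits of length p by an element of order p. As n is a unit, unimodularity
  is needed only up to powers of n.

  If the square of p divides the order, R/pR need not be a field, so ranks are of no use. Two
  elements are shown to be degenerate modulo p in turn: the first forces \<phi>(G / 1) into pR, and
  then the free orbit becomes degenerate as well.\<close>

definition word :: "('r, 'm) ring_scheme \<Rightarrow> 'x list \<Rightarrow> 'x list \<Rightarrow> 'r" where
  "word R v = (\<lambda>w. if w = v then \<one>\<^bsub>R\<^esub> else \<zero>\<^bsub>R\<^esub>)"

lemma letter_eq_word: "letter R x = word R [x]"
  by (simp add: letter_def word_def)

text \<open>Both sides run over the pairs of cuts \<open>j \<le> i\<close> of a word of length
  \<open>n\<close>; the exchange is associativity of the product in a free algebra.\<close>

lemma (in abelian_monoid) finsum_triangle:
  fixes T :: "nat \<Rightarrow> nat \<Rightarrow> 'a"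
  assumes "\<And>i j. T i j \<in> carrier G"
  shows "(\<Oplus>i\<in>{..n}. \<Oplus>j\<in>{..i}. T j i) = (\<Oplus>j\<in>{..n}. \<Oplus>k\<in>{..n - j}. T j (j + k))"
proof (induction n)
  case 0
  then show ?case using assms by simp
next
  case (Suc n)
  have "(\<Oplus>j\<in>{..Suc n}. \<Oplus>k\<in>{..Suc n - j}. T j (j + k))
      = T (Suc n) (Suc n) \<oplus> (\<Oplus>j\<in>{..n}. \<Oplus>k\<in>{..Suc n - j}. T j (j + k))"
    using assms by (simp add: Pi_def)
  also have "(\<Oplus>j\<in>{..n}. \<Oplus>k\<in>{..Suc n - j}. T j (j + k))
      = (\<Oplus>j\<in>{..n}. T j (Suc n) \<oplus> (\<Oplus>k\<in>{..n - j}. T j (j + k)))"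
    using assms by (intro add.finprod_cong') (auto simp: Suc_diff_le Pi_def)
  also have "\<dots> = (\<Oplus>j\<in>{..n}. T j (Suc n)) \<oplus> (\<Oplus>j\<in>{..n}. \<Oplus>k\<in>{..n - j}. T j (j + k))"
    using assms by (intro finsum_addf) (auto simp: Pi_def)
  also have "(\<Oplus>j\<in>{..n}. \<Oplus>k\<in>{..n - j}. T j (j + k)) = (\<Oplus>i\<in>{..n}. \<Oplus>j\<in>{..i}. T j i)"
    using Suc by simp
  also have "T (Suc n) (Suc n) \<oplus> ((\<Oplus>j\<in>{..n}. T j (Suc n)) \<oplus> (\<Oplus>i\<in>{..n}. \<Oplus>j\<in>{..i}. T j i))
     = (\<Oplus>i\<in>{..Suc n}. \<Oplus>j\<in>{..i}. T j i)"
    using assms by (simp add: Pi_def a_assoc)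
  finally show ?case by simp
qed

context cring
begin

lemma free_module_carrier_iff:
  "f \<in> carrier (free_module R X) \<longleftrightarrow>
    (\<forall>x. f x \<in> carrier R) \<and> finite {x. f x \<noteq> \<zero>} \<and> (\<forall>x. x \<notin> X \<longrightarrow> f x = \<zero>)"
  by (simp add: free_module_def)

lemma finite_support_add:
  assumes "finite {x. f x \<noteq> \<zero>}" "finite {x. g x \<noteq> \<zero>}"
  shows "finite {x. f x \<oplus> g x \<noteq> \<zero>}"
proof -
  have "{x. f x \<oplus> g x \<noteq> \<zero>} \<subseteq> {x. f x \<noteq> \<zero>} \<union> {x. g x \<noteq> \<zero>}"
    by auto
  then show ?thesis by (rule finite_subset) (use assms in simp)
qed

lemma finite_support_smult:
  assumes "finite {x. f x \<noteq> \<zero>}" "a \<in> carrier R"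
  shows "finite {x. a \<otimes> f x \<noteq> \<zero>}"
  by (rule finite_subset[OF _ assms(1)]) (use assms in auto)

lemma free_module_simps [simp]:
  "add (free_module R X) = (\<lambda>f g x. f x \<oplus> g x)"
  "zero (free_module R X) = (\<lambda>x. \<zero>)"
  "smult (free_module R X) = (\<lambda>a f x. a \<otimes> f x)"
  by (simp_all add: free_module_def)

lemma free_module_abelian_group: "abelian_group (free_module R X)"
proof (rule abelian_groupI)
  let ?M = "free_module R X"
  fix f assume f: "f \<in> carrier ?M"
  then have "{x. \<ominus> f x \<noteq> \<zero>} \<subseteq> {x. f x \<noteq> \<zero>}" by auto
  with f have "finite {x. \<ominus> f x \<noteq> \<zero>}"
    by (auto simp: free_module_carrier_iff intro: finite_subset)
  with f have "(\<lambda>x. \<ominus> f x) \<in> carrier ?M"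
    by (simp add: free_module_carrier_iff)
  then show "\<exists>g\<in>carrier ?M. g \<oplus>\<^bsub>?M\<^esub> f = \<zero>\<^bsub>?M\<^esub>"
    by (rule bexI[rotated]) (use f in \<open>auto simp: free_module_carrier_iff l_neg\<close>)
qed (auto simp: free_module_carrier_iff finite_support_add a_ac)

lemma free_module_module: "module R (free_module R X)"
  by (rule moduleI) (auto simp: is_cring free_module_abelian_group finite_support_smult
      free_module_carrier_iff l_distr r_distr m_assoc)

lemma free_algebra_simps [simp]:
  "carrier (free_algebra R X) = carrier (free_module R (lists X))"
  "add (free_algebra R X) = (\<lambda>f g x. f x \<oplus> g x)"
  "zero (free_algebra R X) = (\<lambda>x. \<zero>)"
  "smult (free_algebra R X) = (\<lambda>a f x. a \<otimes> f x)"
  "one (free_algebra R X) = word R []"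
  "monoid.mult (free_algebra R X) = (\<lambda>f g w. \<Oplus>i\<in>{..length w}. f (take i w) \<otimes> g (drop i w))"
  by (simp_all add: free_algebra_def free_module_def word_def)

lemma word_closed: "w \<in> lists X \<Longrightarrow> word R w \<in> carrier (free_algebra R X)"
  by (auto simp: word_def free_module_carrier_iff)

lemma free_algebra_mult_closed:
  assumes f: "f \<in> carrier (free_algebra R X)" and g: "g \<in> carrier (free_algebra R X)"
  shows "f \<otimes>\<^bsub>free_algebra R X\<^esub> g \<in> carrier (free_algebra R X)"
proof -
  let ?h = "\<lambda>w. \<Oplus>i\<in>{..length w}. f (take i w) \<otimes> g (drop i w)"
  have fg: "f w \<in> carrier R" "g w \<in> carrier R" for w
    using f g by (simp_all add: free_module_carrier_iff)
  have nz: "\<exists>i\<le>length w. f (take i w) \<noteq> \<zero> \<and> g (drop i w) \<noteq> \<zero>" if "?h w \<noteq> \<zero>" for w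
  proof (rule ccontr)
    assume "\<not> ?thesis"
    then have "?h w = (\<Oplus>i\<in>{..length w}. \<zero>)"
      by (intro add.finprod_cong') (use fg in auto)
    then show False using that by simp
  qed
  have "{w. ?h w \<noteq> \<zero>} \<subseteq> (\<lambda>(u, v). u @ v) ` ({w. f w \<noteq> \<zero>} \<times> {w. g w \<noteq> \<zero>})"
  proof
    fix w assume "w \<in> {w. ?h w \<noteq> \<zero>}"
    then obtain i where "f (take i w) \<noteq> \<zero>" "g (drop i w) \<noteq> \<zero>"
      using nz by blast
    then have "(take i w, drop i w) \<in> {w. f w \<noteq> \<zero>} \<times> {w. g w \<noteq> \<zero>}" by simp
    moreover have "w = (\<lambda>(u, v). u @ v) (take i w, drop i w)" by simp
    ultimately show "w \<in> (\<lambda>(u, v). u @ v) ` ({w. f w \<noteq> \<zero>} \<times> {w. g w \<noteq> \<zero>})"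
      by (rule rev_image_eqI)
  qed
  moreover have "finite ((\<lambda>(u, v). u @ v) ` ({w. f w \<noteq> \<zero>} \<times> {w. g w \<noteq> \<zero>}))"
    using f g by (simp add: free_module_carrier_iff)
  ultimately have "finite {w. ?h w \<noteq> \<zero>}" by (rule finite_subset)
  moreover have "?h w = \<zero>" if "w \<notin> lists X" for w
  proof (rule ccontr)
    assume "?h w \<noteq> \<zero>"
    then obtain i where "f (take i w) \<noteq> \<zero>" "g (drop i w) \<noteq> \<zero>"
      using nz by blast
    then have "take i w \<in> lists X" "drop i w \<in> lists X"
      using f g by (auto simp: free_module_carrier_iff)
    then have "take i w @ drop i w \<in> lists X"
      by (metis append_in_lists_conv)
    then show False using that by simp
  qed
  moreover have "?h w \<in> carrier R" for w
    using fg by simp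
  ultimately show ?thesis
    by (simp add: free_module_carrier_iff)
qed

lemma free_algebra_m_assoc:
  assumes "\<And>w. f w \<in> carrier R" "\<And>w. g w \<in> carrier R" "\<And>w. h w \<in> carrier R"
  shows "(f \<otimes>\<^bsub>free_algebra R X\<^esub> g) \<otimes>\<^bsub>free_algebra R X\<^esub> h
    = f \<otimes>\<^bsub>free_algebra R X\<^esub> (g \<otimes>\<^bsub>free_algebra R X\<^esub> h)"
proof -
  have "(\<Oplus>i\<in>{..length w}. (\<Oplus>j\<in>{..length (take i w)}.
            f (take j (take i w)) \<otimes> g (drop j (take i w))) \<otimes> h (drop i w))
      = (\<Oplus>j\<in>{..length w}. f (take j w) \<otimes> (\<Oplus>k\<in>{..length (drop j w)}.
            g (take k (drop j w)) \<otimes> h (drop k (drop j w))))" (is "?l = ?r") for w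
  proof -
    define T where "T j i = f (take j w) \<otimes> g (take (i - j) (drop j w)) \<otimes> h (drop i w)" for j i
    have T: "T j i \<in> carrier R" for i j using assms by (simp add: T_def)
    have "?l = (\<Oplus>i\<in>{..length w}. \<Oplus>j\<in>{..i}. T j i)"
    proof (intro add.finprod_cong')
      fix i assume i: "i \<in> {..length w}"
      have "(\<Oplus>j\<in>{..length (take i w)}. f (take j (take i w)) \<otimes> g (drop j (take i w))) \<otimes> h (drop i w)
        = (\<Oplus>j\<in>{..i}. (f (take j (take i w)) \<otimes> g (drop j (take i w))) \<otimes> h (drop i w))"
        using i assms by (subst finsum_ldistr) (auto simp: min_def)
      also have "\<dots> = (\<Oplus>j\<in>{..i}. T j i)"
        by (intro add.finprod_cong') (use assms in \<open>auto simp: T_def drop_take min_def\<close>)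
      finally show "(\<Oplus>j\<in>{..length (take i w)}. f (take j (take i w)) \<otimes> g (drop j (take i w))) \<otimes> h (drop i w)
         = (\<Oplus>j\<in>{..i}. T j i)" .
    qed (use T in auto)
    also have "\<dots> = (\<Oplus>j\<in>{..length w}. \<Oplus>k\<in>{..length w - j}. T j (j + k))"
      by (rule finsum_triangle) (rule T)
    also have "\<dots> = ?r"
    proof (intro add.finprod_cong')
      fix j assume j: "j \<in> {..length w}"
      have "(\<Oplus>k\<in>{..length w - j}. T j (j + k))
        = (\<Oplus>k\<in>{..length (drop j w)}. f (take j w) \<otimes> (g (take k (drop j w)) \<otimes> h (drop k (drop j w))))"
        by (intro add.finprod_cong') (use assms in \<open>auto simp: T_def m_assoc add.commute\<close>)
      also have "\<dots> = f (take j w) \<otimes> (\<Oplus>k\<in>{..length (drop j w)}.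
            g (take k (drop j w)) \<otimes> h (drop k (drop j w)))"
        using assms by (subst finsum_rdistr) auto
      finally show "(\<Oplus>k\<in>{..length w - j}. T j (j + k))
         = f (take j w) \<otimes> (\<Oplus>k\<in>{..length (drop j w)}. g (take k (drop j w)) \<otimes> h (drop k (drop j w)))" .
    qed (use assms in auto)
    finally show ?thesis .
  qed
  then show ?thesis by auto
qed

lemma word_mult_word:
  "word R u \<otimes>\<^bsub>free_algebra R X\<^esub> word R v = word R (u @ v)"
proof
  fix w :: "'c list"
  have eq: "word R u (take i w) \<otimes> word R v (drop i w)
      = (if length u = i then word R (u @ v) w else \<zero>)" if "i \<le> length w" for i
  proof -
    have "take i w = u \<and> drop i w = v \<longleftrightarrow> length u = i \<and> w = u @ v"
      using that by (auto simp: append_eq_conv_conj)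
    then show ?thesis by (auto simp: word_def)
  qed
  have "(\<Oplus>i\<in>{..length w}. word R u (take i w) \<otimes> word R v (drop i w))
      = (\<Oplus>i\<in>{..length w}. if length u = i then word R (u @ v) w else \<zero>)"
    by (intro add.finprod_cong') (auto simp: eq word_def)
  also have "\<dots> = word R (u @ v) w"
  proof (cases "length u \<le> length w")
    case True
    then show ?thesis by (subst add.finprod_singleton) (auto simp: word_def)
  next
    case False
    then have "(\<Oplus>i\<in>{..length w}. if length u = i then word R (u @ v) w else \<zero>) = (\<Oplus>i\<in>{..length w}. \<zero>)"
      by (intro add.finprod_cong') auto
    also have "\<dots> = word R (u @ v) w" using False by (auto simp: word_def)
    finally show ?thesis .
  qed
  finally show "(word R u \<otimes>\<^bsub>free_algebra R X\<^esub> word R v) w = word R (u @ v) w"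
    by simp
qed

lemma word_Nil_mult:
  assumes "\<And>w. f w \<in> carrier R"
  shows "word R [] \<otimes>\<^bsub>free_algebra R X\<^esub> f = f"
    and "f \<otimes>\<^bsub>free_algebra R X\<^esub> word R [] = f"
proof -
  have "(\<Oplus>i\<in>{..length w}. word R [] (take i w) \<otimes> f (drop i w)) = f w" for w
  proof -
    have "(\<Oplus>i\<in>{..length w}. word R [] (take i w) \<otimes> f (drop i w))
      = (\<Oplus>i\<in>{..length w}. if 0 = i then f w else \<zero>)"
      by (intro add.finprod_cong') (auto simp: word_def assms)
    also have "\<dots> = f w" by (subst add.finprod_singleton) (auto simp: assms)
    finally show ?thesis .
  qed
  then show "word R [] \<otimes>\<^bsub>free_algebra R X\<^esub> f = f" by auto
  have "(\<Oplus>i\<in>{..length w}. f (take i w) \<otimes> word R [] (drop i w)) = f w" for w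
  proof -
    have "(\<Oplus>i\<in>{..length w}. f (take i w) \<otimes> word R [] (drop i w))
      = (\<Oplus>i\<in>{..length w}. if length w = i then f w else \<zero>)"
      by (intro add.finprod_cong') (auto simp: word_def assms)
    also have "\<dots> = f w" by (subst add.finprod_singleton) (auto simp: assms)
    finally show ?thesis .
  qed
  then show "f \<otimes>\<^bsub>free_algebra R X\<^esub> word R [] = f" by auto
qed

lemma free_algebra_assoc_algebra: "assoc_algebra R (free_algebra R X)"
proof -
  let ?F = "free_algebra R X"
  have c: "f w \<in> carrier R" if "f \<in> carrier ?F" for f w
    using that by (simp add: free_module_carrier_iff)
  have ab: "abelian_group ?F"
  proof (rule abelian_groupI)
    fix f assume f: "f \<in> carrier ?F"
    interpret N: abelian_group "free_module R (lists X)" by (rule free_module_abelian_group)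
    show "\<exists>g\<in>carrier ?F. g \<oplus>\<^bsub>?F\<^esub> f = \<zero>\<^bsub>?F\<^esub>"
      using N.l_neg[of f] N.a_inv_closed[of f] f by auto
  qed (auto simp: free_module_carrier_iff finite_support_add a_ac)
  have mod: "module R ?F"
    by (rule moduleI)
      (auto simp: is_cring ab finite_support_smult free_module_carrier_iff l_distr r_distr m_assoc)
  have rng: "ring ?F"
  proof (rule ringI)
    show "abelian_group ?F" by (rule ab)
    show "monoid ?F"
    proof (rule monoidI)
      fix f g h assume "f \<in> carrier ?F" "g \<in> carrier ?F" "h \<in> carrier ?F"
      then show "f \<otimes>\<^bsub>?F\<^esub> g \<otimes>\<^bsub>?F\<^esub> h = f \<otimes>\<^bsub>?F\<^esub> (g \<otimes>\<^bsub>?F\<^esub> h)"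
        by (intro free_algebra_m_assoc) (auto simp: free_module_carrier_iff)
    next
      fix f assume "f \<in> carrier ?F"
      then show "\<one>\<^bsub>?F\<^esub> \<otimes>\<^bsub>?F\<^esub> f = f" "f \<otimes>\<^bsub>?F\<^esub> \<one>\<^bsub>?F\<^esub> = f"
        using word_Nil_mult[of f X] c[of f] by (simp_all del: free_algebra_simps(1,6))
    qed (use free_algebra_mult_closed word_closed[of "[]" X] in auto)
  next
    fix f g h assume fgh: "f \<in> carrier ?F" "g \<in> carrier ?F" "h \<in> carrier ?F"
    show "(f \<oplus>\<^bsub>?F\<^esub> g) \<otimes>\<^bsub>?F\<^esub> h = f \<otimes>\<^bsub>?F\<^esub> h \<oplus>\<^bsub>?F\<^esub> g \<otimes>\<^bsub>?F\<^esub> h"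
      "h \<otimes>\<^bsub>?F\<^esub> (f \<oplus>\<^bsub>?F\<^esub> g) = h \<otimes>\<^bsub>?F\<^esub> f \<oplus>\<^bsub>?F\<^esub> h \<otimes>\<^bsub>?F\<^esub> g"
      using c[OF fgh(1)] c[OF fgh(2)] c[OF fgh(3)]
      by (auto simp: l_distr r_distr Pi_def fun_eq_iff finsum_addf)
  qed
  show ?thesis
  proof (rule assoc_algebra.intro[OF mod rng], unfold_locales)
    fix a f g assume afg: "a \<in> carrier R" "f \<in> carrier ?F" "g \<in> carrier ?F"
    show "(a \<odot>\<^bsub>?F\<^esub> f) \<otimes>\<^bsub>?F\<^esub> g = a \<odot>\<^bsub>?F\<^esub> (f \<otimes>\<^bsub>?F\<^esub> g)"
      using afg(1) c[OF afg(2)] c[OF afg(3)] by (auto simp: m_assoc finsum_rdistr fun_eq_iff)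
    show "f \<otimes>\<^bsub>?F\<^esub> (a \<odot>\<^bsub>?F\<^esub> g) = a \<odot>\<^bsub>?F\<^esub> (f \<otimes>\<^bsub>?F\<^esub> g)"
      using afg(1) c[OF afg(2)] c[OF afg(3)] by (auto simp: m_lcomm finsum_rdistr fun_eq_iff)
  qed
qed

lemma free_algebra_induct [consumes 1, case_names zero add word]:
  assumes f: "f \<in> carrier (free_algebra R X)"
    and zero: "P \<zero>\<^bsub>free_algebra R X\<^esub>"
    and add: "\<And>f g. \<lbrakk>f \<in> carrier (free_algebra R X); g \<in> carrier (free_algebra R X); P f; P g\<rbrakk>
        \<Longrightarrow> P (f \<oplus>\<^bsub>free_algebra R X\<^esub> g)"
    and word: "\<And>a w. \<lbrakk>a \<in> carrier R; w \<in> lists X\<rbrakk> \<Longrightarrow> P (a \<odot>\<^bsub>free_algebra R X\<^esub> word R w)"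
  shows "P f"
proof -
  have "P f" if "finite S" "f \<in> carrier (free_algebra R X)" "{w. f w \<noteq> \<zero>} \<subseteq> S" for S f
    using that
  proof (induction S arbitrary: f rule: finite_induct)
    case empty
    then have "f = \<zero>\<^bsub>free_algebra R X\<^esub>" by auto
    then show ?case using zero by simp
  next
    case (insert v S)
    have fc: "f w \<in> carrier R" for w using insert.prems by (simp add: free_module_carrier_iff)
    show ?case
    proof (cases "v \<in> lists X")
      case False
      then have "f v = \<zero>" using insert.prems by (simp add: free_module_carrier_iff)
      then have "{w. f w \<noteq> \<zero>} \<subseteq> S" using insert.prems by auto
      then show ?thesis using insert by blast
    next
      case True
      let ?g = "f(v := \<zero>)"
      have "finite {w. ?g w \<noteq> \<zero>}"
        by (rule finite_subset[of _ S]) (use insert in auto)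
      then have g: "?g \<in> carrier (free_algebra R X)"
        using insert.prems by (auto simp: free_module_carrier_iff)
      have "P ?g"
        by (rule insert.IH[OF g]) (use insert.prems in auto)
      moreover have "f = ?g \<oplus>\<^bsub>free_algebra R X\<^esub> (f v \<odot>\<^bsub>free_algebra R X\<^esub> word R v)"
        using fc by (auto simp: word_def)
      moreover have "f v \<odot>\<^bsub>free_algebra R X\<^esub> word R v \<in> carrier (free_algebra R X)"
        using word_closed[OF True] fc by (auto simp: free_module_carrier_iff finite_support_smult)
      ultimately show ?thesis
        using add[OF g _ \<open>P ?g\<close> word[of "f v" v]] fc True by metis
    qed
  qed
  from this[of "{w. f w \<noteq> \<zero>}" f] f show ?thesis
    by (simp add: free_module_carrier_iff)
qed

definition linear_ext :: "('x list \<Rightarrow> 'a) \<Rightarrow> ('x list \<Rightarrow> 'a) \<Rightarrow> 'a" where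
  "linear_ext l f = (\<Oplus>w\<in>{w. f w \<noteq> \<zero>}. f w \<otimes> l w)"

lemma linear_ext_superset:
  assumes "finite S" "{w. f w \<noteq> \<zero>} \<subseteq> S" "\<And>w. f w \<in> carrier R" "\<And>w. l w \<in> carrier R"
  shows "linear_ext l f = (\<Oplus>w\<in>S. f w \<otimes> l w)"
  unfolding linear_ext_def
  by (rule add.finprod_mono_neutral_cong_left) (use assms in auto)

lemma linear_ext_hom:
  assumes l: "\<And>w. l w \<in> carrier R"
  shows "linear_ext l \<in> module_hom R (free_algebra R X) (regular_module R)"
proof -
  let ?F = "free_algebra R X"
  have fin: "finite {w. f w \<noteq> \<zero>}" and c: "\<And>w. f w \<in> carrier R" if "f \<in> carrier ?F" for f
    using that by (simp_all add: free_module_carrier_iff)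
  have "linear_ext l (f \<oplus>\<^bsub>?F\<^esub> g) = linear_ext l f \<oplus> linear_ext l g"
    if fg: "f \<in> carrier ?F" "g \<in> carrier ?F" for f g
  proof -
    let ?S = "{w. f w \<noteq> \<zero>} \<union> {w. g w \<noteq> \<zero>}"
    have S: "finite ?S" using fin fg by blast
    note cf = c[OF fg(1)] and cg = c[OF fg(2)]
    have "linear_ext l (f \<oplus>\<^bsub>?F\<^esub> g) = (\<Oplus>w\<in>?S. (f w \<oplus> g w) \<otimes> l w)"
      by (subst linear_ext_superset[of ?S]) (use S cf cg l in auto)
    also have "\<dots> = (\<Oplus>w\<in>?S. f w \<otimes> l w \<oplus> g w \<otimes> l w)"
      by (intro add.finprod_cong') (use cf cg l in \<open>auto simp: l_distr\<close>)
    also have "\<dots> = (\<Oplus>w\<in>?S. f w \<otimes> l w) \<oplus> (\<Oplus>w\<in>?S. g w \<otimes> l w)"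
      by (intro finsum_addf) (use cf cg l in auto)
    also have "(\<Oplus>w\<in>?S. f w \<otimes> l w) = linear_ext l f"
      by (rule linear_ext_superset[symmetric]) (use S cf l in auto)
    also have "(\<Oplus>w\<in>?S. g w \<otimes> l w) = linear_ext l g"
      by (rule linear_ext_superset[symmetric]) (use S cg l in auto)
    finally show ?thesis .
  qed
  moreover have "linear_ext l (a \<odot>\<^bsub>?F\<^esub> f) = a \<otimes> linear_ext l f"
    if af: "a \<in> carrier R" "f \<in> carrier ?F" for a f
  proof -
    let ?S = "{w. f w \<noteq> \<zero>}"
    note cf = c[OF af(2)]
    have "linear_ext l (a \<odot>\<^bsub>?F\<^esub> f) = (\<Oplus>w\<in>?S. (a \<otimes> f w) \<otimes> l w)"
      by (subst linear_ext_superset[of ?S]) (use fin[OF af(2)] cf af l in auto)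
    also have "\<dots> = (\<Oplus>w\<in>?S. a \<otimes> (f w \<otimes> l w))"
      by (intro add.finprod_cong') (use cf af l in \<open>auto simp: m_assoc\<close>)
    also have "\<dots> = a \<otimes> linear_ext l f"
      unfolding linear_ext_def using fin[OF af(2)] cf af l by (subst finsum_rdistr) auto
    finally show ?thesis .
  qed
  moreover have "linear_ext l f \<in> carrier R" if "f \<in> carrier ?F" for f
    unfolding linear_ext_def using c[OF that] l by auto
  ultimately show ?thesis
    by (auto simp: module_hom_def regular_module_def simp del: free_algebra_simps)
qed

lemma linear_ext_word: "l w \<in> carrier R \<Longrightarrow> linear_ext l (word R w) = l w"
proof -
  assume l: "l w \<in> carrier R"
  have "linear_ext l (word R w) = (\<Oplus>v\<in>{v. v = w \<and> \<one> \<noteq> \<zero>}. l w)"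
    unfolding linear_ext_def word_def by (intro add.finprod_cong') (use l in auto)
  also have "\<dots> = l w"
  \<comment> \<open>In the zero ring a word has empty support, but there \<open>l w\<close> is zero
    as well.\<close>
  proof (cases "\<one> = \<zero>")
    case True
    then show ?thesis using l one_zeroD by auto
  next
    case False
    then have "{v. v = w \<and> \<one> \<noteq> \<zero>} = {w}" by auto
    then show ?thesis using l by simp
  qed
  finally show ?thesis .
qed

end

section \<open>Quotients and symmetrizing forms\<close>

lemma quotient_algebra_simps [simp]:
  "carrier (quotient_algebra A I) = a_rcosets\<^bsub>A\<^esub> I"
  "monoid.mult (quotient_algebra A I) = rcoset_mult A I"
  "one (quotient_algebra A I) = I +>\<^bsub>A\<^esub> \<one>\<^bsub>A\<^esub>"
  "zero (quotient_algebra A I) = I"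
  "add (quotient_algebra A I) = set_add A"
  "smult (quotient_algebra A I) = (\<lambda>a C. \<Union>x\<in>C. I +>\<^bsub>A\<^esub> (a \<odot>\<^bsub>A\<^esub> x))"
  by (simp_all add: quotient_algebra_def ring.extend_def module.fields_def FactRing_def)

lemma (in assoc_algebra) ideal_smult_closed:
  assumes "ideal I A" "a \<in> carrier R" "x \<in> I"
  shows "a \<odot>\<^bsub>A\<^esub> x \<in> I"
proof -
  interpret I: ideal I A by fact
  have x: "x \<in> carrier A" using assms(3) I.a_subset by auto
  have "(a \<odot>\<^bsub>A\<^esub> \<one>\<^bsub>A\<^esub>) \<otimes>\<^bsub>A\<^esub> x \<in> I"
    using assms x by (intro I.I_l_closed) auto
  then show ?thesis
    using assms x by (simp add: smult_mult_left)
qed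

lemma (in assoc_algebra) quotient_smult:
  assumes "ideal I A" "a \<in> carrier R" "x \<in> carrier A"
  shows "a \<odot>\<^bsub>quotient_algebra A I\<^esub> (I +>\<^bsub>A\<^esub> x) = I +>\<^bsub>A\<^esub> (a \<odot>\<^bsub>A\<^esub> x)"
proof -
  interpret I: ideal I A by fact
  have "I +>\<^bsub>A\<^esub> (a \<odot>\<^bsub>A\<^esub> y) = I +>\<^bsub>A\<^esub> (a \<odot>\<^bsub>A\<^esub> x)" if y: "y \<in> I +>\<^bsub>A\<^esub> x" for y
  proof -
    obtain i where i: "i \<in> I" "y = i \<oplus>\<^bsub>A\<^esub> x"
      using y by (auto simp: a_r_coset_def r_coset_def)
    then have "i \<in> carrier A" using I.a_subset by auto
    then have "a \<odot>\<^bsub>A\<^esub> y = a \<odot>\<^bsub>A\<^esub> i \<oplus>\<^bsub>A\<^esub> a \<odot>\<^bsub>A\<^esub> x"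
      using i assms by (simp add: smult_r_distr)
    then have "a \<odot>\<^bsub>A\<^esub> y \<in> I +>\<^bsub>A\<^esub> (a \<odot>\<^bsub>A\<^esub> x)"
      using ideal_smult_closed[OF assms(1,2) i(1)] by (auto simp: a_r_coset_def r_coset_def)
    then show ?thesis
      using assms M.a_repr_independence[OF _ _ I.is_additive_subgroup[THEN additive_subgroup.a_subgroup]]
      by (metis smult_closed)
  qed
  moreover have "x \<in> I +>\<^bsub>A\<^esub> x" using assms I.a_rcos_self by blast
  ultimately have "(\<Union>y\<in>I +>\<^bsub>A\<^esub> x. I +>\<^bsub>A\<^esub> (a \<odot>\<^bsub>A\<^esub> y)) = I +>\<^bsub>A\<^esub> (a \<odot>\<^bsub>A\<^esub> x)"
    by (intro SUP_eq_const) blast+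
  then show ?thesis by simp
qed

lemma (in assoc_algebra) quotient_assoc_algebra:
  assumes "ideal I A"
  shows "assoc_algebra R (quotient_algebra A I)"
proof -
  interpret I: ideal I A by fact
  let ?Q = "quotient_algebra A I"
  have rep: "\<exists>x\<in>carrier A. C = I +>\<^bsub>A\<^esub> x" if "C \<in> carrier ?Q" for C
    using that by (auto simp: A_RCOSETS_def')
  have car [simp]: "I +>\<^bsub>A\<^esub> x \<in> carrier ?Q" if "x \<in> carrier A" for x
    using that by (auto simp: A_RCOSETS_def')
  have [simp]: "(I +>\<^bsub>A\<^esub> x) \<oplus>\<^bsub>?Q\<^esub> (I +>\<^bsub>A\<^esub> y) = I +>\<^bsub>A\<^esub> (x \<oplus>\<^bsub>A\<^esub> y)"
    "(I +>\<^bsub>A\<^esub> x) \<otimes>\<^bsub>?Q\<^esub> (I +>\<^bsub>A\<^esub> y) = I +>\<^bsub>A\<^esub> (x \<otimes>\<^bsub>A\<^esub> y)"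
    if "x \<in> carrier A" "y \<in> carrier A" for x y
    using that by (simp_all add: I.a_rcos_sum I.rcoset_mult_add)
  note sm [simp] = quotient_smult[OF assms]
  have z: "I = I +>\<^bsub>A\<^esub> \<zero>\<^bsub>A\<^esub>" using I.a_subset by simp
  have [simp]: "\<one>\<^bsub>?Q\<^esub> = I +>\<^bsub>A\<^esub> \<one>\<^bsub>A\<^esub>" "\<zero>\<^bsub>?Q\<^esub> = I +>\<^bsub>A\<^esub> \<zero>\<^bsub>A\<^esub>"
    using z by simp_all
  note [simp del] = quotient_algebra_simps
  have rng: "ring ?Q"
  proof (rule ringI)
    show "abelian_group ?Q"
    proof (rule abelian_groupI)
      fix C assume "C \<in> carrier ?Q"
      then obtain x where x: "x \<in> carrier A" "C = I +>\<^bsub>A\<^esub> x" using rep by blast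
      show "\<exists>D\<in>carrier ?Q. D \<oplus>\<^bsub>?Q\<^esub> C = \<zero>\<^bsub>?Q\<^esub>"
        by (rule bexI[of _ "I +>\<^bsub>A\<^esub> (\<ominus>\<^bsub>A\<^esub> x)"]) (use x in \<open>simp_all add: M.l_neg\<close>)
    qed (auto dest!: rep simp: M.a_ac)
    show "monoid ?Q"
      by (rule monoidI) (auto dest!: rep simp: A.m_assoc)
  qed (auto dest!: rep simp: A.l_distr A.r_distr)
  have mod: "module R ?Q"
  proof (rule moduleI)
    show "abelian_group ?Q" using rng by (rule ring.is_abelian_group)
  qed (use R.is_cring in \<open>auto dest!: rep simp: smult_l_distr smult_r_distr smult_assoc1\<close>)
  show ?thesis
    by (rule assoc_algebra.intro[OF mod rng], unfold_locales)
      (auto dest!: rep simp: smult_mult_left smult_mult_right)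
qed

context cring
begin

definition presented_map ::
    "'x set \<Rightarrow> (('x list \<Rightarrow> 'a) \<Rightarrow> ('x list \<Rightarrow> 'a) \<Rightarrow> bool) \<Rightarrow> ('x list \<Rightarrow> 'a) \<Rightarrow> ('x list \<Rightarrow> 'a) set" where
  "presented_map X rel f =
    genideal (free_algebra R X) {u \<ominus>\<^bsub>free_algebra R X\<^esub> v | u v. rel u v} +>\<^bsub>free_algebra R X\<^esub> f"

text \<open>The facts about presented algebras are collected here so that cosets need not be opened
  later. The last one takes the place of the universal property: it tests the relations inside words
  and yields a linear form, so no target algebra is needed.\<close>

lemma presented_map:
  assumes rel: "\<forall>u v. rel u v \<longrightarrow> u \<in> carrier (free_algebra R X) \<and> v \<in> carrier (free_algebra R X)"
  shows "assoc_algebra R (presented_algebra R X rel)"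
    and "carrier (presented_algebra R X rel) = presented_map X rel ` carrier (free_algebra R X)"
    and "presented_map X rel \<one>\<^bsub>free_algebra R X\<^esub> = \<one>\<^bsub>presented_algebra R X rel\<^esub>"
    and "presented_map X rel \<zero>\<^bsub>free_algebra R X\<^esub> = \<zero>\<^bsub>presented_algebra R X rel\<^esub>"
    and "\<And>f g. \<lbrakk>f \<in> carrier (free_algebra R X); g \<in> carrier (free_algebra R X)\<rbrakk>
      \<Longrightarrow> presented_map X rel (f \<oplus>\<^bsub>free_algebra R X\<^esub> g)
        = presented_map X rel f \<oplus>\<^bsub>presented_algebra R X rel\<^esub> presented_map X rel g"
    and "\<And>f g. \<lbrakk>f \<in> carrier (free_algebra R X); g \<in> carrier (free_algebra R X)\<rbrakk>
      \<Longrightarrow> presented_map X rel (f \<otimes>\<^bsub>free_algebra R X\<^esub> g)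
        = presented_map X rel f \<otimes>\<^bsub>presented_algebra R X rel\<^esub> presented_map X rel g"
    and "\<And>s f. \<lbrakk>s \<in> carrier R; f \<in> carrier (free_algebra R X)\<rbrakk>
      \<Longrightarrow> presented_map X rel (s \<odot>\<^bsub>free_algebra R X\<^esub> f)
        = s \<odot>\<^bsub>presented_algebra R X rel\<^esub> presented_map X rel f"
    and "\<And>u v. rel u v \<Longrightarrow> presented_map X rel u = presented_map X rel v"
    and "\<And>l. \<lbrakk>\<And>w. l w \<in> carrier R;
        \<And>u v w w'. \<lbrakk>rel u v; w \<in> lists X; w' \<in> lists X\<rbrakk> \<Longrightarrow>
          linear_ext l (word R w \<otimes>\<^bsub>free_algebra R X\<^esub> u \<otimes>\<^bsub>free_algebra R X\<^esub> word R w')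
          = linear_ext l (word R w \<otimes>\<^bsub>free_algebra R X\<^esub> v \<otimes>\<^bsub>free_algebra R X\<^esub> word R w')\<rbrakk>
      \<Longrightarrow> \<exists>L\<in>module_hom R (presented_algebra R X rel) (regular_module R).
            \<forall>f\<in>carrier (free_algebra R X). L (presented_map X rel f) = linear_ext l f"
proof -
  define F where "F = free_algebra R X"
  interpret F: assoc_algebra R F unfolding F_def by (rule free_algebra_assoc_algebra)
  define I where "I = genideal F {u \<ominus>\<^bsub>F\<^esub> v | u v. rel u v}"
  have rel': "u \<in> carrier F" "v \<in> carrier F" if "rel u v" for u v
    using rel that by (simp_all add: F_def)
  have gens: "{u \<ominus>\<^bsub>F\<^esub> v | u v. rel u v} \<subseteq> carrier F"
    using rel' by auto
  interpret I: ideal I F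
    unfolding I_def by (rule F.genideal_ideal[OF gens])
  define A where "A = presented_algebra R X rel"
  have A: "A = quotient_algebra F I"
    by (simp add: A_def presented_algebra_def F_def I_def)
  define \<pi> where "\<pi> = presented_map X rel"
  have \<pi>: "\<pi> f = I +>\<^bsub>F\<^esub> f" for f
    by (simp add: \<pi>_def presented_map_def F_def I_def)
  have alg: "assoc_algebra R A"
    unfolding A by (rule F.quotient_assoc_algebra) (rule I.is_ideal)
  have img: "carrier A = \<pi> ` carrier F"
    by (auto simp: A \<pi> A_RCOSETS_def')
  have one: "\<pi> \<one>\<^bsub>F\<^esub> = \<one>\<^bsub>A\<^esub>" by (simp add: A \<pi>)
  have zero: "\<pi> \<zero>\<^bsub>F\<^esub> = \<zero>\<^bsub>A\<^esub>"
    by (simp add: A \<pi> I.a_subset)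
  have add: "\<pi> (f \<oplus>\<^bsub>F\<^esub> g) = \<pi> f \<oplus>\<^bsub>A\<^esub> \<pi> g" if "f \<in> carrier F" "g \<in> carrier F" for f g
    using that by (simp add: A \<pi> I.a_rcos_sum)
  have mult: "\<pi> (f \<otimes>\<^bsub>F\<^esub> g) = \<pi> f \<otimes>\<^bsub>A\<^esub> \<pi> g" if "f \<in> carrier F" "g \<in> carrier F" for f g
    using that by (simp add: A \<pi> I.rcoset_mult_add)
  have smult: "\<pi> (a \<odot>\<^bsub>F\<^esub> f) = a \<odot>\<^bsub>A\<^esub> \<pi> f" if "a \<in> carrier R" "f \<in> carrier F" for a f
    using that F.quotient_smult[OF I.is_ideal that] by (simp only: A \<pi>)
  have eq_iff: "\<pi> f = \<pi> g \<longleftrightarrow> f \<ominus>\<^bsub>F\<^esub> g \<in> I" if "f \<in> carrier F" "g \<in> carrier F" for f g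
    unfolding \<pi> using that
    by (metis F.quotient_eq_iff_same_a_r_cos I.is_ideal)
  have rel_eq: "\<pi> u = \<pi> v" if "rel u v" for u v
  proof -
    have "u \<ominus>\<^bsub>F\<^esub> v \<in> I" unfolding I_def
      by (rule subsetD[OF F.genideal_self[OF gens]]) (use that in auto)
    then show ?thesis using eq_iff rel'[OF that] by simp
  qed
  have descend: "\<exists>L\<in>module_hom R A (regular_module R). \<forall>f\<in>carrier F. L (\<pi> f) = linear_ext l f"
    if l: "\<And>w. l w \<in> carrier R" and lrel: "\<And>u v w w'. \<lbrakk>rel u v; w \<in> lists X; w' \<in> lists X\<rbrakk> \<Longrightarrow>
          linear_ext l (word R w \<otimes>\<^bsub>F\<^esub> u \<otimes>\<^bsub>F\<^esub> word R w')
          = linear_ext l (word R w \<otimes>\<^bsub>F\<^esub> v \<otimes>\<^bsub>F\<^esub> word R w')" for l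
  proof -
    have h: "linear_ext l \<in> module_hom R F (regular_module R)"
      unfolding F_def by (rule linear_ext_hom) (rule l)
    have hadd: "linear_ext l (f \<oplus>\<^bsub>F\<^esub> g) = linear_ext l f \<oplus> linear_ext l g"
      if "f \<in> carrier F" "g \<in> carrier F" for f g
      using module_hom_add[OF h that] by (simp add: regular_module_def)
    have hsm: "linear_ext l (a \<odot>\<^bsub>F\<^esub> f) = a \<otimes> linear_ext l f"
      if "a \<in> carrier R" "f \<in> carrier F" for a f
      using module_hom_smult[OF h that] by (simp add: regular_module_def)
    have hc: "linear_ext l f \<in> carrier R" if "f \<in> carrier F" for f
      using module_hom_closed[OF h] that by (auto simp: regular_module_def)
    have wc: "word R w \<in> carrier F" if "w \<in> lists X" for w
      unfolding F_def by (rule word_closed) (rule that)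
    have wc0: "\<one>\<^bsub>F\<^esub> = word R []" by (simp add: F_def)
    have hz: "linear_ext l \<zero>\<^bsub>F\<^esub> = \<zero>"
      by (simp add: F_def linear_ext_def)
    \<comment> \<open>The largest two-sided ideal inside the kernel of \<open>linear_ext l\<close>.
      Once it contains the relators, it contains the ideal that they generate.\<close>
    define K where "K = {f \<in> carrier F. \<forall>g\<in>carrier F. \<forall>g'\<in>carrier F. linear_ext l (g \<otimes>\<^bsub>F\<^esub> f \<otimes>\<^bsub>F\<^esub> g') = \<zero>}"
    have hneg: "linear_ext l (\<ominus>\<^bsub>F\<^esub> f) = \<ominus> linear_ext l f" if f: "f \<in> carrier F" for f
    proof -
      have "linear_ext l (\<ominus>\<^bsub>F\<^esub> f) \<oplus> linear_ext l f = \<zero>"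
        using hadd[of "\<ominus>\<^bsub>F\<^esub> f" f] f hz by (simp add: F.l_neg)
      then show ?thesis using hc f by (simp add: minus_equality)
    qed
    have K: "ideal K F"
    proof (rule idealI)
      show "ring F" by (rule F.ring_axioms)
      show "subgroup K (add_monoid F)"
      proof (rule group.subgroupI[OF F.a_group])
        show "K \<noteq> {}" using hz by (auto simp: K_def intro!: exI[of _ "\<zero>\<^bsub>F\<^esub>"])
      qed (auto simp: K_def F.l_distr F.r_distr F.r_minus F.l_minus hadd hneg simp flip: a_inv_def)
      fix a x assume "a \<in> K" "x \<in> carrier F"
      then show "x \<otimes>\<^bsub>F\<^esub> a \<in> K" "a \<otimes>\<^bsub>F\<^esub> x \<in> K"
        by (auto simp: K_def F.m_assoc) (metis F.m_assoc F.m_closed)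
    qed
    have "u \<ominus>\<^bsub>F\<^esub> v \<in> K" if uv: "rel u v" for u v
    proof -
      note [simp] = rel'[OF uv]
      have 1: "linear_ext l (word R w \<otimes>\<^bsub>F\<^esub> (u \<ominus>\<^bsub>F\<^esub> v) \<otimes>\<^bsub>F\<^esub> word R w') = \<zero>"
        if w: "w \<in> lists X" "w' \<in> lists X" for w w'
      proof -
        have "word R w \<otimes>\<^bsub>F\<^esub> (u \<ominus>\<^bsub>F\<^esub> v) \<otimes>\<^bsub>F\<^esub> word R w'
          = (word R w \<otimes>\<^bsub>F\<^esub> u \<otimes>\<^bsub>F\<^esub> word R w') \<oplus>\<^bsub>F\<^esub> \<ominus>\<^bsub>F\<^esub> (word R w \<otimes>\<^bsub>F\<^esub> v \<otimes>\<^bsub>F\<^esub> word R w')"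
          using wc w by (simp add: a_minus_def F.l_distr F.r_distr F.l_minus F.r_minus)
        then show ?thesis
          using lrel[OF uv w] wc w hc by (simp add: hadd hneg r_neg)
      qed
      \<comment> \<open>Linearity passes from words to arbitrary factors, on the right here and on
        the left in the next step.\<close>
      have 2: "linear_ext l (word R w \<otimes>\<^bsub>F\<^esub> (u \<ominus>\<^bsub>F\<^esub> v) \<otimes>\<^bsub>F\<^esub> g') = \<zero>"
        if w: "w \<in> lists X" and g': "g' \<in> carrier F" for w g'
        using g'[unfolded F_def]
      proof (induction rule: free_algebra_induct)
        case zero
        then show ?case using wc[OF w] hz by (simp flip: F_def del: free_algebra_simps)
      next
        case (add f g)
        then show ?case using wc[OF w] by (simp add: F.r_distr hadd flip: F_def del: free_algebra_simps)
      next
        case (word a w')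
        then show ?case using wc[OF w] wc[of w'] 1[OF w, of w']
          by (simp add: F.smult_mult_right hsm flip: F_def del: free_algebra_simps)
      qed
      have 3: "linear_ext l (g \<otimes>\<^bsub>F\<^esub> (u \<ominus>\<^bsub>F\<^esub> v) \<otimes>\<^bsub>F\<^esub> g') = \<zero>"
        if g: "g \<in> carrier F" and g': "g' \<in> carrier F" for g g'
        using g[unfolded F_def]
      proof (induction rule: free_algebra_induct)
        case zero
        then show ?case using g' hz by (simp flip: F_def del: free_algebra_simps)
      next
        case (add f g)
        then show ?case using g' by (simp add: F.l_distr hadd flip: F_def del: free_algebra_simps)
      next
        case (word a w')
        then show ?case using g' wc[of w'] 2[of w' g']
          by (simp add: F.smult_mult_left hsm flip: F_def del: free_algebra_simps)
      qed
      then show ?thesis by (simp add: K_def)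
    qed
    then have IK: "I \<subseteq> K"
      unfolding I_def by (intro F.genideal_minimal[OF K]) auto
    have kill: "linear_ext l f = \<zero>" if "f \<in> I" for f
    proof -
      have f: "f \<in> K" using that IK by auto
      then have "linear_ext l (\<one>\<^bsub>F\<^esub> \<otimes>\<^bsub>F\<^esub> f \<otimes>\<^bsub>F\<^esub> \<one>\<^bsub>F\<^esub>) = \<zero>"
        unfolding K_def by blast
      moreover have "f \<in> carrier F" using f by (simp add: K_def)
      ultimately show ?thesis by simp
    qed
    have wd: "linear_ext l f = linear_ext l g" if "f \<in> carrier F" "g \<in> carrier F" "\<pi> f = \<pi> g" for f g
    proof -
      have "linear_ext l (f \<ominus>\<^bsub>F\<^esub> g) = \<zero>" using that eq_iff kill by simp
      then have "linear_ext l f \<oplus> \<ominus> linear_ext l g = \<zero>"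
        using that by (simp add: a_minus_def hadd hneg)
      then show ?thesis using that hc minus_equality by (metis a_inv_closed minus_minus)
    qed
    define L where "L C = linear_ext l (SOME f. f \<in> carrier F \<and> \<pi> f = C)" for C
    have L: "L (\<pi> f) = linear_ext l f" if "f \<in> carrier F" for f
      unfolding L_def
    proof (rule someI2[of _ f])
      show "f \<in> carrier F \<and> \<pi> f = \<pi> f" using that by simp
      show "linear_ext l g = linear_ext l f" if "g \<in> carrier F \<and> \<pi> g = \<pi> f" for g
        using wd[of g f] that \<open>f \<in> carrier F\<close> by simp
    qed
    have "L \<in> module_hom R A (regular_module R)"
      unfolding module_hom_def regular_module_def img
      by (auto simp: L hc hadd hsm simp flip: add smult)
    then show ?thesis using L by auto
  qed
  note F_def [symmetric, simp] A_def [symmetric, simp] \<pi>_def [symmetric, simp]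
  note [simp del] = free_algebra_simps
  show "assoc_algebra R (presented_algebra R X rel)"
    "carrier (presented_algebra R X rel) = presented_map X rel ` carrier (free_algebra R X)"
    "presented_map X rel \<one>\<^bsub>free_algebra R X\<^esub> = \<one>\<^bsub>presented_algebra R X rel\<^esub>"
    "presented_map X rel \<zero>\<^bsub>free_algebra R X\<^esub> = \<zero>\<^bsub>presented_algebra R X rel\<^esub>"
    using alg img one zero by simp_all
  show "\<lbrakk>f \<in> carrier (free_algebra R X); g \<in> carrier (free_algebra R X)\<rbrakk>
      \<Longrightarrow> presented_map X rel (f \<oplus>\<^bsub>free_algebra R X\<^esub> g)
        = presented_map X rel f \<oplus>\<^bsub>presented_algebra R X rel\<^esub> presented_map X rel g"
    "\<lbrakk>f \<in> carrier (free_algebra R X); g \<in> carrier (free_algebra R X)\<rbrakk>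
      \<Longrightarrow> presented_map X rel (f \<otimes>\<^bsub>free_algebra R X\<^esub> g)
        = presented_map X rel f \<otimes>\<^bsub>presented_algebra R X rel\<^esub> presented_map X rel g" for f g
    using add mult by simp_all
  show "\<lbrakk>s \<in> carrier R; f \<in> carrier (free_algebra R X)\<rbrakk>
      \<Longrightarrow> presented_map X rel (s \<odot>\<^bsub>free_algebra R X\<^esub> f)
        = s \<odot>\<^bsub>presented_algebra R X rel\<^esub> presented_map X rel f" for s f
    using smult by simp
  show "rel u v \<Longrightarrow> presented_map X rel u = presented_map X rel v" for u v
    using rel_eq by simp
  show "\<exists>L\<in>module_hom R (presented_algebra R X rel) (regular_module R).
            \<forall>f\<in>carrier (free_algebra R X). L (presented_map X rel f) = linear_ext l f"
    if "\<And>w. l w \<in> carrier R"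
      "\<And>u v w w'. \<lbrakk>rel u v; w \<in> lists X; w' \<in> lists X\<rbrakk> \<Longrightarrow>
          linear_ext l (word R w \<otimes>\<^bsub>free_algebra R X\<^esub> u \<otimes>\<^bsub>free_algebra R X\<^esub> word R w')
          = linear_ext l (word R w \<otimes>\<^bsub>free_algebra R X\<^esub> v \<otimes>\<^bsub>free_algebra R X\<^esub> word R w')" for l
    using descend[OF that(1)] that(2) by simp
qed

end

lemma (in module) span_induct [consumes 2, case_names zero add smult]:
  assumes "B \<subseteq> carrier M" "x \<in> span B" "P \<zero>\<^bsub>M\<^esub>"
    and "\<And>x y. \<lbrakk>x \<in> carrier M; y \<in> carrier M; P x; P y\<rbrakk> \<Longrightarrow> P (x \<oplus>\<^bsub>M\<^esub> y)"
    and "\<And>a e. \<lbrakk>a \<in> carrier R; e \<in> B\<rbrakk> \<Longrightarrow> P (a \<odot>\<^bsub>M\<^esub> e)"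
  shows "P x"
proof -
  have "P (\<Oplus>\<^bsub>M\<^esub>v\<in>S. a v \<odot>\<^bsub>M\<^esub> v)" if "finite S" "S \<subseteq> B" "a \<in> S \<rightarrow> carrier R" for S a
    using that
  proof (induction S rule: finite_induct)
    case empty
    then show ?case using assms(3) by simp
  next
    case (insert v S)
    have c: "(\<lambda>v. a v \<odot>\<^bsub>M\<^esub> v) \<in> S \<rightarrow> carrier M" "v \<in> carrier M"
      using insert.prems assms(1) by auto
    show ?case
      using insert c assms(4)[of "a v \<odot>\<^bsub>M\<^esub> v"] assms(5)[of "a v" v] by auto
  qed
  then show ?thesis
    using assms(2) unfolding span_def lincomb_def by auto
qed

section \<open>Linear functionals, dual bases and symmetrizing forms\<close>

context module
begin

abbreviation (input) "functionals \<equiv> module_hom R M (regular_module R)"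

lemma functional_simps:
  assumes "f \<in> functionals"
  shows "x \<in> carrier M \<Longrightarrow> f x \<in> carrier R"
    "\<lbrakk>x \<in> carrier M; y \<in> carrier M\<rbrakk> \<Longrightarrow> f (x \<oplus>\<^bsub>M\<^esub> y) = f x \<oplus> f y"
    "\<lbrakk>a \<in> carrier R; x \<in> carrier M\<rbrakk> \<Longrightarrow> f (a \<odot>\<^bsub>M\<^esub> x) = a \<otimes> f x"
    "f \<zero>\<^bsub>M\<^esub> = \<zero>"
proof -
  show 1: "x \<in> carrier M \<Longrightarrow> f x \<in> carrier R" for x
    using assms by (auto simp: module_hom_def regular_module_def)
  show "\<lbrakk>x \<in> carrier M; y \<in> carrier M\<rbrakk> \<Longrightarrow> f (x \<oplus>\<^bsub>M\<^esub> y) = f x \<oplus> f y"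
    using assms by (auto simp: module_hom_def regular_module_def)
  show 3: "\<lbrakk>a \<in> carrier R; x \<in> carrier M\<rbrakk> \<Longrightarrow> f (a \<odot>\<^bsub>M\<^esub> x) = a \<otimes> f x" for a x
    using assms by (auto simp: module_hom_def regular_module_def)
  show "f \<zero>\<^bsub>M\<^esub> = \<zero>"
    using 3[of \<zero> "\<zero>\<^bsub>M\<^esub>"] 1[of "\<zero>\<^bsub>M\<^esub>"] by simp
qed

lemma functional_finsum:
  assumes "f \<in> functionals" "finite S" "x \<in> S \<rightarrow> carrier M"
  shows "f (\<Oplus>\<^bsub>M\<^esub>i\<in>S. x i) = (\<Oplus>i\<in>S. f (x i))"
  using assms(2,3)
proof (induction S rule: finite_induct)
  case empty
  then show ?case using functional_simps[OF assms(1)] by simp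
next
  case (insert v S)
  then show ?case using functional_simps[OF assms(1)]
    by (simp add: Pi_def)
qed

lemma functionals_eq_on_span:
  assumes "f \<in> functionals" "g \<in> functionals" "B \<subseteq> carrier M" "x \<in> span B"
    and "\<And>e. e \<in> B \<Longrightarrow> f e = g e"
  shows "f x = g x"
  using assms(3,4)
proof (induction rule: span_induct)
  case (smult a e)
  then have "e \<in> carrier M" using assms(3) by auto
  then show ?case using smult assms(5) functional_simps[OF assms(1)] functional_simps[OF assms(2)] by simp
qed (simp_all add: functional_simps[OF assms(1)] functional_simps[OF assms(2)])

end

text \<open>Freeness is recorded by coordinate functionals: on a spanning set they force linear
  independence, and functionals are what the action on forms supplies.\<close>

locale dual_basis = module +
  fixes B :: "'c set" and d :: "'c \<Rightarrow> 'c \<Rightarrow> 'a"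
  assumes finite_basis: "finite B" and basis_carrier: "B \<subseteq> carrier M"
    and spanning: "span B = carrier M"
    and dual_functional: "e \<in> B \<Longrightarrow> d e \<in> functionals"
    and dual_basis: "\<lbrakk>e \<in> B; e' \<in> B\<rbrakk> \<Longrightarrow> d e e' = (if e = e' then \<one> else \<zero>)"
begin

lemma basisD: "e \<in> B \<Longrightarrow> e \<in> carrier M"
  using basis_carrier by auto

lemmas dual_simps = functional_simps[OF dual_functional]

lemma coordinate_expansion:
  assumes "x \<in> carrier M"
  shows "x = (\<Oplus>\<^bsub>M\<^esub>e\<in>B. d e x \<odot>\<^bsub>M\<^esub> e)"
  using basis_carrier assms[folded spanning]
proof (induction rule: span_induct)
  case zero
  have "(\<Oplus>\<^bsub>M\<^esub>e\<in>B. d e \<zero>\<^bsub>M\<^esub> \<odot>\<^bsub>M\<^esub> e) = (\<Oplus>\<^bsub>M\<^esub>e\<in>B. \<zero>\<^bsub>M\<^esub>)"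
    by (intro M.add.finprod_cong') (use dual_simps basisD in auto)
  then show ?case by simp
next
  case (add x y)
  have "(\<Oplus>\<^bsub>M\<^esub>e\<in>B. d e (x \<oplus>\<^bsub>M\<^esub> y) \<odot>\<^bsub>M\<^esub> e)
      = (\<Oplus>\<^bsub>M\<^esub>e\<in>B. d e x \<odot>\<^bsub>M\<^esub> e \<oplus>\<^bsub>M\<^esub> d e y \<odot>\<^bsub>M\<^esub> e)"
    by (intro M.add.finprod_cong') (use add dual_simps basisD in \<open>auto simp: smult_l_distr\<close>)
  also have "\<dots> = (\<Oplus>\<^bsub>M\<^esub>e\<in>B. d e x \<odot>\<^bsub>M\<^esub> e) \<oplus>\<^bsub>M\<^esub> (\<Oplus>\<^bsub>M\<^esub>e\<in>B. d e y \<odot>\<^bsub>M\<^esub> e)"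
    by (intro M.finsum_addf) (use add dual_simps basisD in auto)
  finally show ?case using add by simp
next
  case (smult a e')
  have "(\<Oplus>\<^bsub>M\<^esub>e\<in>B. d e (a \<odot>\<^bsub>M\<^esub> e') \<odot>\<^bsub>M\<^esub> e) = (\<Oplus>\<^bsub>M\<^esub>e\<in>B. if e' = e then a \<odot>\<^bsub>M\<^esub> e else \<zero>\<^bsub>M\<^esub>)"
    by (intro M.add.finprod_cong') (use smult dual_simps basisD in \<open>auto simp: dual_basis\<close>)
  also have "\<dots> = a \<odot>\<^bsub>M\<^esub> e'"
    by (subst M.add.finprod_singleton) (use smult finite_basis basisD in auto)
  finally show ?case by simp
qed

lemma coordinates_eqI:
  assumes "x \<in> carrier M" "y \<in> carrier M" "\<And>e. e \<in> B \<Longrightarrow> d e x = d e y"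
  shows "x = y"
proof -
  have "(\<Oplus>\<^bsub>M\<^esub>e\<in>B. d e x \<odot>\<^bsub>M\<^esub> e) = (\<Oplus>\<^bsub>M\<^esub>e\<in>B. d e y \<odot>\<^bsub>M\<^esub> e)"
    by (intro M.add.finprod_cong') (use assms dual_simps basisD in auto)
  then show ?thesis using coordinate_expansion assms by metis
qed

lemma coordinate_combination:
  assumes "\<And>e. e \<in> B \<Longrightarrow> k e \<in> carrier R" "e' \<in> B"
  shows "d e' (\<Oplus>\<^bsub>M\<^esub>e\<in>B. k e \<odot>\<^bsub>M\<^esub> e) = k e'"
proof -
  have "d e' (\<Oplus>\<^bsub>M\<^esub>e\<in>B. k e \<odot>\<^bsub>M\<^esub> e) = (\<Oplus>e\<in>B. d e' (k e \<odot>\<^bsub>M\<^esub> e))"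
    by (rule functional_finsum) (use assms dual_functional finite_basis basisD in auto)
  also have "\<dots> = (\<Oplus>e\<in>B. if e' = e then k e else \<zero>)"
  proof (intro R.add.finprod_cong')
    fix e assume e: "e \<in> B"
    then show "d e' (k e \<odot>\<^bsub>M\<^esub> e) = (if e' = e then k e else \<zero>)"
      using assms dual_simps(3)[OF assms(2), of "k e" e] basisD[OF e] by (simp add: dual_basis)
  qed (use assms in auto)
  also have "\<dots> = k e'"
    by (subst R.add.finprod_singleton) (use assms finite_basis in auto)
  finally show ?thesis .
qed

lemma finitely_generated: "finitely_generated_module R M"
  unfolding finitely_generated_module_def
  using finite_basis basis_carrier spanning module_axioms by blast

lemma projective: "projective_module R M"
proof -
  \<comment> \<open>A free module needs no complement; zero is realised as the free module on the
    empty set.\<close>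
  define Q where "Q = free_module R ({} :: 'c set)"
  have Q: "carrier Q = {\<lambda>x. \<zero>}"
    by (auto simp: Q_def R.free_module_carrier_iff)
  define \<phi> where "\<phi> = (\<lambda>(x, q :: 'c \<Rightarrow> 'a) e. if e \<in> B then d e x else \<zero>)"
  have hom: "\<phi> \<in> module_hom R (direct_sum M Q) (free_module R B)"
  proof -
    have "finite {e. \<phi> (x, q) e \<noteq> \<zero>}" for x q
      by (rule finite_subset[OF _ finite_basis]) (auto simp: \<phi>_def)
    then show ?thesis
      by (auto simp: module_hom_def direct_sum_def R.free_module_carrier_iff \<phi>_def dual_simps fun_eq_iff)
  qed
  have "inj_on \<phi> (carrier (direct_sum M Q))"
  proof (rule inj_onI)
    fix u v assume uv: "u \<in> carrier (direct_sum M Q)" "v \<in> carrier (direct_sum M Q)" "\<phi> u = \<phi> v"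
    then obtain x y where [simp]: "u = (x, \<lambda>x. \<zero>)" "v = (y, \<lambda>x. \<zero>)" "x \<in> carrier M" "y \<in> carrier M"
      by (auto simp: direct_sum_def Q)
    have "d e x = d e y" if "e \<in> B" for e
      using fun_cong[OF uv(3), of e] that by (simp add: \<phi>_def)
    then show "u = v" using coordinates_eqI by simp
  qed
  moreover have "f \<in> \<phi> ` carrier (direct_sum M Q)" if f: "f \<in> carrier (free_module R B)" for f
  proof (rule image_eqI)
    show "(\<Oplus>\<^bsub>M\<^esub>e\<in>B. f e \<odot>\<^bsub>M\<^esub> e, \<lambda>x. \<zero>) \<in> carrier (direct_sum M Q)"
      using f basisD by (auto simp: direct_sum_def Q R.free_module_carrier_iff)
    show "f = \<phi> (\<Oplus>\<^bsub>M\<^esub>e\<in>B. f e \<odot>\<^bsub>M\<^esub> e, \<lambda>x. \<zero>)"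
      using f by (auto simp: \<phi>_def coordinate_combination R.free_module_carrier_iff)
  qed
  moreover have "\<phi> u \<in> carrier (free_module R B)" if "u \<in> carrier (direct_sum M Q)" for u
    using module_hom_closed[OF hom] that by auto
  ultimately have "bij_betw \<phi> (carrier (direct_sum M Q)) (carrier (free_module R B))"
    unfolding bij_betw_def by blast
  then have "\<phi> \<in> module_iso R (direct_sum M Q) (free_module R B)"
    using hom by (simp add: module_iso_def)
  then show ?thesis
    unfolding projective_module_def using module_axioms R.free_module_module[of "{}"] Q_def by blast
qed

end

text \<open>The elements \<open>z\<close> form a basis dual to \<open>B\<close> for the trace form.
  Pairing with them recovers coordinates, which gives injectivity; a functional \<open>f\<close> is
  represented by the combination of the \<open>z e\<close> with coefficients \<open>f e\<close>,
  which gives surjectivity.\<close>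

lemma (in assoc_algebra) symmetric_algebraI:
  assumes basis: "dual_basis R A B d"
    and tr: "\<tau> \<in> functionals"
    and comm: "\<And>x y. \<lbrakk>x \<in> B; y \<in> B\<rbrakk> \<Longrightarrow> \<tau> (x \<otimes>\<^bsub>A\<^esub> y) = \<tau> (y \<otimes>\<^bsub>A\<^esub> x)"
    and dual: "\<And>e. e \<in> B \<Longrightarrow> \<exists>z\<in>carrier A. \<forall>x\<in>B. \<tau> (z \<otimes>\<^bsub>A\<^esub> x) = d e x"
  shows "symmetric_algebra R A"
proof -
  interpret dual_basis R A B d by (rule basis)
  note t = functional_simps[OF tr]
  have left: "(\<lambda>x. \<tau> (x \<otimes>\<^bsub>A\<^esub> y)) \<in> functionals" and right: "(\<lambda>x. \<tau> (y \<otimes>\<^bsub>A\<^esub> x)) \<in> functionals"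
    if "y \<in> carrier A" for y
    using that t by (auto simp: module_hom_def regular_module_def l_distr r_distr smult_mult_left smult_mult_right)
  have 1: "\<tau> (x \<otimes>\<^bsub>A\<^esub> y) = \<tau> (y \<otimes>\<^bsub>A\<^esub> x)" if "x \<in> carrier A" "y \<in> B" for x y
    by (rule functionals_eq_on_span[OF left right basis_carrier])
      (use that basisD spanning comm in auto)
  have comm': "\<tau> (x \<otimes>\<^bsub>A\<^esub> y) = \<tau> (y \<otimes>\<^bsub>A\<^esub> x)" if "x \<in> carrier A" "y \<in> carrier A" for x y
    by (rule functionals_eq_on_span[OF right left basis_carrier])
      (use that spanning 1 in auto)
  obtain z where z: "\<And>e. e \<in> B \<Longrightarrow> z e \<in> carrier A"
    "\<And>e x. \<lbrakk>e \<in> B; x \<in> B\<rbrakk> \<Longrightarrow> \<tau> (z e \<otimes>\<^bsub>A\<^esub> x) = d e x"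
    using dual by metis
  have zd: "\<tau> (z e \<otimes>\<^bsub>A\<^esub> x) = d e x" if "e \<in> B" "x \<in> carrier A" for e x
    by (rule functionals_eq_on_span[OF right dual_functional basis_carrier])
      (use that spanning z in auto)
  let ?b = "\<lambda>x y. \<tau> (x \<otimes>\<^bsub>A\<^esub> y)"
  let ?h = "\<lambda>x. \<lambda>y\<in>carrier A. ?b x y"
  have hom: "?h \<in> module_hom R A (dual_module R A)"
    using right t
    by (auto simp: module_hom_def dual_module_def regular_module_def l_distr r_distr
        smult_mult_left smult_mult_right)
  have "inj_on ?h (carrier A)"
  proof (rule inj_onI)
    fix x y assume xy: "x \<in> carrier A" "y \<in> carrier A" "?h x = ?h y"
    have "d e x = d e y" if e: "e \<in> B" for e
    proof -
      have "\<tau> (x \<otimes>\<^bsub>A\<^esub> z e) = \<tau> (y \<otimes>\<^bsub>A\<^esub> z e)"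
        using fun_cong[OF xy(3), of "z e"] z(1)[OF e] by simp
      then show ?thesis
        using zd[OF e xy(1)] zd[OF e xy(2)] comm'[OF xy(1) z(1)[OF e]] comm'[OF xy(2) z(1)[OF e]]
        by simp
    qed
    then show "x = y" using coordinates_eqI xy by blast
  qed
  moreover have "f \<in> ?h ` carrier A" if f: "f \<in> carrier (dual_module R A)" for f
  proof
    have fh: "f \<in> functionals" and ext: "f \<in> extensional (carrier A)"
      using f by (auto simp: dual_module_def)
    note fs = functional_simps[OF fh]
    let ?z = "\<Oplus>\<^bsub>A\<^esub>e\<in>B. f e \<odot>\<^bsub>A\<^esub> z e"
    show zc: "?z \<in> carrier A" using z fs basisD by auto
    have "f y = \<tau> (?z \<otimes>\<^bsub>A\<^esub> y)" if y: "y \<in> carrier A" for y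
    proof (rule functionals_eq_on_span[OF fh right[OF zc] basis_carrier])
      show "y \<in> span B" using y spanning by simp
      fix e' assume e': "e' \<in> B"
      have "\<tau> (?z \<otimes>\<^bsub>A\<^esub> e') = (\<Oplus>e\<in>B. \<tau> ((f e \<odot>\<^bsub>A\<^esub> z e) \<otimes>\<^bsub>A\<^esub> e'))"
        by (rule functional_finsum[OF left]) (use finite_basis z fs basisD e' in auto)
      also have "\<dots> = (\<Oplus>e\<in>B. if e' = e then f e else \<zero>)"
        by (intro R.add.finprod_cong')
          (use finite_basis z fs basisD e' t in \<open>auto simp: smult_mult_left dual_basis\<close>)
      also have "\<dots> = f e'"
        by (subst R.add.finprod_singleton) (use finite_basis fs basisD e' in auto)
      finally show "f e' = \<tau> (?z \<otimes>\<^bsub>A\<^esub> e')" ..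
    qed
    then show "f = ?h ?z"
      using ext by (auto simp: extensional_def)
  qed
  moreover have "?h x \<in> carrier (dual_module R A)" if "x \<in> carrier A" for x
    using module_hom_closed[OF hom] that by auto
  ultimately have "bij_betw ?h (carrier A) (carrier (dual_module R A))"
    unfolding bij_betw_def by blast
  then have "nondegenerate_form R A ?b"
    using hom by (simp add: nondegenerate_form_def module_iso_def)
  moreover have "bilinear_form R A ?b"
    using left right by (simp add: bilinear_form_def)
  moreover have "assoc_algebra R A" by unfold_locales
  ultimately show ?thesis
    unfolding symmetric_algebra_def
    using finitely_generated projective comm' by (auto simp: m_assoc intro!: exI[of _ ?b])
qed

section \<open>Conjugation and double cosets\<close>

locale fin_group = group G for G (structure) +
  assumes finite_carrier: "finite (carrier G)"
begin

abbreviation cj :: "'a \<Rightarrow> 'a set \<Rightarrow> 'a set" where "cj \<equiv> conj_subgroup G"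
abbreviation sub :: "'a set \<Rightarrow> bool" where "sub H \<equiv> subgroup H G"

lemma subD: "sub H \<Longrightarrow> H \<subseteq> carrier G"
  by (rule subgroup.subset)

lemma sub_mem: "\<lbrakk>sub H; x \<in> H\<rbrakk> \<Longrightarrow> x \<in> carrier G"
  using subD by auto

lemma sub_finite: "sub H \<Longrightarrow> finite H"
  using subD finite_carrier finite_subset by blast

lemma sub_card_pos: "sub H \<Longrightarrow> card H > 0"
  using sub_finite subgroup.one_closed by (metis card_gt_0_iff empty_iff)

lemma sub_card_nz [simp]: "sub H \<Longrightarrow> card H \<noteq> 0" "sub H \<Longrightarrow> 0 < card H"
  using sub_card_pos by fastforce+

lemma sub_Int: "\<lbrakk>sub H; sub K\<rbrakk> \<Longrightarrow> sub (H \<inter> K)"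
  by (rule subgroups_Inter_pair)

lemma finite_subs: "finite {H. sub H}"
  by (rule finite_subset[of _ "Pow (carrier G)"]) (use subD finite_carrier in auto)

lemma inv_cancel [simp]:
  "\<lbrakk>x \<in> carrier G; y \<in> carrier G\<rbrakk> \<Longrightarrow> inv x \<otimes> (x \<otimes> y) = y"
  "\<lbrakk>x \<in> carrier G; y \<in> carrier G\<rbrakk> \<Longrightarrow> x \<otimes> (inv x \<otimes> y) = y"
  by (simp_all flip: m_assoc)

lemma cj_image:
  assumes "g \<in> carrier G" "H \<subseteq> carrier G"
  shows "cj g H = (\<lambda>h. g \<otimes> h \<otimes> inv g) ` H"
  using assms by (auto simp: conj_subgroup_def l_coset_def r_coset_def m_assoc)
    (auto simp: subset_iff m_assoc intro!: image_eqI)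

lemma mem_cj:
  assumes "g \<in> carrier G" "H \<subseteq> carrier G" "x \<in> carrier G"
  shows "x \<in> cj g H \<longleftrightarrow> inv g \<otimes> x \<otimes> g \<in> H"
proof
  assume "x \<in> cj g H"
  then obtain h where "h \<in> H" "x = g \<otimes> h \<otimes> inv g" using assms by (auto simp: cj_image)
  then show "inv g \<otimes> x \<otimes> g \<in> H" using assms by (auto simp: m_assoc subset_iff)
next
  assume h: "inv g \<otimes> x \<otimes> g \<in> H"
  have "x = g \<otimes> (inv g \<otimes> x \<otimes> g) \<otimes> inv g" using assms by (simp add: m_assoc)
  then show "x \<in> cj g H" using h assms by (auto simp: cj_image)
qed

lemma cj_closed: "\<lbrakk>g \<in> carrier G; H \<subseteq> carrier G\<rbrakk> \<Longrightarrow> cj g H \<subseteq> carrier G"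
  by (auto simp: cj_image subset_iff)

lemma cj_eqI:
  assumes "g \<in> carrier G" "H \<subseteq> carrier G" "K \<subseteq> carrier G"
    "\<And>x. x \<in> carrier G \<Longrightarrow> inv g \<otimes> x \<otimes> g \<in> H \<longleftrightarrow> x \<in> K"
  shows "cj g H = K"
  using assms mem_cj[OF assms(1,2)] cj_closed[OF assms(1,2)] by blast

lemma cj_one [simp]: "H \<subseteq> carrier G \<Longrightarrow> cj \<one> H = H"
  by (rule cj_eqI) auto

lemma cj_cj:
  assumes "g \<in> carrier G" "h \<in> carrier G" "H \<subseteq> carrier G"
  shows "cj g (cj h H) = cj (g \<otimes> h) H"
  using assms by (intro cj_eqI cj_closed) (auto simp: mem_cj inv_mult_group m_assoc)

lemma cj_inv [simp]:
  "\<lbrakk>g \<in> carrier G; H \<subseteq> carrier G\<rbrakk> \<Longrightarrow> cj (inv g) (cj g H) = H"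
  "\<lbrakk>g \<in> carrier G; H \<subseteq> carrier G\<rbrakk> \<Longrightarrow> cj g (cj (inv g) H) = H"
  by (simp_all add: cj_cj)

lemma cj_Int:
  assumes "g \<in> carrier G" "H \<subseteq> carrier G" "K \<subseteq> carrier G"
  shows "cj g (H \<inter> K) = cj g H \<inter> cj g K"
  by (rule cj_eqI) (use assms cj_closed[OF assms(1)] in \<open>auto simp: mem_cj dest: subsetD\<close>)

lemma cj_mono: "\<lbrakk>g \<in> carrier G; K \<subseteq> carrier G; H \<subseteq> K\<rbrakk> \<Longrightarrow> cj g H \<subseteq> cj g K"
  using cj_Int[of g H K] by (metis inf.absorb_iff1 order_trans)

lemma cj_mono_iff: "\<lbrakk>g \<in> carrier G; K \<subseteq> carrier G; H \<subseteq> carrier G\<rbrakk> \<Longrightarrow> cj g H \<subseteq> cj g K \<longleftrightarrow> H \<subseteq> K"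
  using cj_mono[of g K H] cj_mono[of "inv g" "cj g K" "cj g H"] cj_closed by auto

lemma card_cj [simp]:
  assumes "g \<in> carrier G" "H \<subseteq> carrier G"
  shows "card (cj g H) = card H"
  unfolding cj_image[OF assms]
  by (rule card_image) (use assms in \<open>auto simp: inj_on_def subset_iff\<close>)

lemma cj_sub:
  assumes "g \<in> carrier G" "sub H"
  shows "sub (cj g H)"
proof (rule subgroupI)
  note H = subD[OF assms(2)]
  show "cj g H \<subseteq> carrier G" using assms H by (simp add: cj_closed)
  have "g \<otimes> \<one> \<otimes> inv g \<in> cj g H"
    using assms H subgroup.one_closed[of H G] by (simp only: cj_image) blast
  then show "cj g H \<noteq> {}" by auto
  fix a b assume "a \<in> cj g H" "b \<in> cj g H"
  then obtain h k where hk: "h \<in> H" "k \<in> H" "a = g \<otimes> h \<otimes> inv g" "b = g \<otimes> k \<otimes> inv g"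
    using assms H by (auto simp: cj_image)
  have [simp]: "h \<in> carrier G" "k \<in> carrier G" using hk H by auto
  have "inv h \<in> H" "h \<otimes> k \<in> H"
    using hk assms(2) by (auto simp: subgroup.m_inv_closed subgroup.m_closed)
  moreover have "inv a = g \<otimes> inv h \<otimes> inv g" "a \<otimes> b = g \<otimes> (h \<otimes> k) \<otimes> inv g"
    using hk assms(1) by (simp_all add: inv_mult_group m_assoc)
  ultimately show "inv a \<in> cj g H" "a \<otimes> b \<in> cj g H"
    using assms H by (auto simp: cj_image)
qed

lemma cj_self:
  assumes "sub H" "h \<in> H"
  shows "cj h H = H"
proof -
  note H = subD[OF assms(1)]
  have "inv h \<otimes> x \<otimes> h \<in> H \<longleftrightarrow> x \<in> H" if "x \<in> carrier G" for x
  proof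
    assume "inv h \<otimes> x \<otimes> h \<in> H"
    then have "h \<otimes> (inv h \<otimes> x \<otimes> h) \<otimes> inv h \<in> H"
      using assms by (simp add: subgroup.m_closed subgroup.m_inv_closed)
    then show "x \<in> H" using that assms H by (auto simp: m_assoc subset_iff)
  qed (use assms in \<open>simp add: subgroup.m_closed subgroup.m_inv_closed\<close>)
  then show ?thesis using assms H by (intro cj_eqI) auto
qed

lemma l_coset_closed: "\<lbrakk>g \<in> carrier G; C \<subseteq> carrier G\<rbrakk> \<Longrightarrow> g <# C \<subseteq> carrier G"
  by (auto simp: l_coset_def)

lemma mem_l_coset:
  assumes "g \<in> carrier G" "C \<subseteq> carrier G" "x \<in> carrier G"
  shows "x \<in> g <# C \<longleftrightarrow> inv g \<otimes> x \<in> C"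
proof
  assume "inv g \<otimes> x \<in> C"
  moreover have "x = g \<otimes> (inv g \<otimes> x)" using assms by simp
  ultimately show "x \<in> g <# C" unfolding l_coset_def by blast
qed (use assms in \<open>auto simp: l_coset_def subset_iff\<close>)

lemma l_coset_inv [simp]:
  "\<lbrakk>g \<in> carrier G; C \<subseteq> carrier G\<rbrakk> \<Longrightarrow> inv g <# (g <# C) = C"
  "\<lbrakk>g \<in> carrier G; C \<subseteq> carrier G\<rbrakk> \<Longrightarrow> g <# (inv g <# C) = C"
  by (simp_all add: lcos_m_assoc lcos_mult_one)

lemma sub_mult_mem:
  assumes "sub H" "h \<in> H" "x \<in> carrier G"
  shows "h \<otimes> x \<in> H \<longleftrightarrow> x \<in> H" "x \<otimes> h \<in> H \<longleftrightarrow> x \<in> H"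
proof -
  have "h \<in> carrier G" using assms sub_mem by auto
  then show "h \<otimes> x \<in> H \<longleftrightarrow> x \<in> H" "x \<otimes> h \<in> H \<longleftrightarrow> x \<in> H"
    using assms subgroup.m_closed[OF assms(1)] subgroup.m_inv_closed[OF assms(1,2)]
    by (metis inv_cancel(1), metis inv_closed m_assoc r_inv r_one)
qed

lemma sum_translate_left:
  assumes "sub H" "h \<in> H"
  shows "(\<Sum>x\<in>H. f (h \<otimes> x)) = (\<Sum>x\<in>H. f x)"
  using assms sub_mem[OF assms(1)]
  by (intro sum.reindex_bij_witness[of _ "\<lambda>x. inv h \<otimes> x" "\<lambda>x. h \<otimes> x"])
    (auto simp: subgroup.m_closed subgroup.m_inv_closed)

lemma sum_translate_right:
  assumes "sub H" "h \<in> H"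
  shows "(\<Sum>x\<in>H. f (x \<otimes> h)) = (\<Sum>x\<in>H. f x)"
  using assms sub_mem[OF assms(1)]
  by (intro sum.reindex_bij_witness[of _ "\<lambda>x. x \<otimes> inv h" "\<lambda>x. x \<otimes> h"])
    (auto simp: subgroup.m_closed subgroup.m_inv_closed m_assoc)

lemma sum_conjugate:
  assumes "g \<in> carrier G" "H \<subseteq> carrier G"
  shows "(\<Sum>x\<in>cj g H. f x) = (\<Sum>x\<in>H. f (g \<otimes> x \<otimes> inv g))"
proof -
  have "inj_on (\<lambda>h. g \<otimes> h \<otimes> inv g) H" using assms by (auto simp: inj_on_def subset_iff)
  then show ?thesis using assms by (simp add: cj_image sum.reindex)
qed

definition dcoset :: "'a set \<Rightarrow> 'a \<Rightarrow> 'a set \<Rightarrow> 'a set" where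
  "dcoset L x K = (\<lambda>(l, k). l \<otimes> x \<otimes> k) ` (L \<times> K)"

lemma dcoset_eq: "(L #> x) <#> K = dcoset L x K"
  by (auto simp: dcoset_def r_coset_def set_mult_def image_def)

lemma double_coset_reps_iff:
  "double_coset_reps G L H K D \<longleftrightarrow> D \<subseteq> H \<and> (\<forall>x\<in>H. \<exists>!h. h \<in> D \<and> x \<in> dcoset L h K)"
  by (simp add: double_coset_reps_def dcoset_eq)

text \<open>Each element of the double coset has as many factorisations
  \<open>l \<otimes> x \<otimes> k\<close> as the group \<open>L \<inter> cj x K\<close> has
  elements.\<close>

lemma sum_dcoset:
  fixes f :: "'a \<Rightarrow> int"
  assumes L: "sub L" and K: "sub K" and x: "x \<in> carrier G"
  shows "int (card (L \<inter> cj x K)) * (\<Sum>y\<in>dcoset L x K. f y) = (\<Sum>l\<in>L. \<Sum>k\<in>K. f (l \<otimes> x \<otimes> k))"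
proof -
  note Lc [simp] = sub_mem[OF L] and Kc [simp] = sub_mem[OF K]
  have fib: "card {(l, k) \<in> L \<times> K. l \<otimes> x \<otimes> k = y} = card (L \<inter> cj x K)" if y: "y \<in> dcoset L x K" for y
  proof -
    obtain l0 k0 where lk: "l0 \<in> L" "k0 \<in> K" "y = l0 \<otimes> x \<otimes> k0"
      using y by (auto simp: dcoset_def)
    \<comment> \<open>From one factorisation \<open>(l0, k0)\<close> all others arise by moving an
      element \<open>s\<close> of \<open>L \<inter> cj x K\<close> across \<open>x\<close>.\<close>
    have "bij_betw (\<lambda>s. (l0 \<otimes> s, inv x \<otimes> inv s \<otimes> x \<otimes> k0)) (L \<inter> cj x K)
        {(l, k) \<in> L \<times> K. l \<otimes> x \<otimes> k = y}"
    proof (rule bij_betw_byWitness[of _ "\<lambda>(l, k). inv l0 \<otimes> l"])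
      show "\<forall>s\<in>L \<inter> cj x K. (case (l0 \<otimes> s, inv x \<otimes> inv s \<otimes> x \<otimes> k0) of (l, k) \<Rightarrow> inv l0 \<otimes> l) = s"
        using lk by simp
      show "\<forall>p\<in>{(l, k). (l, k) \<in> L \<times> K \<and> l \<otimes> x \<otimes> k = y}.
        (l0 \<otimes> (case p of (l, k) \<Rightarrow> inv l0 \<otimes> l),
         inv x \<otimes> inv (case p of (l, k) \<Rightarrow> inv l0 \<otimes> l) \<otimes> x \<otimes> k0) = p"
      proof
        fix p assume "p \<in> {(l, k). (l, k) \<in> L \<times> K \<and> l \<otimes> x \<otimes> k = y}"
        then obtain l k where p: "p = (l, k)" "l \<in> L" "k \<in> K" "l \<otimes> x \<otimes> k = y" by blast
        then have "inv x \<otimes> (inv l \<otimes> (l0 \<otimes> (x \<otimes> k0))) = inv x \<otimes> (inv l \<otimes> (l \<otimes> (x \<otimes> k)))"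
          using lk x by (simp add: m_assoc)
        then show "(l0 \<otimes> (case p of (l, k) \<Rightarrow> inv l0 \<otimes> l),
         inv x \<otimes> inv (case p of (l, k) \<Rightarrow> inv l0 \<otimes> l) \<otimes> x \<otimes> k0) = p"
          using lk x p by (simp add: inv_mult_group m_assoc)
      qed
      have "inv x \<otimes> inv s \<otimes> x \<in> K" if s: "s \<in> L \<inter> cj x K" for s
      proof -
        have "inv x \<otimes> s \<otimes> x \<in> K" using s x K subD by (auto simp: mem_cj)
        then have "inv (inv x \<otimes> s \<otimes> x) \<in> K" using K by (simp add: subgroup.m_inv_closed)
        then show ?thesis using s x by (simp add: inv_mult_group m_assoc)
      qed
      then have "inv x \<otimes> inv s \<otimes> x \<otimes> k0 \<in> K" if "s \<in> L \<inter> cj x K" for s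
        using subgroup.m_closed[OF K _ lk(2)] that by blast
      then show "(\<lambda>s. (l0 \<otimes> s, inv x \<otimes> inv s \<otimes> x \<otimes> k0)) ` (L \<inter> cj x K)
          \<subseteq> {(l, k). (l, k) \<in> L \<times> K \<and> l \<otimes> x \<otimes> k = y}"
        using lk L K x by (auto simp: subgroup.m_closed m_assoc)
      show "(\<lambda>(l, k). inv l0 \<otimes> l) ` {(l, k). (l, k) \<in> L \<times> K \<and> l \<otimes> x \<otimes> k = y} \<subseteq> L \<inter> cj x K"
      proof
        fix s assume "s \<in> (\<lambda>(l, k). inv l0 \<otimes> l) ` {(l, k). (l, k) \<in> L \<times> K \<and> l \<otimes> x \<otimes> k = y}"
        then obtain l k where s: "s = inv l0 \<otimes> l" and a: "l \<in> L" "k \<in> K" "y = l \<otimes> x \<otimes> k"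
          by auto
        then have eq: "l \<otimes> (x \<otimes> k) = l0 \<otimes> (x \<otimes> k0)" using lk x by (simp add: m_assoc)
        have "inv x \<otimes> (inv l0 \<otimes> l) \<otimes> x = inv x \<otimes> (inv l0 \<otimes> (l \<otimes> (x \<otimes> k))) \<otimes> inv k"
          using a lk x by (simp add: m_assoc)
        also have "\<dots> = k0 \<otimes> inv k" using a lk x by (simp add: eq)
        finally have "inv x \<otimes> (inv l0 \<otimes> l) \<otimes> x \<in> K"
          using a lk K by (simp add: subgroup.m_closed subgroup.m_inv_closed)
        then show "s \<in> L \<inter> cj x K"
          unfolding s using a lk L K x subD by (simp add: subgroup.m_closed subgroup.m_inv_closed mem_cj)
      qed
    qed
    then show ?thesis by (rule bij_betw_same_card[symmetric])
  qed
  have fin: "finite (L \<times> K)" using L K sub_finite by blast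
  have "(\<Sum>l\<in>L. \<Sum>k\<in>K. f (l \<otimes> x \<otimes> k)) = (\<Sum>p\<in>L \<times> K. f (case p of (l, k) \<Rightarrow> l \<otimes> x \<otimes> k))"
    by (simp add: sum.cartesian_product case_prod_unfold)
  also have "\<dots> = (\<Sum>y\<in>dcoset L x K. \<Sum>p\<in>{p \<in> L \<times> K. (case p of (l, k) \<Rightarrow> l \<otimes> x \<otimes> k) = y}.
      f (case p of (l, k) \<Rightarrow> l \<otimes> x \<otimes> k))"
    unfolding dcoset_def by (rule sum.image_gen[OF fin])
  also have "\<dots> = (\<Sum>y\<in>dcoset L x K. int (card (L \<inter> cj x K)) * f y)"
  proof (rule sum.cong[OF refl])
    fix y assume y: "y \<in> dcoset L x K"
    let ?P = "{p \<in> L \<times> K. (case p of (l, k) \<Rightarrow> l \<otimes> x \<otimes> k) = y}"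
    have "?P = {(l, k) \<in> L \<times> K. l \<otimes> x \<otimes> k = y}" by auto
    then have "card ?P = card (L \<inter> cj x K)" using fib[OF y] by simp
    moreover have "(\<Sum>p\<in>?P. f (case p of (l, k) \<Rightarrow> l \<otimes> x \<otimes> k)) = (\<Sum>p\<in>?P. f y)"
      by (rule sum.cong) auto
    ultimately show "(\<Sum>p\<in>?P. f (case p of (l, k) \<Rightarrow> l \<otimes> x \<otimes> k)) = int (card (L \<inter> cj x K)) * f y"
      by simp
  qed
  finally show ?thesis by (simp add: sum_distrib_left)
qed

lemma dcoset_subset:
  assumes "sub H" "L \<subseteq> H" "K \<subseteq> H" "x \<in> H"
  shows "dcoset L x K \<subseteq> H"
  using assms by (auto simp: dcoset_def subset_iff intro!: subgroup.m_closed[OF assms(1)])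

lemma dcoset_self: "\<lbrakk>sub L; sub K; x \<in> carrier G\<rbrakk> \<Longrightarrow> x \<in> dcoset L x K"
  unfolding dcoset_def by (rule image_eqI[of _ _ "(\<one>, \<one>)"]) (auto simp: subgroup.one_closed)

lemma dcoset_trans:
  assumes "sub L" "sub K" "x \<in> carrier G" "y \<in> dcoset L x K"
  shows "dcoset L y K \<subseteq> dcoset L x K"
proof
  note [simp] = sub_mem[OF assms(1)] sub_mem[OF assms(2)]
  fix z assume "z \<in> dcoset L y K"
  moreover obtain l k where lk: "l \<in> L" "k \<in> K" "y = l \<otimes> x \<otimes> k"
    using assms by (auto simp: dcoset_def)
  ultimately obtain l' k' where z: "l' \<in> L" "k' \<in> K" "z = l' \<otimes> y \<otimes> k'"
    by (auto simp: dcoset_def)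
  have "z = (l' \<otimes> l) \<otimes> x \<otimes> (k \<otimes> k')" using lk z assms(3) by (simp add: m_assoc)
  moreover have "l' \<otimes> l \<in> L" "k \<otimes> k' \<in> K"
    using lk z assms by (simp_all add: subgroup.m_closed)
  ultimately show "z \<in> dcoset L x K" by (auto simp: dcoset_def)
qed

lemma dcoset_absorb:
  assumes "sub L" "sub K" "x \<in> carrier G" "y \<in> dcoset L x K"
  shows "dcoset L y K = dcoset L x K"
proof
  note [simp] = sub_mem[OF assms(1)] sub_mem[OF assms(2)]
  show "dcoset L y K \<subseteq> dcoset L x K" by (rule dcoset_trans[OF assms])
  obtain l k where lk: "l \<in> L" "k \<in> K" "y = l \<otimes> x \<otimes> k" using assms by (auto simp: dcoset_def)
  then have "x = inv l \<otimes> y \<otimes> inv k" "y \<in> carrier G" using assms(3) by (simp_all add: m_assoc)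
  moreover have "inv l \<in> L" "inv k \<in> K" using lk assms by (simp_all add: subgroup.m_inv_closed)
  ultimately have "x \<in> dcoset L y K" unfolding dcoset_def by (intro image_eqI[of _ _ "(inv l, inv k)"]) auto
  then show "dcoset L x K \<subseteq> dcoset L y K"
    using dcoset_trans[OF assms(1,2) \<open>y \<in> carrier G\<close>] by simp
qed

lemma double_coset_reps_exist:
  assumes "sub H" "sub L" "sub K" "L \<subseteq> H" "K \<subseteq> H"
  shows "\<exists>D. double_coset_reps G L H K D"
proof -
  define rep where "rep x = (SOME y. y \<in> dcoset L x K)" for x
  have rep: "rep x \<in> dcoset L x K" if "x \<in> H" for x
    unfolding rep_def by (rule someI) (use that assms sub_mem dcoset_self in blast)
  have "rep x = rep y" if "x \<in> H" "y \<in> H" "dcoset L x K = dcoset L y K" for x y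
    using that by (simp add: rep_def)
  moreover have "dcoset L (rep x) K = dcoset L x K" if "x \<in> H" for x
    using dcoset_absorb[OF assms(2,3) _ rep[OF that]] that assms sub_mem by blast
  moreover have "rep x \<in> H" if "x \<in> H" for x
    using rep[OF that] dcoset_subset[OF assms(1,4,5) that] by blast
  ultimately have "double_coset_reps G L H K (rep ` H)"
    unfolding double_coset_reps_iff
    using assms dcoset_absorb dcoset_self sub_mem[OF assms(1)] by (smt (verit, best) image_iff image_subset_iff)
  then show ?thesis by blast
qed

lemma sum_over_dcosets:
  fixes f :: "'a \<Rightarrow> int"
  assumes "sub H" "L \<subseteq> H" "K \<subseteq> H" "double_coset_reps G L H K D"
  shows "(\<Sum>x\<in>H. f x) = (\<Sum>x\<in>D. \<Sum>y\<in>dcoset L x K. f y)"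
proof -
  have D: "D \<subseteq> H" "\<And>x. x \<in> H \<Longrightarrow> \<exists>!h. h \<in> D \<and> x \<in> dcoset L h K"
    using assms(4) by (auto simp: double_coset_reps_iff)
  have finD: "finite D" using D(1) assms(1) sub_finite finite_subset by blast
  have fin: "finite (dcoset L x K)" if "x \<in> D" for x
    using dcoset_subset[OF assms(1-3)] that D(1) sub_finite[OF assms(1)] finite_subset by blast
  have "H = (\<Union>x\<in>D. dcoset L x K)"
  proof
    show "H \<subseteq> (\<Union>x\<in>D. dcoset L x K)" using D(2) by fast
    show "(\<Union>x\<in>D. dcoset L x K) \<subseteq> H" using dcoset_subset[OF assms(1-3)] D(1) by fast
  qed
  then have "(\<Sum>x\<in>H. f x) = (\<Sum>x\<in>(\<Union>x\<in>D. dcoset L x K). f x)" by simp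
  also have "\<dots> = (\<Sum>x\<in>D. \<Sum>y\<in>dcoset L x K. f y)"
  proof (rule sum.UNION_disjoint[OF finD])
    show "\<forall>x\<in>D. \<forall>y\<in>D. x \<noteq> y \<longrightarrow> dcoset L x K \<inter> dcoset L y K = {}"
    proof (intro ballI impI)
      fix x y assume xy: "x \<in> D" "y \<in> D" "x \<noteq> y"
      have "z \<notin> dcoset L x K \<inter> dcoset L y K" for z
      proof
        assume z: "z \<in> dcoset L x K \<inter> dcoset L y K"
        then have "z \<in> H" using dcoset_subset[OF assms(1-3)] D(1) xy by blast
        then show False using D(2) xy z by blast
      qed
      then show "dcoset L x K \<inter> dcoset L y K = {}" by blast
    qed
  qed (use fin in blast)
  finally show ?thesis .
qed

text \<open>The order of \<open>L \<inter> cj x K\<close> is constant on a double coset, and its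
  product with the size of the double coset is |L| |K|. So a sum over representatives, once scaled,
  becomes a sum over the whole group in which the representatives no longer occur.\<close>

lemma double_coset_sum:
  fixes v :: "'a \<Rightarrow> int"
  assumes H: "sub H" and L: "sub L" "L \<subseteq> H" and K: "sub K" "K \<subseteq> H"
    and D: "double_coset_reps G L H K D"
    and v: "\<And>l x k. \<lbrakk>l \<in> L; x \<in> H; k \<in> K\<rbrakk> \<Longrightarrow> v (l \<otimes> x \<otimes> k) = v x"
  shows "int (card L) * int (card K) * (\<Sum>x\<in>D. v x) = (\<Sum>x\<in>H. int (card (L \<inter> cj x K)) * v x)"
proof -
  have DH: "D \<subseteq> H" using D by (simp add: double_coset_reps_iff)
  note [simp] = sub_mem[OF H] sub_mem[OF L(1)] sub_mem[OF K(1)]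
  have "(\<Sum>y\<in>dcoset L x K. int (card (L \<inter> cj y K)) * v y) = int (card L) * int (card K) * v x"
    if x: "x \<in> D" for x
  proof -
    have xH: "x \<in> H" using x DH by auto
    then have xc: "x \<in> carrier G" by simp
    have "int (card (L \<inter> cj (l \<otimes> x \<otimes> k) K)) * v (l \<otimes> x \<otimes> k) = int (card (L \<inter> cj x K)) * v x"
      if lk: "l \<in> L" "k \<in> K" for l k
    proof -
      have "cj (l \<otimes> x \<otimes> k) K = cj l (cj x K)"
        using lk xc K subD by (simp add: cj_cj[symmetric] cj_closed cj_self)
      then have "L \<inter> cj (l \<otimes> x \<otimes> k) K = cj l (L \<inter> cj x K)"
        using lk xc subD[OF L(1)] subD[OF K(1)] by (simp add: cj_Int cj_closed cj_self[OF L(1)])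
      then show ?thesis
        using v[OF lk(1) xH lk(2)] lk subD[OF L(1)] by (simp add: card_cj inf.coboundedI1)
    qed
    then have "(\<Sum>l\<in>L. \<Sum>k\<in>K. int (card (L \<inter> cj (l \<otimes> x \<otimes> k) K)) * v (l \<otimes> x \<otimes> k))
      = int (card L) * (int (card K) * (int (card (L \<inter> cj x K)) * v x))"
      by simp
    then have "int (card (L \<inter> cj x K)) * (\<Sum>y\<in>dcoset L x K. int (card (L \<inter> cj y K)) * v y)
       = int (card (L \<inter> cj x K)) * (int (card L) * int (card K) * v x)"
      unfolding sum_dcoset[OF L(1) K(1) xc] by (simp add: algebra_simps)
    moreover have "int (card (L \<inter> cj x K)) \<noteq> 0"
      using sub_Int[OF L(1) cj_sub[OF xc K(1)]] by simp
    ultimately show ?thesis by simp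
  qed
  then show ?thesis
    by (simp add: sum_over_dcosets[OF H L(2) K(2) D] sum_distrib_left)
qed

section \<open>The dual of the regular representation\<close>

text \<open>
  The class of \<open>t\<^sup>H\<^sub>A c\<^sub>g r\<^sup>K\<close> depends only on \<open>H\<close>, \<open>A\<close> and the coset \<open>g K\<close> up to simultaneous
  translation by \<open>H\<close>, and these classes turn out to be a basis. An integer valued function \<open>u H A C\<close> with
  \<open>C = g K\<close>, invariant under \<open>H\<close>, is thus a linear form on the Mackey algebra; \<open>act\<close> is the
  right action of the generators on such forms.
\<close>

definition valid :: "'a set \<Rightarrow> 'a set \<Rightarrow> 'a set \<Rightarrow> bool" where
  "valid H A C \<longleftrightarrow> sub H \<and> sub A \<and> A \<subseteq> H \<and> C \<subseteq> carrier G \<and> (\<forall>a\<in>A. a <# C = C)"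

definition invariant :: "('a set \<Rightarrow> 'a set \<Rightarrow> 'a set \<Rightarrow> int) \<Rightarrow> bool" where
  "invariant u \<longleftrightarrow> (\<forall>H A C. \<forall>h\<in>H. valid H A C \<longrightarrow> u H (cj h A) (h <# C) = u H A C)"

text \<open>Relations are compared on valid triples only; elsewhere the values produced by
  \<open>act\<close> are accidental.\<close>

definition veq :: "('a set \<Rightarrow> 'a set \<Rightarrow> 'a set \<Rightarrow> int) \<Rightarrow> ('a set \<Rightarrow> 'a set \<Rightarrow> 'a set \<Rightarrow> int) \<Rightarrow> bool" where
  "veq u v \<longleftrightarrow> (\<forall>H A C. valid H A C \<longrightarrow> u H A C = v H A C)"

definition reps :: "'a set \<Rightarrow> 'a set \<Rightarrow> 'a set \<Rightarrow> 'a set" where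
  "reps L H K = (SOME D. double_coset_reps G L H K D)"

primrec act :: "'a mackey_gen \<Rightarrow> ('a set \<Rightarrow> 'a set \<Rightarrow> 'a set \<Rightarrow> int) \<Rightarrow> 'a set \<Rightarrow> 'a set \<Rightarrow> 'a set \<Rightarrow> int" where
  "act (Tr K H) u = (\<lambda>H' A C. if H' = H then u K A C else 0)"
| "act (Con g H) u = (\<lambda>H' A C. if H' = H then u (cj g H) (cj g A) (g <# C) else 0)"
| "act (Res K H) u = (\<lambda>H' A C. if H' = K then \<Sum>h\<in>reps H K A. u H (H \<inter> cj h A) (h <# C) else 0)"

lemma reps: "\<lbrakk>sub H; sub L; sub K; L \<subseteq> H; K \<subseteq> H\<rbrakk> \<Longrightarrow> double_coset_reps G L H K (reps L H K)"
  unfolding reps_def by (rule someI_ex) (rule double_coset_reps_exist)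

lemma reps_subset: "\<lbrakk>sub H; sub L; sub K; L \<subseteq> H; K \<subseteq> H\<rbrakk> \<Longrightarrow> reps L H K \<subseteq> H"
  using reps by (simp add: double_coset_reps_iff)

lemma validD:
  assumes "valid H A C"
  shows "sub H" "sub A" "A \<subseteq> H" "C \<subseteq> carrier G" "A \<subseteq> carrier G" "H \<subseteq> carrier G"
    "a \<in> A \<Longrightarrow> a <# C = C"
  using assms subD by (auto simp: valid_def)

lemma valid_Tr: "\<lbrakk>valid H A C; sub K; H \<subseteq> K\<rbrakk> \<Longrightarrow> valid K A C"
  by (auto simp: valid_def)

lemma l_coset_stable_cj:
  assumes "g \<in> carrier G" "C \<subseteq> carrier G" "sub A" "\<And>a. a \<in> A \<Longrightarrow> a <# C = C" "x \<in> cj g A"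
  shows "x <# (g <# C) = g <# C"
proof -
  obtain a where a: "a \<in> A" "x = g \<otimes> a \<otimes> inv g"
    using assms subD by (auto simp: cj_image)
  then have [simp]: "a \<in> carrier G" using assms sub_mem by auto
  have "x <# (g <# C) = (g \<otimes> a) <# C"
    using a assms by (simp add: lcos_m_assoc m_assoc)
  also have "\<dots> = g <# (a <# C)" using assms by (simp add: lcos_m_assoc)
  finally show ?thesis using a assms(4) by simp
qed

lemma valid_Con:
  assumes "valid H A C" "g \<in> carrier G"
  shows "valid (cj g H) (cj g A) (g <# C)"
  unfolding valid_def
  using assms validD[OF assms(1)] l_coset_stable_cj[OF assms(2) validD(4,2,7)[OF assms(1)]]
  by (intro conjI ballI cj_sub l_coset_closed cj_mono) auto

lemma valid_Res:
  assumes "valid K A C" "g \<in> carrier G" "sub H"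
  shows "valid H (H \<inter> cj g A) (g <# C)"
  unfolding valid_def
  using assms validD[OF assms(1)] l_coset_stable_cj[OF assms(2) validD(4,2,7)[OF assms(1)]]
  by (intro conjI ballI sub_Int cj_sub l_coset_closed) auto

lemma invariantD: "\<lbrakk>invariant u; valid H A C; h \<in> H\<rbrakk> \<Longrightarrow> u H (cj h A) (h <# C) = u H A C"
  by (auto simp: invariant_def)

text \<open>The summand in the \<open>Res\<close> clause of \<open>act\<close> is constant on double
  cosets: on the left by invariance of \<open>u\<close>, on the right because \<open>A\<close>
  stabilises both itself and \<open>C\<close>. Hence the choice hidden in \<open>reps\<close> does
  not matter.\<close>

lemma restricted_value_invariant:
  assumes u: "invariant u" and v: "valid K A C" and H: "sub H" "H \<subseteq> K"
    and "l \<in> H" "x \<in> K" "a \<in> A"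
  shows "u H (H \<inter> cj (l \<otimes> x \<otimes> a) A) ((l \<otimes> x \<otimes> a) <# C) = u H (H \<inter> cj x A) (x <# C)"
proof -
  note d [simp] = validD[OF v]
  have [simp]: "l \<in> carrier G" "x \<in> carrier G" "a \<in> carrier G"
    using assms(5-7) sub_mem[OF H(1)] sub_mem[OF d(1)] sub_mem[OF d(2)] by auto
  have "cj (l \<otimes> x \<otimes> a) A = cj l (cj x A)"
    using assms by (simp add: cj_cj[symmetric] cj_closed cj_self)
  then have 1: "H \<inter> cj (l \<otimes> x \<otimes> a) A = cj l (H \<inter> cj x A)"
    using assms subD[OF H(1)] by (simp add: cj_Int cj_closed cj_self[OF H(1)])
  have 2: "(l \<otimes> x \<otimes> a) <# C = l <# (x <# C)"
    using assms by (simp add: lcos_m_assoc[symmetric] l_coset_closed)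
  show ?thesis
    unfolding 1 2 by (rule invariantD[OF u valid_Res[OF v _ H(1)] assms(5)]) simp
qed

text \<open>The \<open>Res\<close> clause of \<open>act\<close> is the Mackey formula with chosen
  representatives. Scaling removes the choice, and the positive factors cancel over the integers, so
  identities between restrictions can be checked on sums over groups, where translation and
  conjugation are substitutions.\<close>

lemma act_Res_scaled:
  assumes u: "invariant u" and v: "valid K A C" and H: "sub H" "H \<subseteq> K"
  shows "int (card H) * int (card A) * act (Res K H) u K A C
    = (\<Sum>k\<in>K. int (card (H \<inter> cj k A)) * u H (H \<inter> cj k A) (k <# C))"
  using double_coset_sum[OF validD(1)[OF v] H validD(2,3)[OF v]
      reps[OF validD(1)[OF v] H(1) validD(2)[OF v] H(2) validD(3)[OF v]],
      of "\<lambda>x. u H (H \<inter> cj x A) (x <# C)"] restricted_value_invariant[OF u v H] by simp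

lemma mackey_gensE:
  assumes "x \<in> mackey_gens G"
  obtains (Tr) K H where "x = Tr K H" "sub H" "sub K" "H \<subseteq> K"
  | (Res) K H where "x = Res K H" "sub H" "sub K" "H \<subseteq> K"
  | (Con) g H where "x = Con g H" "g \<in> carrier G" "sub H"
  using assms unfolding mackey_gens_def by blast

lemma act_invariant:
  assumes u: "invariant u" and x: "x \<in> mackey_gens G"
  shows "invariant (act x u)"
  using x
proof (cases rule: mackey_gensE)
  case (Tr K H)
  then have "u K (cj h A) (h <# C) = u K A C" if "valid H A C" "h \<in> H" for A C h
    using invariantD[OF u valid_Tr[OF that(1)]] that(2) by blast
  then show ?thesis using Tr by (auto simp: invariant_def)
next
  case (Con g H)
  have "u (cj g H) (cj g (cj h A)) (g <# (h <# C)) = u (cj g H) (cj g A) (g <# C)"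
    if v: "valid H A C" and h: "h \<in> H" for h A C
  proof -
    note d = validD[OF v]
    have hc [simp]: "h \<in> carrier G" using h d by auto
    have "g \<otimes> h \<otimes> inv g \<in> cj g H"
      using h d Con by (auto simp: cj_image)
    moreover have "cj (g \<otimes> h \<otimes> inv g) (cj g A) = cj g (cj h A)"
      "(g \<otimes> h \<otimes> inv g) <# (g <# C) = g <# (h <# C)"
      using d Con by (simp_all add: cj_cj lcos_m_assoc m_assoc)
    ultimately show ?thesis
      using invariantD[OF u valid_Con[OF v Con(2)]] by metis
  qed
  then show ?thesis using Con by (auto simp: invariant_def)
next
  case (Res K H)
  have "act (Res K H) u K (cj h A) (h <# C) = act (Res K H) u K A C"
    if v: "valid K A C" and h: "h \<in> K" for h A C
  proof -
    note d = validD[OF v]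
    have hc [simp]: "h \<in> carrier G" using h d by auto
    have v': "valid K (cj h A) (h <# C)"
      using valid_Con[OF v hc] cj_self[OF d(1) h] by simp
    let ?f = "\<lambda>k. int (card (H \<inter> cj k A)) * u H (H \<inter> cj k A) (k <# C)"
    have "int (card H) * int (card A) * act (Res K H) u K (cj h A) (h <# C) = (\<Sum>k\<in>K. ?f (k \<otimes> h))"
      using act_Res_scaled[OF u v' Res(2,4)] d sub_mem[OF d(1)]
      by (simp add: cj_cj lcos_m_assoc)
    also have "\<dots> = int (card H) * int (card A) * act (Res K H) u K A C"
      unfolding act_Res_scaled[OF u v Res(2,4)] by (rule sum_translate_right[OF d(1) h])
    finally show ?thesis using Res d by simp
  qed
  then show ?thesis unfolding Res(1) by (auto simp: invariant_def)
qed

lemma act_veq: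
  assumes uv: "veq u v" and x: "x \<in> mackey_gens G"
  shows "veq (act x u) (act x v)"
  using x
proof (cases rule: mackey_gensE)
  case (Tr K H)
  then show ?thesis using uv by (auto simp: veq_def dest: valid_Tr)
next
  case (Con g H)
  then show ?thesis using uv by (auto simp: veq_def dest: valid_Con)
next
  case (Res K H)
  have "(\<Sum>h\<in>reps H K A. u H (H \<inter> cj h A) (h <# C)) = (\<Sum>h\<in>reps H K A. v H (H \<inter> cj h A) (h <# C))"
    if "valid K A C" for A C
  proof (rule sum.cong[OF refl])
    fix h assume "h \<in> reps H K A"
    then have "h \<in> carrier G"
      using reps_subset[OF Res(3,2) _ Res(4)] validD[OF that] by blast
    then show "u H (H \<inter> cj h A) (h <# C) = v H (H \<inter> cj h A) (h <# C)"
      using uv valid_Res[OF that _ Res(2)] by (auto simp: veq_def)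
  qed
  then show ?thesis unfolding Res(1) by (auto simp: veq_def)
qed

lemma act_sum: "act x (\<lambda>H A C. \<Sum>i\<in>S. u i H A C) = (\<lambda>H A C. \<Sum>i\<in>S. act x (u i) H A C)"
  by (cases x) (auto simp: fun_eq_iff intro: sum.swap)

lemma acts_invariant: "\<lbrakk>invariant u; w \<in> lists (mackey_gens G)\<rbrakk> \<Longrightarrow> invariant (fold act w u)"
  by (induction w arbitrary: u) (auto simp: act_invariant)

lemma acts_veq: "\<lbrakk>veq u v; w \<in> lists (mackey_gens G)\<rbrakk> \<Longrightarrow> veq (fold act w u) (fold act w v)"
  by (induction w arbitrary: u v) (auto simp: act_veq)

lemma acts_sum: "fold act w (\<lambda>H A C. \<Sum>i\<in>S. u i H A C) = (\<lambda>H A C. \<Sum>i\<in>S. fold act w (u i) H A C)"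
  by (induction w arbitrary: u) (auto simp: act_sum)

lemma act_tr_res_refl:
  assumes u: "invariant u" and H: "sub H"
  shows "veq (act (Tr H H) u) (act (Res H H) u)"
proof -
  have "act (Res H H) u H A C = u H A C" if v: "valid H A C" for A C
  proof -
    note d = validD[OF v]
    have "int (card H) * int (card A) * act (Res H H) u H A C
      = (\<Sum>k\<in>H. int (card (H \<inter> cj k A)) * u H (H \<inter> cj k A) (k <# C))"
      by (rule act_Res_scaled[OF u v H]) simp
    also have "\<dots> = (\<Sum>k\<in>H. int (card A) * u H A C)"
    proof (rule sum.cong[OF refl])
      fix k assume k: "k \<in> H"
      then have "k \<in> carrier G" using d by auto
      moreover have "cj k A \<subseteq> H" using cj_mono[of k H A] cj_self[OF H k] d calculation by simp
      ultimately show "int (card (H \<inter> cj k A)) * u H (H \<inter> cj k A) (k <# C) = int (card A) * u H A C"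
        using invariantD[OF u v k] d by (simp add: Int_absorb1)
    qed
    finally show ?thesis using H d by simp
  qed
  then show ?thesis by (auto simp: veq_def)
qed

lemma act_tr_con_refl:
  assumes u: "invariant u" and H: "sub H" "h \<in> H"
  shows "veq (act (Tr H H) u) (act (Con h H) u)"
  using invariantD[OF u _ H(2)] cj_self[OF H] by (auto simp: veq_def)

text \<open>Two restrictions in succession give a double sum over \<open>K\<close> and
  \<open>L\<close> whose summand depends on \<open>k \<otimes> l\<close> only. Translation inside
  \<open>L\<close> makes the inner sum independent of \<open>k\<close>, which leaves |K| times the
  single restriction.\<close>

lemma act_res_res:
  assumes u: "invariant u" and "sub H" "sub K" "sub L" "H \<subseteq> K" "K \<subseteq> L"
  shows "veq (act (Res L K) (act (Res K H) u)) (act (Res L H) u)"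
proof -
  have "act (Res L K) (act (Res K H) u) L A C = act (Res L H) u L A C" if v: "valid L A C" for A C
  proof -
    note d = validD[OF v]
    have inv: "invariant (act (Res K H) u)"
      using assms by (intro act_invariant) (auto simp: mackey_gens_def)
    have HL: "H \<subseteq> L" using assms by auto
    let ?f = "\<lambda>x. int (card (H \<inter> cj x A)) * u H (H \<inter> cj x A) (x <# C)"
    have Lc: "l \<in> carrier G" if "l \<in> L" for l using that d by auto
    have "int (card H) * (int (card K) * int (card A) * act (Res L K) (act (Res K H) u) L A C)
      = (\<Sum>l\<in>L. int (card H) * int (card (K \<inter> cj l A)) * act (Res K H) u K (K \<inter> cj l A) (l <# C))"
      unfolding act_Res_scaled[OF inv v assms(3,6)] by (simp add: sum_distrib_left algebra_simps)
    also have "\<dots> = (\<Sum>l\<in>L. \<Sum>k\<in>K. ?f (k \<otimes> l))"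
    proof (rule sum.cong[OF refl])
      fix l assume l: "l \<in> L"
      have "int (card H) * int (card (K \<inter> cj l A)) * act (Res K H) u K (K \<inter> cj l A) (l <# C)
        = (\<Sum>k\<in>K. int (card (H \<inter> cj k (K \<inter> cj l A))) * u H (H \<inter> cj k (K \<inter> cj l A)) (k <# (l <# C)))"
        by (rule act_Res_scaled[OF u valid_Res[OF v Lc[OF l] assms(3)] assms(2,5)])
      also have "\<dots> = (\<Sum>k\<in>K. ?f (k \<otimes> l))"
      proof (rule sum.cong[OF refl])
        fix k assume k: "k \<in> K"
        then have [simp]: "k \<in> carrier G" using assms sub_mem by auto
        have "H \<inter> cj k (K \<inter> cj l A) = H \<inter> cj (k \<otimes> l) A"
          using k l Lc d subD[OF assms(3)] cj_self[OF assms(3) k] assms(5)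
          by (auto simp: cj_Int cj_closed cj_cj)
        then show "int (card (H \<inter> cj k (K \<inter> cj l A))) * u H (H \<inter> cj k (K \<inter> cj l A)) (k <# (l <# C))
           = ?f (k \<otimes> l)"
          using l Lc d by (simp add: lcos_m_assoc)
      qed
      finally show "int (card H) * int (card (K \<inter> cj l A)) * act (Res K H) u K (K \<inter> cj l A) (l <# C)
        = (\<Sum>k\<in>K. ?f (k \<otimes> l))" .
    qed
    also have "\<dots> = (\<Sum>k\<in>K. \<Sum>l\<in>L. ?f (k \<otimes> l))" by (rule sum.swap)
    also have "\<dots> = (\<Sum>k\<in>K. \<Sum>l\<in>L. ?f l)"
      by (rule sum.cong[OF refl], rule sum_translate_left[OF d(1)]) (use assms in auto)
    also have "\<dots> = int (card K) * (int (card H) * int (card A) * act (Res L H) u L A C)"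
      unfolding act_Res_scaled[OF u v assms(2) HL] by simp
    finally show ?thesis using assms d by simp
  qed
  then show ?thesis by (auto simp: veq_def)
qed

lemma act_con_con:
  assumes "sub H" "g \<in> carrier G" "g' \<in> carrier G"
  shows "veq (act (Con g H) (act (Con g' (cj g H)) u)) (act (Con (g' \<otimes> g) H) u)"
  unfolding veq_def
proof (intro allI impI)
  fix H' A C assume "valid H' A C"
  note d = validD[OF this]
  show "act (Con g H) (act (Con g' (cj g H)) u) H' A C = act (Con (g' \<otimes> g) H) u H' A C"
    using assms d by (simp add: cj_cj lcos_m_assoc)
qed

lemma act_tr_con:
  assumes "sub H" "sub K" "H \<subseteq> K" "g \<in> carrier G"
  shows "act (Con g H) (act (Tr (cj g K) (cj g H)) u) = act (Tr K H) (act (Con g K) u)"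
  using assms by (auto simp: fun_eq_iff)

lemma act_res_con:
  assumes u: "invariant u" and "sub H" "sub K" "H \<subseteq> K" "g \<in> carrier G"
  shows "veq (act (Con g K) (act (Res (cj g K) (cj g H)) u)) (act (Res K H) (act (Con g H) u))"
proof -
  have "act (Res (cj g K) (cj g H)) u (cj g K) (cj g A) (g <# C) = act (Res K H) (act (Con g H) u) K A C"
    if v: "valid K A C" for A C
  proof -
    note d = validD[OF v]
    have inv: "invariant (act (Con g H) u)"
      using assms by (intro act_invariant) (auto simp: mackey_gens_def)
    have Kc [simp]: "k \<in> carrier G" if "k \<in> K" for k using that d by auto
    have Hc: "H \<subseteq> carrier G" using assms subD by auto
    note sc = act_Res_scaled[OF u valid_Con[OF v assms(5)] cj_sub[OF assms(5,2)] cj_mono[OF assms(5) d(6) assms(4)]]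
    have "int (card H) * int (card A) * act (Res (cj g K) (cj g H)) u (cj g K) (cj g A) (g <# C)
       = (\<Sum>k\<in>cj g K. int (card (cj g H \<inter> cj k (cj g A))) * u (cj g H) (cj g H \<inter> cj k (cj g A)) (k <# (g <# C)))"
      using sc assms d Hc by simp
    also have "\<dots> = (\<Sum>k\<in>K. int (card (cj g H \<inter> cj (g \<otimes> k \<otimes> inv g) (cj g A))) *
        u (cj g H) (cj g H \<inter> cj (g \<otimes> k \<otimes> inv g) (cj g A)) ((g \<otimes> k \<otimes> inv g) <# (g <# C)))"
      by (rule sum_conjugate[OF assms(5) d(6)])
    also have "\<dots> = (\<Sum>k\<in>K. int (card (H \<inter> cj k A)) * act (Con g H) u H (H \<inter> cj k A) (k <# C))"
    proof (rule sum.cong[OF refl])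
      fix k assume k: "k \<in> K"
      have "cj g H \<inter> cj (g \<otimes> k \<otimes> inv g) (cj g A) = cj g (H \<inter> cj k A)"
        using k assms d Hc by (simp add: cj_Int cj_closed cj_cj m_assoc)
      moreover have "(g \<otimes> k \<otimes> inv g) <# (g <# C) = g <# (k <# C)"
        using k assms d by (simp add: lcos_m_assoc m_assoc)
      moreover have "card (cj g (H \<inter> cj k A)) = card (H \<inter> cj k A)"
        using assms Hc by (intro card_cj) auto
      ultimately show "int (card (cj g H \<inter> cj (g \<otimes> k \<otimes> inv g) (cj g A))) *
        u (cj g H) (cj g H \<inter> cj (g \<otimes> k \<otimes> inv g) (cj g A)) ((g \<otimes> k \<otimes> inv g) <# (g <# C))
        = int (card (H \<inter> cj k A)) * act (Con g H) u H (H \<inter> cj k A) (k <# C)"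
        by simp
    qed
    also have "\<dots> = int (card H) * int (card A) * act (Res K H) (act (Con g H) u) K A C"
      by (rule act_Res_scaled[OF inv v assms(2,4), symmetric])
    finally show ?thesis using assms d by simp
  qed
  then show ?thesis by (simp add: veq_def)
qed

text \<open>After scaling, a representative \<open>x\<close> contributes exactly the part of the
  group sum that lies in the double coset of \<open>x\<close>. These parts add up to the sum over
  \<open>H\<close> that belongs to the restriction on the left-hand side.\<close>

lemma act_mackey:
  assumes u: "invariant u" and H: "sub H" and K: "sub K" "K \<subseteq> H" and L: "sub L" "L \<subseteq> H"
    and D: "double_coset_reps G L H K D"
  shows "veq (act (Tr H K) (act (Res H L) u))
    (\<lambda>H' A C. \<Sum>x\<in>D. act (Res K (cj (inv x) L \<inter> K)) (act (Con x (cj (inv x) L \<inter> K))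
        (act (Tr L (L \<inter> cj x K)) u)) H' A C)"
proof -
  have DH: "D \<subseteq> H" using D by (simp add: double_coset_reps_iff)
  have "act (Res H L) u H A C = (\<Sum>x\<in>D. act (Res K (cj (inv x) L \<inter> K)) (act (Con x (cj (inv x) L \<inter> K))
        (act (Tr L (L \<inter> cj x K)) u)) K A C)" if v: "valid K A C" for A C
  proof -
    note d = validD[OF v]
    have vH: "valid H A C" using valid_Tr[OF v H K(2)] .
    let ?f = "\<lambda>x. int (card (L \<inter> cj x A)) * u L (L \<inter> cj x A) (x <# C)"
    have "int (card L) * int (card A) * act (Res K (cj (inv x) L \<inter> K)) (act (Con x (cj (inv x) L \<inter> K))
        (act (Tr L (L \<inter> cj x K)) u)) K A C = (\<Sum>y\<in>dcoset L x K. ?f y)"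
      (is "_ * act (Res K ?M) ?u K A C = _") if x: "x \<in> D" for x
    proof -
      have xH: "x \<in> H" using x DH by auto
      have xc [simp]: "x \<in> carrier G" using xH H sub_mem by auto
      note Lc = subD[OF L(1)] and Kc = subD[OF K(1)]
      have M: "sub ?M" "?M \<subseteq> K" "?M \<subseteq> carrier G"
        using sub_Int[OF cj_sub[OF _ L(1)] K(1)] Kc by auto
      have xM: "cj x ?M = L \<inter> cj x K"
        using Lc Kc by (simp add: cj_Int cj_closed)
      have LxK: "sub (L \<inter> cj x K)" using sub_Int[OF L(1) cj_sub[OF xc K(1)]] .
      have cM: "card ?M = card (L \<inter> cj x K)"
        using card_cj[OF xc M(3)] xM by simp
      have inv: "invariant ?u"
        using LxK L M by (intro act_invariant u) (auto simp: mackey_gens_def)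
      have "int (card ?M) * int (card A) * act (Res K ?M) ?u K A C
         = (\<Sum>k\<in>K. int (card (?M \<inter> cj k A)) * ?u ?M (?M \<inter> cj k A) (k <# C))"
        by (rule act_Res_scaled[OF inv v M(1,2)])
      also have "\<dots> = (\<Sum>k\<in>K. ?f (x \<otimes> k))"
      proof (rule sum.cong[OF refl])
        fix k assume k: "k \<in> K"
        have kc [simp]: "k \<in> carrier G" using k K sub_mem by auto
        have "cj (x \<otimes> k) A = cj x (cj k A)" using d by (simp add: cj_cj)
        moreover have "cj k A \<subseteq> K" using cj_mono[OF kc Kc d(3)] cj_self[OF K(1) k] by simp
        then have "cj x (cj k A) \<subseteq> cj x K" using cj_mono[OF xc Kc] by simp
        ultimately have eq: "cj x (?M \<inter> cj k A) = L \<inter> cj (x \<otimes> k) A"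
          using d M by (subst cj_Int) (auto simp: cj_closed xM)
        have "card (?M \<inter> cj k A) = card (cj x (?M \<inter> cj k A))"
          using M by (intro card_cj[symmetric]) auto
        then show "int (card (?M \<inter> cj k A)) * ?u ?M (?M \<inter> cj k A) (k <# C) = ?f (x \<otimes> k)"
          using d by (simp add: xM eq lcos_m_assoc)
      qed
      finally have 1: "int (card ?M) * int (card A) * act (Res K ?M) ?u K A C = (\<Sum>k\<in>K. ?f (x \<otimes> k))" .
      \<comment> \<open>Left translation by \<open>L\<close> does not change the summand, so the sum
        over \<open>K\<close> already determines the sum over the double coset.\<close>
      have "?f (l \<otimes> (x \<otimes> k)) = ?f (x \<otimes> k)" if l: "l \<in> L" and k: "k \<in> K" for l k
      proof -
        have lc [simp]: "l \<in> carrier G" "k \<in> carrier G" using k l K L sub_mem by auto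
        have xk: "x \<otimes> k \<in> H" using xH k K subgroup.m_closed[OF H] by auto
        have "L \<inter> cj (l \<otimes> (x \<otimes> k)) A = cj l (L \<inter> cj (x \<otimes> k) A)"
          using l d Lc by (simp add: cj_Int cj_closed cj_self[OF L(1)] cj_cj)
        moreover have "u L (L \<inter> cj (l \<otimes> (x \<otimes> k)) A) ((l \<otimes> (x \<otimes> k)) <# C)
            = u L (L \<inter> cj (x \<otimes> k) A) ((x \<otimes> k) <# C)"
          using restricted_value_invariant[OF u vH L l xk, of \<one>] d subgroup.one_closed[OF d(2)]
          by simp
        moreover have "card (cj l (L \<inter> cj (x \<otimes> k) A)) = card (L \<inter> cj (x \<otimes> k) A)"
          using Lc by (intro card_cj) auto
        ultimately show ?thesis by simp
      qed
      then have "(\<Sum>l\<in>L. \<Sum>k\<in>K. ?f (l \<otimes> x \<otimes> k)) = int (card L) * (\<Sum>k\<in>K. ?f (x \<otimes> k))"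
        using L K sub_mem by (simp add: m_assoc)
      then have "int (card ?M) * (\<Sum>y\<in>dcoset L x K. ?f y)
          = int (card ?M) * (int (card L) * int (card A) * act (Res K ?M) ?u K A C)"
        unfolding cM sum_dcoset[OF L(1) K(1) xc] 1[unfolded cM, symmetric] by (simp add: algebra_simps)
      then show ?thesis using M by simp
    qed
    then have "int (card L) * int (card A) * (\<Sum>x\<in>D. act (Res K (cj (inv x) L \<inter> K)) (act (Con x (cj (inv x) L \<inter> K))
        (act (Tr L (L \<inter> cj x K)) u)) K A C) = (\<Sum>x\<in>D. \<Sum>y\<in>dcoset L x K. ?f y)"
      unfolding sum_distrib_left by (intro sum.cong) auto
    also have "\<dots> = (\<Sum>y\<in>H. ?f y)"
      by (rule sum_over_dcosets[OF H L(2) K(2) D, symmetric])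
    also have "\<dots> = int (card L) * int (card A) * act (Res H L) u H A C"
      by (rule act_Res_scaled[OF u vH L, symmetric])
    finally show ?thesis using L d by simp
  qed
  then show ?thesis by (auto simp: veq_def)
qed

end

section \<open>Groups of order exactly divisible by a prime\<close>

text \<open>Orbits have length 1 or \<open>p\<close>, and \<open>Y\<close> picks one point from each
  long orbit. It is chosen before \<open>v\<close>, because one and the same \<open>Y\<close> has to
  serve a whole family of marks later.\<close>

lemma prime_orbit_decomposition:
  fixes X :: "'b set"
  assumes "finite X" "prime p" "\<sigma> ` X \<subseteq> X" "\<And>x. x \<in> X \<Longrightarrow> (\<sigma> ^^ p) x = x"
  shows "\<exists>Y\<subseteq>{x \<in> X. \<sigma> x \<noteq> x}. \<forall>v :: 'b \<Rightarrow> int. (\<forall>x\<in>X. v (\<sigma> x) = v x) \<longrightarrow>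
    (\<Sum>x\<in>X. v x) = (\<Sum>x\<in>{x \<in> X. \<sigma> x = x}. v x) + int p * (\<Sum>x\<in>Y. v x)"
  using assms
proof (induction "card X" arbitrary: X rule: less_induct)
  case less
  show ?case
  proof (cases "\<forall>x\<in>X. \<sigma> x = x")
    case True
    then have "{x \<in> X. \<sigma> x = x} = X" by auto
    then show ?thesis by (intro exI[of _ "{}"]) simp
  next
    case False
    then obtain x where x: "x \<in> X" "\<sigma> x \<noteq> x" by blast
    have iter: "(\<sigma> ^^ i) y \<in> X" if "y \<in> X" for i y
      using that less.prems(3) by (induction i) auto
    let ?O = "(\<lambda>i. (\<sigma> ^^ i) x) ` {..<p}"
    have p0: "p > 0" using less.prems(2) prime_gt_0_nat by blast
    have xp: "(\<sigma> ^^ p) x = x" using less.prems(4) x by blast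
    have mult: "(\<sigma> ^^ (d * a)) x = x" if "(\<sigma> ^^ d) x = x" for d a
      using that by (induction a) (simp_all add: funpow_add)
    \<comment> \<open>By Bezout, a point fixed by an iterate of exponent prime to \<open>p\<close>
      is fixed by \<open>\<sigma>\<close> itself.\<close>
    have nofix: "(\<sigma> ^^ d) x \<noteq> x" if d0: "0 < d" "d < p" for d
    proof
      assume d: "(\<sigma> ^^ d) x = x"
      have "coprime d p"
        using that less.prems(2) by (metis coprime_commute nat_dvd_not_less prime_imp_coprime)
      then obtain a b where ab: "d * a = p * b + 1"
        using bezout_nat[of d p] d0 by auto
      have "\<sigma> x = \<sigma> ((\<sigma> ^^ (p * b)) x)" using mult[OF xp] by simp
      also have "\<dots> = (\<sigma> ^^ (d * a)) x" unfolding ab by simp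
      also have "\<dots> = x" by (rule mult[OF d])
      finally show False using x by simp
    qed
    have inj: "inj_on (\<lambda>i. (\<sigma> ^^ i) x) {..<p}"
    proof -
      have "False" if "i < j" "j < p" "(\<sigma> ^^ i) x = (\<sigma> ^^ j) x" for i j
      proof -
        have "x = (\<sigma> ^^ (p - i)) ((\<sigma> ^^ i) x)"
          using that(1,2) xp by (simp add: funpow_add[unfolded o_def, THEN fun_cong, symmetric])
        also have "\<dots> = (\<sigma> ^^ ((p - i) + j)) x" unfolding that(3) by (simp add: funpow_add)
        also have "(p - i) + j = (j - i) + p" using that by simp
        also have "(\<sigma> ^^ ((j - i) + p)) x = (\<sigma> ^^ (j - i)) x" by (simp add: funpow_add xp)
        finally have "(\<sigma> ^^ (j - i)) x = x" by simp
        moreover have "0 < j - i" "j - i < p" using that(1,2) by linarith+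
        ultimately show False using nofix by blast
      qed
      then show ?thesis
        by (intro inj_onI) (metis lessThan_iff nat_neq_iff)
    qed
    have card_O: "card ?O = p" using card_image[OF inj] by simp
    have OX: "?O \<subseteq> X" using iter x by auto
    have O_closed: "\<sigma> y \<in> ?O" if y: "y \<in> ?O" for y
    proof -
      obtain i where i: "i < p" "y = (\<sigma> ^^ i) x" using y by auto
      show ?thesis
      proof (cases "Suc i = p")
        case True
        then have "\<sigma> y = (\<sigma> ^^ 0) x" using i xp by auto
        then show ?thesis using p0 by blast
      next
        case False
        then have "\<sigma> y = (\<sigma> ^^ Suc i) x" "Suc i < p" using i by auto
        then show ?thesis by blast
      qed
    qed
    then have O_iter: "(\<sigma> ^^ i) y \<in> ?O" if "y \<in> ?O" for i y
      using that by (induction i) auto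
    \<comment> \<open>The orbit of \<open>x\<close> is removed. The rest is stable since
      \<open>\<sigma> ^^ (p - 1)\<close> inverts \<open>\<sigma>\<close>: nothing outside can be
      sent into the orbit.\<close>
    let ?X = "X - ?O"
    have closed: "\<sigma> ` ?X \<subseteq> ?X"
    proof
      fix z assume "z \<in> \<sigma> ` ?X"
      then obtain y where y: "y \<in> X" "y \<notin> ?O" "z = \<sigma> y" by blast
      have "z \<notin> ?O"
      proof
        assume "z \<in> ?O"
        from O_iter[OF this] have "(\<sigma> ^^ (p - 1)) (\<sigma> y) \<in> ?O" unfolding y(3) .
        moreover have "(\<sigma> ^^ (p - 1)) (\<sigma> y) = (\<sigma> ^^ p) y"
          using p0 by (metis Suc_diff_1 comp_apply funpow_Suc_right)
        ultimately show False using y less.prems(4) by simp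
      qed
      then show "z \<in> ?X" using y less.prems(3) by blast
    qed
    have "x \<in> ?O" using p0 by force
    then have "?X \<subset> X" using x by blast
    then have smaller: "card ?X < card X" using less.prems(1) by (rule psubset_card_mono[rotated])
    have "finite ?X" using less.prems(1) by simp
    have period: "(\<sigma> ^^ p) y = y" if "y \<in> ?X" for y
      using less.prems(4) that by blast
    have "\<exists>Y\<subseteq>{x \<in> ?X. \<sigma> x \<noteq> x}. \<forall>v :: 'b \<Rightarrow> int. (\<forall>x\<in>?X. v (\<sigma> x) = v x) \<longrightarrow>
        (\<Sum>x\<in>?X. v x) = (\<Sum>x\<in>{x \<in> ?X. \<sigma> x = x}. v x) + int p * (\<Sum>x\<in>Y. v x)"
      by (rule less.hyps[OF smaller \<open>finite ?X\<close> less.prems(2) closed]) (rule period)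
    then obtain Y where Y: "Y \<subseteq> {x \<in> ?X. \<sigma> x \<noteq> x}"
      and Ysum: "\<forall>v :: 'b \<Rightarrow> int. (\<forall>x\<in>?X. v (\<sigma> x) = v x) \<longrightarrow>
        (\<Sum>x\<in>?X. v x) = (\<Sum>x\<in>{x \<in> ?X. \<sigma> x = x}. v x) + int p * (\<Sum>x\<in>Y. v x)"
      by (elim exE conjE)
    have finY: "finite Y" using Y less.prems(1) finite_subset by fastforce
    have xY: "x \<notin> Y" using Y p0 by force
    have fix_eq: "{y \<in> ?X. \<sigma> y = y} = {y \<in> X. \<sigma> y = y}"
    proof -
      have "\<sigma> y \<noteq> y" if yO: "y \<in> ?O" for y
      proof
        assume fx: "\<sigma> y = y"
        obtain i where i: "i < p" "y = (\<sigma> ^^ i) x" using yO by auto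
        have "(\<sigma> ^^ (p - i)) y = x"
          using i xp by (simp add: funpow_add[unfolded o_def, THEN fun_cong, symmetric])
        moreover have "(\<sigma> ^^ k) y = y" for k by (induction k) (simp_all add: fx)
        ultimately show False using fx x by metis
      qed
      then show ?thesis by blast
    qed
    show ?thesis
    proof (intro exI[of _ "insert x Y"] conjI allI impI)
      show "insert x Y \<subseteq> {x \<in> X. \<sigma> x \<noteq> x}" using Y x by blast
      fix v :: "'b \<Rightarrow> int" assume v: "\<forall>x\<in>X. v (\<sigma> x) = v x"
      have vi: "v ((\<sigma> ^^ i) x) = v x" for i
        by (induction i) (use v iter x in auto)
      have "(\<Sum>y\<in>?O. v y) = (\<Sum>y\<in>?O. v x)"
        by (rule sum.cong[OF refl]) (use vi in auto)
      then have "(\<Sum>y\<in>?O. v y) = int p * v x" using card_O by simp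
      moreover have "(\<Sum>y\<in>X. v y) = (\<Sum>y\<in>?X. v y) + (\<Sum>y\<in>?O. v y)"
        by (rule sum.subset_diff[OF OX less.prems(1)])
      moreover have "(\<Sum>y\<in>?X. v y) = (\<Sum>y\<in>{x \<in> ?X. \<sigma> x = x}. v y) + int p * (\<Sum>y\<in>Y. v y)"
        using Ysum v by auto
      ultimately show "(\<Sum>x\<in>X. v x) = (\<Sum>x\<in>{x \<in> X. \<sigma> x = x}. v x) + int p * (\<Sum>x\<in>insert x Y. v x)"
        using finY xY fix_eq by (simp add: algebra_simps)
    qed
  qed
qed

section \<open>Subgroups, tables of marks and products of subgroups\<close>

context fin_group
begin

definition subs :: "'a set \<Rightarrow> 'a set set" where
  "subs L = {D. sub D \<and> D \<subseteq> L}"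

lemma finite_subs_of [simp]: "finite (subs L)"
  by (rule finite_subset[OF _ finite_subs]) (auto simp: subs_def)

lemma subsD: "D \<in> subs L \<Longrightarrow> sub D" "D \<in> subs L \<Longrightarrow> D \<subseteq> L"
  by (auto simp: subs_def)

lemma subs_cj:
  assumes "sub L" "x \<in> L" "D \<in> subs L"
  shows "cj x D \<in> subs L"
proof -
  have "x \<in> carrier G" using assms sub_mem by auto
  then show ?thesis
    using assms cj_sub[of x D] cj_mono[of x L D] cj_self[OF assms(1,2)] subD by (auto simp: subs_def)
qed

text \<open>The value at \<open>D\<close> of the mark of the \<open>L\<close>-set \<open>L / B\<close>.\<close>

definition mark :: "'a set \<Rightarrow> 'a set \<Rightarrow> 'a set \<Rightarrow> int" where
  "mark L B D = int (card {X \<in> (\<lambda>x. x <# B) ` L. \<forall>d\<in>D. d <# X = X})"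

lemma l_coset_eq_iff:
  assumes "sub B" "x \<in> carrier G" "y \<in> carrier G"
  shows "y <# B = x <# B \<longleftrightarrow> y \<in> x <# B"
proof
  note Bc = subD[OF assms(1)]
  assume "y <# B = x <# B"
  then show "y \<in> x <# B"
    using mem_l_coset[OF assms(3) Bc assms(3)] assms subgroup.one_closed[OF assms(1)] by simp
next
  note Bc = subD[OF assms(1)]
  assume y: "y \<in> x <# B"
  then have h: "inv x \<otimes> y \<in> B" using mem_l_coset assms Bc by simp
  have "z \<in> y <# B \<longleftrightarrow> z \<in> x <# B" if z: "z \<in> carrier G" for z
  proof -
    have "inv x \<otimes> z = (inv x \<otimes> y) \<otimes> (inv y \<otimes> z)" using assms z by (simp add: m_assoc)
    then show ?thesis using sub_mult_mem(1)[OF assms(1) h, of "inv y \<otimes> z"] mem_l_coset assms Bc z by simp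
  qed
  then show "y <# B = x <# B" using l_coset_closed[OF _ Bc] assms by blast
qed

lemma coset_fixed_iff:
  assumes "sub B" "x \<in> carrier G" "D \<subseteq> carrier G"
  shows "(\<forall>d\<in>D. d <# (x <# B) = x <# B) \<longleftrightarrow> D \<subseteq> cj x B"
proof -
  note Bc = subD[OF assms(1)]
  have "d <# (x <# B) = x <# B \<longleftrightarrow> d \<in> cj x B" if "d \<in> D" for d
  proof -
    have d: "d \<in> carrier G" using that assms by auto
    show ?thesis using assms d Bc l_coset_eq_iff[of B x "d \<otimes> x"]
      by (simp add: lcos_m_assoc mem_l_coset mem_cj m_assoc)
  qed
  then show ?thesis by blast
qed

lemma card_l_coset: "\<lbrakk>x \<in> carrier G; B \<subseteq> carrier G\<rbrakk> \<Longrightarrow> card (x <# B) = card B"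
proof -
  assume a: "x \<in> carrier G" "B \<subseteq> carrier G"
  then have "inj_on (\<lambda>y. x \<otimes> y) B" by (auto simp: inj_on_def subset_iff)
  then have "card ((\<lambda>y. x \<otimes> y) ` B) = card B" by (rule card_image)
  moreover have "x <# B = (\<lambda>y. x \<otimes> y) ` B" by (auto simp: l_coset_def)
  ultimately show ?thesis by simp
qed

text \<open>A fixed coset is counted once for each of its |B| representatives. As a sum over a
  group, a mark becomes accessible to translations.\<close>

lemma mark_count:
  assumes L: "sub L" and B: "B \<in> subs L" and D: "D \<subseteq> carrier G"
  shows "int (card B) * mark L B D = (\<Sum>x\<in>L. of_bool (D \<subseteq> cj x B))"
proof -
  note Bs = subsD[OF B] and Lc = sub_mem[OF L]
  note Bc = subD[OF Bs(1)]
  have finL: "finite L" using L by (rule sub_finite)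
  have "(\<Sum>x\<in>L. of_bool (D \<subseteq> cj x B)) = (\<Sum>X\<in>(\<lambda>x. x <# B) ` L. \<Sum>x\<in>{x \<in> L. x <# B = X}. of_bool (D \<subseteq> cj x B) :: int)"
    by (rule sum.image_gen[OF finL])
  also have "\<dots> = (\<Sum>X\<in>(\<lambda>x. x <# B) ` L. int (card B) * of_bool (\<forall>d\<in>D. d <# X = X))"
  proof (rule sum.cong[OF refl])
    fix X assume "X \<in> (\<lambda>x. x <# B) ` L"
    then obtain x0 where x0: "x0 \<in> L" "X = x0 <# B" by blast
    have "X \<subseteq> L" using x0 Bs subgroup.m_closed[OF L] by (auto simp: l_coset_def)
    then have "{x \<in> L. x <# B = X} = X"
      using x0 l_coset_eq_iff[OF Bs(1)] Lc by auto
    moreover have "of_bool (D \<subseteq> cj x B) = (of_bool (\<forall>d\<in>D. d <# X = X) :: int)"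
      if "x \<in> {x \<in> L. x <# B = X}" for x
      using coset_fixed_iff[OF Bs(1) _ D, of x] that Lc by auto
    ultimately show "(\<Sum>x\<in>{x \<in> L. x <# B = X}. of_bool (D \<subseteq> cj x B))
        = int (card B) * of_bool (\<forall>d\<in>D. d <# X = X)"
      using x0 Lc Bc card_l_coset[of x0 B] by simp
  qed
  also have "\<dots> = int (card B) * mark L B D"
  proof -
    have "finite ((\<lambda>x. x <# B) ` L)" using finL by simp
    then show ?thesis
      by (simp add: mark_def sum_distrib_left[symmetric] Int_def)
  qed
  finally show ?thesis by simp
qed

text \<open>Read off from the mark at the trivial subgroup, which fixes every coset.\<close>

lemma lagrange_subs:
  assumes "sub L" "B \<in> subs L"
  shows "card B dvd card L"
proof -
  have "{\<one>} \<subseteq> cj x B" if "x \<in> L" for x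
    using subgroup.one_closed[OF cj_sub[OF sub_mem[OF assms(1) that] subsD(1)[OF assms(2)]]] by simp
  then have "int (card B) * mark L B {\<one>} = int (card L)"
    using mark_count[OF assms, of "{\<one>}"] by simp
  then have "int (card B) dvd int (card L)" by (metis dvd_triv_left)
  then show ?thesis by simp
qed

lemma sub_carrier: "sub (carrier G)"
  by (rule subgroup_self)

lemma card_sub_dvd_order: "sub L \<Longrightarrow> card L dvd order G"
  using lagrange_subs[OF sub_carrier, of L] subD by (simp add: subs_def order_def)

lemma mark_cj_right:
  assumes "sub L" "B \<in> subs L" "D \<subseteq> carrier G" "y \<in> L"
  shows "mark L B (cj y D) = mark L B D"
proof -
  have y: "y \<in> carrier G" "inv y \<in> L" using assms sub_mem subgroup.m_inv_closed by auto
  have Bc: "B \<subseteq> carrier G" using subsD[OF assms(2)] subD by blast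
  have "(\<Sum>x\<in>L. of_bool (cj y D \<subseteq> cj x B) :: int) = (\<Sum>x\<in>L. of_bool (D \<subseteq> cj (inv y \<otimes> x) B))"
  proof (rule sum.cong[OF refl])
    fix x assume "x \<in> L"
    then have x: "x \<in> carrier G" using assms sub_mem by auto
    have "cj y D \<subseteq> cj x B \<longleftrightarrow> cj y D \<subseteq> cj y (cj (inv y \<otimes> x) B)"
      using x y Bc by (simp add: cj_cj)
    also have "\<dots> \<longleftrightarrow> D \<subseteq> cj (inv y \<otimes> x) B"
      using x y Bc assms by (intro cj_mono_iff cj_closed) auto
    finally show "of_bool (cj y D \<subseteq> cj x B) = (of_bool (D \<subseteq> cj (inv y \<otimes> x) B) :: int)" by simp
  qed
  also have "\<dots> = (\<Sum>x\<in>L. of_bool (D \<subseteq> cj x B))"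
    by (rule sum_translate_left[OF assms(1) y(2)])
  finally have "int (card B) * mark L B (cj y D) = int (card B) * mark L B D"
    using mark_count[OF assms(1,2)] cj_closed[of y D] y assms by simp
  then show ?thesis using subsD[OF assms(2)] by simp
qed

lemma mark_cj_left:
  assumes "sub L" "B \<in> subs L" "D \<subseteq> carrier G" "y \<in> L"
  shows "mark L (cj y B) D = mark L B D"
proof -
  have y: "y \<in> carrier G" using assms sub_mem by auto
  have Bc: "B \<subseteq> carrier G" using subsD[OF assms(2)] subD by blast
  have "(\<Sum>x\<in>L. of_bool (D \<subseteq> cj x (cj y B)) :: int) = (\<Sum>x\<in>L. of_bool (D \<subseteq> cj (x \<otimes> y) B))"
    by (rule sum.cong[OF refl]) (use sub_mem[OF assms(1)] y Bc in \<open>simp add: cj_cj\<close>)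
  also have "\<dots> = (\<Sum>x\<in>L. of_bool (D \<subseteq> cj x B))"
    by (rule sum_translate_right[OF assms(1,4)])
  finally have "int (card B) * mark L (cj y B) D = int (card B) * mark L B D"
    using mark_count[OF assms(1) subs_cj[OF assms(1,4,2)] assms(3)] mark_count[OF assms(1-3)]
    using Bc y by simp
  then show ?thesis using subsD[OF assms(2)] by simp
qed

text \<open>This is the triangularity of the table of marks, up to conjugation in
  \<open>L\<close>.\<close>

lemma mark_nonzero:
  assumes "sub L" "B \<in> subs L" "D \<subseteq> carrier G" "mark L B D \<noteq> 0"
  shows "\<exists>x\<in>L. cj x D \<subseteq> B"
proof -
  have "(\<Sum>x\<in>L. of_bool (D \<subseteq> cj x B) :: int) \<noteq> 0"
    unfolding mark_count[OF assms(1-3), symmetric] using assms(4) subsD[OF assms(2)] by simp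
  then obtain x where "x \<in> L" "of_bool (D \<subseteq> cj x B) \<noteq> (0 :: int)"
    by (rule sum.not_neutral_contains_not_neutral)
  then have x: "x \<in> L" "D \<subseteq> cj x B" by auto
  have xc: "x \<in> carrier G" "inv x \<in> L" using x assms sub_mem subgroup.m_inv_closed by auto
  have Bc: "B \<subseteq> carrier G" using subsD[OF assms(2)] subD by blast
  have "cj (inv x) D \<subseteq> cj (inv x) (cj x B)"
    using x xc Bc by (intro cj_mono cj_closed) auto
  then show ?thesis using xc Bc by auto
qed

definition normalizer_in :: "'a set \<Rightarrow> 'a set \<Rightarrow> 'a set" where
  "normalizer_in L B = {x \<in> L. cj x B = B}"

lemma normalizer_in_sub:
  assumes "sub L" "B \<subseteq> carrier G"
  shows "sub (normalizer_in L B)"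
proof (rule subgroupI)
  note Lc = sub_mem[OF assms(1)]
  show "normalizer_in L B \<subseteq> carrier G" using Lc by (auto simp: normalizer_in_def)
  show "normalizer_in L B \<noteq> {}"
    using subgroup.one_closed[OF assms(1)] assms by (auto simp: normalizer_in_def intro!: exI[of _ \<one>])
  fix a b assume ab: "a \<in> normalizer_in L B" "b \<in> normalizer_in L B"
  then have [simp]: "a \<in> carrier G" "b \<in> carrier G" and fixed: "cj a B = B" "cj b B = B"
    using Lc by (auto simp: normalizer_in_def)
  have "cj (inv a) B = B" using fixed(1) cj_inv(1)[of a B] assms by simp
  then show "inv a \<in> normalizer_in L B"
    using ab subgroup.m_inv_closed[OF assms(1)] by (simp add: normalizer_in_def)
  have "cj (a \<otimes> b) B = B" using fixed assms by (simp add: cj_cj[symmetric])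
  then show "a \<otimes> b \<in> normalizer_in L B"
    using ab subgroup.m_closed[OF assms(1)] by (simp add: normalizer_in_def)
qed

text \<open>An inclusion of \<open>B\<close> in one of its conjugates is an equality by finiteness,
  so the diagonal of the table of marks consists of the indices of \<open>B\<close> in its
  normaliser.\<close>

lemma mark_self:
  assumes "sub L" "B \<in> subs L"
  shows "int (card B) * mark L B B = int (card (normalizer_in L B))"
proof -
  have Bc: "B \<subseteq> carrier G" using subsD[OF assms(2)] subD by blast
  have "B \<subseteq> cj x B \<longleftrightarrow> cj x B = B" if x: "x \<in> L" for x
  proof -
    have "x \<in> carrier G" using x assms sub_mem by auto
    moreover have "finite (cj x B)"
      using calculation cj_sub subsD[OF assms(2)] sub_finite by blast
    ultimately show ?thesis using Bc by (metis card_cj card_subset_eq order_refl)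
  qed
  then have "(\<Sum>x\<in>L. of_bool (B \<subseteq> cj x B) :: int) = (\<Sum>x\<in>L. of_bool (cj x B = B))"
    by (intro sum.cong) auto
  then show ?thesis
    using mark_count[OF assms Bc] sub_finite[OF assms(1)] by (simp add: normalizer_in_def Int_def)
qed

text \<open>\<open>K\<close> normalises \<open>D\<close>, so factors can be rearranged; the order
  formula is the count of the double coset of \<open>\<one>\<close>.\<close>

lemma set_mult_sub:
  assumes "sub D" "sub K" "\<And>k. k \<in> K \<Longrightarrow> cj k D = D"
  shows "sub (D <#> K)" "card (D \<inter> K) * card (D <#> K) = card D * card K"
    "D \<subseteq> D <#> K" "K \<subseteq> D <#> K"
proof -
  note [simp] = sub_mem[OF assms(1)] sub_mem[OF assms(2)]
  have normal: "k \<otimes> d \<otimes> inv k \<in> D" if "k \<in> K" "d \<in> D" for k d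
    using assms(3)[OF that(1)] that cj_image[of k D] subD[OF assms(1)] by auto
  show "sub (D <#> K)"
  proof (rule subgroupI)
    show "D <#> K \<subseteq> carrier G" by (auto simp: set_mult_def)
    show "D <#> K \<noteq> {}"
      using subgroup.one_closed[OF assms(1)] subgroup.one_closed[OF assms(2)] by (auto simp: set_mult_def)
    fix a b assume "a \<in> D <#> K" "b \<in> D <#> K"
    then obtain d k d' k' where ab: "d \<in> D" "k \<in> K" "a = d \<otimes> k" "d' \<in> D" "k' \<in> K" "b = d' \<otimes> k'"
      by (auto simp: set_mult_def)
    have "inv a = (inv k \<otimes> inv d \<otimes> inv (inv k)) \<otimes> inv k"
      using ab by (simp add: inv_mult_group m_assoc)
    moreover have "inv k \<otimes> inv d \<otimes> inv (inv k) \<in> D" "inv k \<in> K"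
      using ab normal[of "inv k" "inv d"] subgroup.m_inv_closed[OF assms(1)] subgroup.m_inv_closed[OF assms(2)]
      by auto
    ultimately show "inv a \<in> D <#> K" by (auto simp: set_mult_def)
    have "a \<otimes> b = (d \<otimes> (k \<otimes> d' \<otimes> inv k)) \<otimes> (k \<otimes> k')" using ab by (simp add: m_assoc)
    moreover have "d \<otimes> (k \<otimes> d' \<otimes> inv k) \<in> D" "k \<otimes> k' \<in> K"
      using ab normal[of k d'] subgroup.m_closed[OF assms(1)] subgroup.m_closed[OF assms(2)] by auto
    ultimately show "a \<otimes> b \<in> D <#> K" unfolding set_mult_def by blast
  qed
  have "dcoset D \<one> K = D <#> K"
    unfolding dcoset_eq[symmetric] using subD[OF assms(1)] by simp
  then have "int (card (D \<inter> K) * card (D <#> K)) = int (card D * card K)"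
    using sum_dcoset[OF assms(1,2), of \<one> "\<lambda>_. 1"] subD[OF assms(2)] by simp
  then show "card (D \<inter> K) * card (D <#> K) = card D * card K" by linarith
  show "D \<subseteq> D <#> K" "K \<subseteq> D <#> K"
    using subgroup.one_closed[OF assms(1)] subgroup.one_closed[OF assms(2)]
    by (force simp: set_mult_def)+
qed

lemma prime_order_cyclic:
  assumes "prime p" "sub P" "card P = p" "y \<in> P" "y \<noteq> \<one>"
  shows "P = range (\<lambda>i::nat. y [^] i)" "y [^] p = \<one>"
proof -
  have y: "y \<in> carrier G" using assms sub_mem by auto
  have g: "sub (generate G {y})" "generate G {y} \<subseteq> P"
    using generate_is_subgroup[of "{y}"] generate_subgroup_incl[of "{y}" P] assms y by auto
  then have "card (generate G {y}) dvd p"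
    using lagrange_subs[OF assms(2)] assms(3) by (simp add: subs_def)
  then have "ord y = 1 \<or> ord y = p"
    using generate_pow_card[OF y] assms(1) by (metis prime_nat_iff)
  moreover have "ord y \<noteq> 1" using ord_eq_1 y assms(5) by simp
  ultimately have o: "ord y = p" by simp
  then show "y [^] p = \<one>" using y pow_ord_eq_1 by metis
  have "generate G {y} = P"
    using g o generate_pow_card[OF y] assms sub_finite by (intro card_subset_eq) auto
  then show "P = range (\<lambda>i::nat. y [^] i)"
    using generate_pow_on_finite_carrier[OF finite_carrier y] by auto
qed

lemma subgroup_of_prime_power_order:
  assumes "prime p" "sub A" "p ^ a dvd card A"
  shows "\<exists>P\<in>subs A. card P = p ^ a"
proof -
  have g: "group (G\<lparr>carrier := A\<rparr>)" using assms(2) by (rule subgroup_imp_group)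
  obtain m where "card A = p ^ a * m" using assms(3) by blast
  then obtain P where P: "subgroup P (G\<lparr>carrier := A\<rparr>)" "card P = p ^ a"
    using sylow_thm[OF assms(1) g, of a m] sub_finite[OF assms(2)] by (auto simp: order_def)
  have "sub P" using incl_subgroup[OF assms(2) P(1)] .
  moreover have "P \<subseteq> A" using subgroup.subset[OF P(1)] by simp
  ultimately show ?thesis using P by (auto simp: subs_def)
qed

text \<open>The cyclic subgroup is given as a range of powers to match the iterates of a single map
  in \<open>prime_orbit_decomposition\<close>.\<close>

lemma cauchy:
  assumes "prime p" "sub A" "p dvd card A"
  obtains y where "y \<in> A" "y [^] p = \<one>" "sub (range (\<lambda>i::nat. y [^] i))"
    "card (range (\<lambda>i::nat. y [^] i)) = p" "range (\<lambda>i::nat. y [^] i) \<subseteq> A"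
proof -
  obtain P where P: "P \<in> subs A" "card P = p"
    using subgroup_of_prime_power_order[OF assms(1,2), of 1] assms(3) by auto
  have "card P > 1" using P assms(1) prime_gt_1_nat by auto
  then obtain y where y: "y \<in> P" "y \<noteq> \<one>"
    by (metis card_le_Suc0_iff_eq One_nat_def card.infinite le_numeral_extra(4) less_le_not_le not_less zero_less_one_class.zero_le_one)
  note c = prime_order_cyclic[OF assms(1) subsD(1)[OF P(1)] P(2) y]
  show thesis
    using that[of y] c P y subsD[OF P(1)] by auto
qed

lemma funpow_cj:
  assumes "y \<in> carrier G" "D \<subseteq> carrier G"
  shows "(cj y ^^ i) D = cj (y [^] i) D"
proof (induction i)
  case (Suc i)
  have "y \<otimes> y [^] i = y [^] Suc i" using assms by (simp add: nat_pow_mult[of y 1 i, simplified])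
  then show ?case using Suc assms by (simp add: cj_cj)
qed (use assms in simp)

lemma funpow_l_coset:
  assumes "y \<in> carrier G" "D \<subseteq> carrier G"
  shows "((\<lambda>X. y <# X) ^^ i) D = y [^] i <# D"
proof (induction i)
  case (Suc i)
  have "y \<otimes> y [^] i = y [^] Suc i" using assms by (simp add: nat_pow_mult[of y 1 i, simplified])
  then show ?case using Suc assms by (simp add: lcos_m_assoc)
qed (use assms in \<open>simp add: lcos_mult_one\<close>)

end

lemma (in fin_group) set_mult_subset: "\<lbrakk>sub D; J \<subseteq> D; K \<subseteq> D\<rbrakk> \<Longrightarrow> J <#> K \<subseteq> D"
  by (auto simp: set_mult_def subset_iff intro!: subgroup.m_closed)

section \<open>Normal p-complements and weights when p divides the group order exactly once\<close>

locale exact_p_group = fin_group +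
  fixes p n :: nat
  assumes p: "prime p" and order: "order G = p * n" and exact: "\<not> p dvd n"
begin

lemma p_pos: "p > 0" using p prime_gt_0_nat by blast

lemma card_sub_dvd: "sub D \<Longrightarrow> card D dvd p * n"
  using card_sub_dvd_order order by metis

lemma not_p_squared: "sub D \<Longrightarrow> \<not> p * p dvd card D"
proof
  assume "sub D" "p * p dvd card D"
  then have "p * p dvd p * n" using card_sub_dvd dvd_trans by blast
  then show False using exact p_pos by simp
qed

lemma p_free_dvd_n: "\<lbrakk>a dvd p * n; \<not> p dvd a\<rbrakk> \<Longrightarrow> a dvd n"
  using p by (metis coprime_commute coprime_dvd_mult_right_iff prime_imp_coprime)

text \<open>\<open>J\<close> is the normal \<open>p\<close>-complement of \<open>D\<close>, and \<open>p\<close> divides the order of \<open>D\<close>.\<close>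

definition complement :: "'a set \<Rightarrow> 'a set \<Rightarrow> bool" where
  "complement D J \<longleftrightarrow> sub D \<and> J \<in> subs D \<and> card D = p * card J \<and> (\<forall>x\<in>D. cj x J = J)"

lemma complementD:
  assumes "complement D J"
  shows "sub D" "sub J" "J \<subseteq> D" "card D = p * card J" "x \<in> D \<Longrightarrow> cj x J = J" "\<not> p dvd card J"
    "p dvd card D"
proof -
  show 1: "sub D" "sub J" "J \<subseteq> D" "card D = p * card J" "x \<in> D \<Longrightarrow> cj x J = J" "p dvd card D"
    using assms by (auto simp: complement_def subs_def)
  then show "\<not> p dvd card J" using not_p_squared[OF 1(1)] by simp
qed

text \<open>The index \<open>e\<close> of \<open>J\<close> in \<open>J <#> B\<close> divides
  \<open>p\<close> and also |B|, hence is 1. This makes complements unique.\<close>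

lemma subset_complement:
  assumes c: "complement D J" and B: "B \<in> subs D" "\<not> p dvd card B"
  shows "B \<subseteq> J"
proof -
  note d = complementD[OF c] and b = subsD[OF B(1)]
  note m = set_mult_sub[OF d(2) b(1) d(5)[OF subsetD[OF b(2)]], simplified]
  have "J <#> B \<subseteq> D" by (rule set_mult_subset[OF d(1,3) b(2)])
  then have 1: "card (J <#> B) dvd p * card J"
    using lagrange_subs[OF d(1), of "J <#> B"] m d by (simp add: subs_def)
  have "card J dvd card (J <#> B)"
    using lagrange_subs[OF m(1), of J] m d by (simp add: subs_def)
  then obtain e where e: "card (J <#> B) = card J * e" by blast
  then have "e dvd p" using 1 d by (simp add: mult.commute[of p])
  moreover have "card B = card (J \<inter> B) * e"
    using m(2) e d by (simp add: ac_simps)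
  ultimately have "e = 1" using p B by (metis dvd_triv_right prime_nat_iff)
  then have "J <#> B = J"
    using e m d sub_finite card_subset_eq by (metis mult.right_neutral)
  then show ?thesis using m by simp
qed

lemma complement_unique: "\<lbrakk>complement D J; complement D K\<rbrakk> \<Longrightarrow> J = K"
  using subset_complement complementD by (metis complement_def subset_antisym)

text \<open>Equivalently, \<open>D\<close> has a normal subgroup of index \<open>p\<close>. Among
  the subgroups of order divisible by \<open>p\<close>, the remaining ones are the p-perfect
  ones.\<close>

definition split :: "'a set \<Rightarrow> bool" where "split D \<longleftrightarrow> (\<exists>J. complement D J)"

definition ker :: "'a set \<Rightarrow> 'a set" where "ker D = (THE J. complement D J)"

lemma ker_eqI:
  assumes "complement D J"
  shows "ker D = J"
  unfolding ker_def
proof (rule the_equality)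
  fix K assume "complement D K"
  then show "K = J" using assms by (rule complement_unique)
qed (rule assms)

lemma ker: "split D \<Longrightarrow> complement D (ker D)"
  using ker_eqI split_def by metis

lemma complement_cj:
  assumes "complement D J" "y \<in> carrier G"
  shows "complement (cj y D) (cj y J)"
proof -
  note d = complementD[OF assms(1)]
  note Dc = subD[OF d(1)] and Jc = subD[OF d(2)]
  have "cj x (cj y J) = cj y J" if x: "x \<in> cj y D" for x
  proof -
    obtain z where z: "z \<in> D" "x = y \<otimes> z \<otimes> inv y" using x assms Dc by (auto simp: cj_image)
    then have "z \<in> carrier G" using Dc by auto
    then have "cj x (cj y J) = cj y (cj z J)" using z assms Jc by (simp add: cj_cj m_assoc)
    then show ?thesis using d(5)[OF z(1)] by simp
  qed
  then show ?thesis
    using d assms Dc Jc by (simp add: complement_def subs_def cj_sub cj_mono)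
qed

lemma split_cj: "\<lbrakk>y \<in> carrier G; D \<subseteq> carrier G\<rbrakk> \<Longrightarrow> split (cj y D) \<longleftrightarrow> split D"
  unfolding split_def using complement_cj cj_inv(1) inv_closed by metis

text \<open>The weights for which the linear form \<open>\<phi>\<close> on the Burnside ring given by
  \<open>\<bar>A\<bar> \<phi>(G / A) = n \<Sum>\<^bsub>D \<le> A\<^esub> weight D\<close> is integral and symmetrizing at \<open>p\<close>.\<close>

definition weight :: "'a set \<Rightarrow> int" where
  "weight D = (if \<not> p dvd card D then 1 else if split D then -1 else int p)"

lemma weight_cj: "\<lbrakk>y \<in> carrier G; D \<subseteq> carrier G\<rbrakk> \<Longrightarrow> weight (cj y D) = weight D"
  by (simp add: weight_def split_cj)

lemma cj_power_fixed:
  assumes "y \<in> carrier G" "B \<subseteq> carrier G" "cj y B = B" "x \<in> range (\<lambda>i::nat. y [^] i)"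
  shows "cj x B = B"
proof -
  obtain i :: nat where "x = y [^] i" using assms by blast
  moreover have "(cj y ^^ i) B = B" using assms(3) by (induction i) auto
  ultimately show ?thesis using funpow_cj assms by simp
qed

text \<open>\<open>B\<close> and \<open>P\<close> have coprime orders and therefore meet trivially.
  This attaches a split partner to a subgroup of order prime to \<open>p\<close> that is normalised
  by \<open>P\<close>.\<close>

lemma complement_product:
  assumes "sub B" "\<not> p dvd card B" "sub P" "card P = p" "\<And>x. x \<in> P \<Longrightarrow> cj x B = B"
  shows "complement (B <#> P) B"
proof -
  note m = set_mult_sub[OF assms(1,3,5)]
  have "sub (B \<inter> P)" using assms by (simp add: sub_Int)
  then have "card (B \<inter> P) dvd card B" "card (B \<inter> P) dvd p"
    using lagrange_subs[OF assms(1), of "B \<inter> P"] lagrange_subs[OF assms(3), of "B \<inter> P"] assms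
    by (auto simp: subs_def)
  then have "card (B \<inter> P) = 1" using p assms(2) by (metis prime_nat_iff)
  then have card: "card (B <#> P) = p * card B" using m assms by simp
  have "cj x B = B" if x: "x \<in> B <#> P" for x
  proof -
    obtain b y where "b \<in> B" "y \<in> P" "x = b \<otimes> y" using x unfolding set_mult_def by blast
    then show ?thesis
      using assms sub_mem[OF assms(1)] sub_mem[OF assms(3)] subD[OF assms(1)]
      by (simp add: cj_cj[symmetric] cj_self)
  qed
  then show ?thesis using m card assms by (simp add: complement_def subs_def)
qed

text \<open>Otherwise \<open>D <#> P\<close> would have order divisible by the square of
  \<open>p\<close>.\<close>

lemma normalized_p_sub_contains:
  assumes "sub D" "p dvd card D" "sub P" "card P = p" "\<And>x. x \<in> P \<Longrightarrow> cj x D = D"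
  shows "P \<subseteq> D"
proof (rule ccontr)
  assume n: "\<not> P \<subseteq> D"
  note m = set_mult_sub[OF assms(1,3,5)]
  have DP: "sub (D \<inter> P)" using assms by (simp add: sub_Int)
  then have "card (D \<inter> P) dvd p"
    using lagrange_subs[OF assms(3), of "D \<inter> P"] assms by (auto simp: subs_def)
  moreover have "card (D \<inter> P) \<noteq> p"
    using n assms sub_finite by (metis card_subset_eq inf.absorb_iff2 inf_le2)
  ultimately have "card (D \<inter> P) = 1" using p by (metis prime_nat_iff)
  then have "card (D <#> P) = card D * p" using m assms by simp
  then have "p * p dvd card (D <#> P)" using assms(2) by simp
  then show False using not_p_squared m by blast
qed

lemma complement_product_eq:
  assumes "complement D J" "sub P" "P \<subseteq> D" "card P = p"
  shows "J <#> P = D"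
proof -
  note d = complementD[OF assms(1)]
  have Pn: "\<And>x. x \<in> P \<Longrightarrow> cj x J = J" using d assms by blast
  have "complement (J <#> P) J" by (rule complement_product[OF d(2,6) assms(2,4) Pn])
  then have "card (J <#> P) = card D" using complementD d by metis
  moreover have "J <#> P \<subseteq> D" by (rule set_mult_subset[OF d(1,3) assms(3)])
  ultimately show ?thesis using card_subset_eq sub_finite[OF d(1)] by blast
qed

text \<open>An element \<open>y\<close> of order \<open>p\<close> in \<open>A\<close> permutes the
  subgroups of \<open>A\<close> by conjugation. The moved ones lie in orbits of length
  \<open>p\<close>, represented by \<open>Y\<close>. Among the stable ones, each \<open>B\<close> of
  order prime to \<open>p\<close> is matched with the split group \<open>B <#> ?P\<close>, and the
  weights 1 and -1 turn the pair into a difference; the others have weight \<open>p\<close>. So a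
  function with \<open>v (ker D)\<close> congruent to \<open>v D\<close> modulo \<open>p\<close> has
  a weighted sum divisible by \<open>p\<close>. As \<open>A\<close> itself is stable, it occurs in
  \<open>S\<close> or \<open>N\<close> but not in \<open>Y\<close>, which allows the identity to be
  solved for the term of \<open>A\<close>.\<close>

lemma weighted_sum_decomposition:
  assumes A: "sub A" "p dvd card A"
  shows "\<exists>Y S N. Y \<subseteq> subs A - {A} \<and> S \<subseteq> {D \<in> subs A. split D} \<and>
    N \<subseteq> {D \<in> subs A. p dvd card D \<and> \<not> split D} \<and> A \<in> S \<union> N \<and>
    (\<forall>v. (\<forall>D\<in>subs A. \<forall>a\<in>A. v (cj a D) = v D) \<longrightarrow>
      (\<Sum>D\<in>subs A. weight D * v D)
        = int p * (\<Sum>D\<in>Y. weight D * v D) + (\<Sum>D\<in>S. v (ker D) - v D) + int p * (\<Sum>D\<in>N. v D))"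
proof -
  obtain y where y: "y \<in> A" "y [^] p = \<one>" "sub (range (\<lambda>i::nat. y [^] i))"
    "card (range (\<lambda>i::nat. y [^] i)) = p" "range (\<lambda>i::nat. y [^] i) \<subseteq> A"
    using cauchy[OF p A] by blast
  let ?P = "range (\<lambda>i::nat. y [^] i)"
  have yc: "y \<in> carrier G" using y A sub_mem by auto
  have subc: "D \<subseteq> carrier G" if "D \<in> subs A" for D using that subsD subD by blast
  have yP: "y \<in> ?P" using yc by (intro range_eqI[of _ _ "1::nat"]) simp
  let ?fixed = "{D \<in> subs A. cj y D = D}"
  have fixP: "cj x D = D" if "D \<in> ?fixed" "x \<in> ?P" for x D
    using cj_power_fixed[OF yc subc] that by blast
  have "cj y ` subs A \<subseteq> subs A" using subs_cj[OF A(1) y(1)] by blast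
  moreover have "(cj y ^^ p) D = D" if "D \<in> subs A" for D
    using funpow_cj[OF yc subc[OF that], of p] y(2) subc[OF that] by simp
  ultimately obtain Y where Y: "Y \<subseteq> {D \<in> subs A. cj y D \<noteq> D}"
    and Ysum: "\<forall>v :: 'a set \<Rightarrow> int. (\<forall>D\<in>subs A. v (cj y D) = v D) \<longrightarrow>
    (\<Sum>D\<in>subs A. v D) = (\<Sum>D\<in>?fixed. v D) + int p * (\<Sum>D\<in>Y. v D)"
    using prime_orbit_decomposition[OF finite_subs_of p, of "cj y" A] by auto
  define S where "S = {D \<in> ?fixed. split D}"
  define N where "N = {D \<in> ?fixed. p dvd card D \<and> \<not> split D}"
  define Q where "Q = {D \<in> ?fixed. \<not> p dvd card D}"
  have fin: "finite S" "finite N" "finite Q" unfolding S_def N_def Q_def by auto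
  have dvd_split: "p dvd card D" if "split D" for D
    using complementD(7)[OF ker[OF that]] .
  \<comment> \<open>Since \<open>y\<close> lies in \<open>D\<close>, it normalises
    \<open>ker D\<close>; this is what keeps the matching inside the stable subgroups.\<close>
  have ySin: "y \<in> D" if "D \<in> S" for D
  proof -
    have "?P \<subseteq> D"
      by (rule normalized_p_sub_contains[OF _ _ y(3,4) fixP])
        (use that dvd_split subsD in \<open>auto simp: S_def\<close>)
    then show ?thesis using yP by blast
  qed
  have bij: "bij_betw ker S Q"
  proof (rule bij_betw_byWitness[of _ "\<lambda>B. B <#> ?P"])
    show "\<forall>D\<in>S. ker D <#> ?P = D"
    proof
      fix D assume D: "D \<in> S"
      have "?P \<subseteq> D"
        by (rule normalized_p_sub_contains[OF _ _ y(3,4) fixP])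
          (use D dvd_split subsD in \<open>auto simp: S_def\<close>)
      then show "ker D <#> ?P = D"
        using complement_product_eq[OF ker y(3)] D y(4) by (simp add: S_def)
    qed
    have prod: "complement (B <#> ?P) B" if "B \<in> Q" for B
      by (rule complement_product[OF _ _ y(3,4) fixP]) (use that subsD in \<open>auto simp: Q_def\<close>)
    show "\<forall>B\<in>Q. ker (B <#> ?P) = B" using prod ker_eqI by blast
    show "ker ` S \<subseteq> Q"
    proof
      fix B assume "B \<in> ker ` S"
      then obtain D where D: "D \<in> S" "B = ker D" by blast
      then have c: "complement D B" using ker by (simp add: S_def)
      note d = complementD[OF c]
      have "D \<subseteq> A" using D(1) by (simp add: S_def subs_def)
      then have "B \<in> subs A" using d(2,3) by (simp add: subs_def)
      then show "B \<in> Q" using d ySin[OF D(1)] by (simp add: Q_def)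
    qed
    show "(\<lambda>B. B <#> ?P) ` Q \<subseteq> S"
    proof
      fix D assume "D \<in> (\<lambda>B. B <#> ?P) ` Q"
      then obtain B where B: "B \<in> Q" "D = B <#> ?P" by blast
      note c = prod[OF B(1), folded B(2)]
      have BA: "B \<in> subs A" using B by (simp add: Q_def)
      have "D \<subseteq> A" unfolding B(2) by (rule set_mult_subset[OF A(1) subsD(2)[OF BA] y(5)])
      moreover have "sub D" using complementD[OF c] by blast
      moreover have "y \<in> D"
        using set_mult_sub(4)[OF subsD(1)[OF BA] y(3) fixP[of B]] yP B by (auto simp: Q_def)
      ultimately show "D \<in> S"
        using c by (auto simp: S_def split_def subs_def cj_self)
    qed
  qed
  show ?thesis
  proof (rule exI[of _ Y], rule exI[of _ S], rule exI[of _ N], intro conjI allI impI)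
    have AA: "cj y A = A" using cj_self[OF A(1) y(1)] .
    show "Y \<subseteq> subs A - {A}" using Y AA by blast
    show "S \<subseteq> {D \<in> subs A. split D}" "N \<subseteq> {D \<in> subs A. p dvd card D \<and> \<not> split D}"
      by (auto simp: S_def N_def)
    show "A \<in> S \<union> N" using A AA by (auto simp: S_def N_def subs_def)
    fix v :: "'a set \<Rightarrow> int" assume v: "\<forall>D\<in>subs A. \<forall>a\<in>A. v (cj a D) = v D"
    have "(\<Sum>D\<in>subs A. weight D * v D)
        = (\<Sum>D\<in>?fixed. weight D * v D) + int p * (\<Sum>D\<in>Y. weight D * v D)"
      using Ysum v y(1) weight_cj[OF yc subc] by simp
    moreover have "(\<Sum>D\<in>?fixed. weight D * v D) = (\<Sum>D\<in>Q. weight D * v D) + (\<Sum>D\<in>S. weight D * v D)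
        + (\<Sum>D\<in>N. weight D * v D)"
    proof -
      have "?fixed = (Q \<union> S) \<union> N" "(Q \<union> S) \<inter> N = {}" "Q \<inter> S = {}"
        using dvd_split by (auto simp: Q_def S_def N_def)
      then show ?thesis using fin by (simp add: sum.union_disjoint)
    qed
    moreover have "(\<Sum>D\<in>Q. weight D * v D) = (\<Sum>D\<in>S. v (ker D))"
    proof -
      have "(\<Sum>D\<in>Q. weight D * v D) = (\<Sum>D\<in>Q. v D)"
        by (rule sum.cong) (auto simp: Q_def weight_def)
      also have "\<dots> = (\<Sum>D\<in>S. v (ker D))" by (rule sum.reindex_bij_betw[OF bij, symmetric])
      finally show ?thesis .
    qed
    moreover have "(\<Sum>D\<in>S. weight D * v D) = (\<Sum>D\<in>S. - v D)"
      by (rule sum.cong) (use dvd_split in \<open>auto simp: S_def weight_def\<close>)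
    moreover have "(\<Sum>D\<in>N. weight D * v D) = (\<Sum>D\<in>N. int p * v D)"
      by (rule sum.cong) (auto simp: N_def weight_def)
    ultimately show "(\<Sum>D\<in>subs A. weight D * v D)
        = int p * (\<Sum>D\<in>Y. weight D * v D) + (\<Sum>D\<in>S. v (ker D) - v D) + int p * (\<Sum>D\<in>N. v D)"
      by (simp add: sum_subtractf sum_negf sum_distrib_left)
  qed
qed

text \<open>In terms of the form \<phi> described at \<open>weight\<close>, this is |A| \<phi>(G /
  A) / n.\<close>

definition ghost :: "'a set \<Rightarrow> int" where
  "ghost A = (\<Sum>D\<in>subs A. weight D)"

lemma ghost_cj:
  assumes "y \<in> carrier G" "sub A"
  shows "ghost (cj y A) = ghost A"
proof -
  have "(\<Sum>D\<in>subs (cj y A). weight D) = (\<Sum>D\<in>subs A. weight D)"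
  proof (rule sum.reindex_bij_witness[of _ "cj y" "cj (inv y)"])
    note Ac = subD[OF assms(2)]
    show "cj (inv y) (cj y D) = D" "cj y D \<in> subs (cj y A)" if "D \<in> subs A" for D
      using that subsD[OF that] subD[OF subsD(1)[OF that]] assms Ac by (auto simp: subs_def cj_sub cj_mono)
    show "cj y (cj (inv y) D) = D" "cj (inv y) D \<in> subs A" "weight (cj (inv y) D) = weight D"
      if D: "D \<in> subs (cj y A)" for D
    proof -
      note Dc = subD[OF subsD(1)[OF D]]
      show "cj y (cj (inv y) D) = D" "weight (cj (inv y) D) = weight D"
        using assms Dc by (simp_all add: weight_cj)
      have "cj (inv y) D \<subseteq> cj (inv y) (cj y A)"
        using assms Ac subsD(2)[OF D] by (intro cj_mono cj_closed) auto
      then show "cj (inv y) D \<in> subs A"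
        using assms Ac subsD(1)[OF D] by (simp add: subs_def cj_sub)
    qed
  qed
  then show ?thesis by (simp add: ghost_def)
qed

text \<open>Integrality of \<phi>. The part of |A| prime to \<open>p\<close> divides
  \<open>n\<close>. The factor \<open>p\<close> comes from \<open>weighted_sum_decomposition\<close>
  for a constant \<open>v\<close>, where all differences vanish.\<close>

lemma card_dvd_ghost:
  assumes "sub A"
  shows "int (card A) dvd int n * ghost A"
proof (cases "p dvd card A")
  case False
  then show ?thesis using p_free_dvd_n[OF card_sub_dvd[OF assms]] by (simp add: dvd_mult2)
next
  case True
  then obtain a where a: "card A = p * a" by blast
  then have "p * a dvd p * n" using card_sub_dvd[OF assms] by simp
  then have an: "a dvd n" using p_pos by simp
  obtain Y S N where "\<forall>v. (\<forall>D\<in>subs A. \<forall>a\<in>A. v (cj a D) = v D) \<longrightarrow>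
      (\<Sum>D\<in>subs A. weight D * v D)
        = int p * (\<Sum>D\<in>Y. weight D * v D) + (\<Sum>D\<in>S. v (ker D) - v D) + int p * (\<Sum>D\<in>N. v D)"
    using weighted_sum_decomposition[OF assms True] by blast
  from this[rule_format, of "\<lambda>_. 1"] have "int p dvd ghost A"
    by (simp add: ghost_def)
  then show ?thesis using an a by (simp add: mult.commute[of "int p"] mult_dvd_mono)
qed

end

text \<open>As \<open>y\<close> normalises \<open>J\<close>, it permutes the cosets fixed by
  \<open>J\<close>. Those fixed by \<open>y\<close> too are the ones fixed by the product group; the
  others lie in orbits of length \<open>p\<close>.\<close>

lemma (in fin_group) mark_congruence:
  assumes p: "prime p" and L: "sub L" and B: "B \<in> subs L" and J: "sub J"
    and yL: "y \<in> L" and y: "y [^] p = \<one>" and fixJ: "cj y J = J"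
  shows "int p dvd mark L B J - mark L B (J <#> range (\<lambda>i::nat. y [^] i))"
proof -
  define D where "D = J <#> range (\<lambda>i::nat. y [^] i)"
  have yc: "y \<in> carrier G" using yL L sub_mem by auto
  note Bc = subD[OF subsD(1)[OF B]] and Jc = subD[OF J]
  have "j \<otimes> y [^] i \<in> D" if "j \<in> J" for j and i :: nat
    using that unfolding D_def set_mult_def by blast
  from this[of _ 0] this[OF subgroup.one_closed[OF J], of 1]
  have JD: "J \<subseteq> D" and yD: "y \<in> D" using yc Jc r_one by (auto simp: subset_iff)
  let ?C = "(\<lambda>x. x <# B) ` L"
  let ?X = "{X \<in> ?C. \<forall>d\<in>J. d <# X = X}"
  have Cc: "X \<subseteq> carrier G" if "X \<in> ?C" for X
    using that l_coset_closed[OF _ Bc] sub_mem[OF L] by auto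
  have finC: "finite ?C" using L sub_finite by blast
  have "(\<lambda>X. y <# X) ` ?X \<subseteq> ?X"
  proof clarify
    fix x assume x: "x \<in> L" "\<forall>d\<in>J. d <# (x <# B) = x <# B"
    have xc: "x \<in> carrier G" using x L sub_mem by auto
    note X = l_coset_closed[OF xc Bc]
    have "y <# (x <# B) = (y \<otimes> x) <# B" using xc yc Bc by (simp add: lcos_m_assoc)
    then have "y <# (x <# B) \<in> ?C" using x yL subgroup.m_closed[OF L] by blast
    moreover have "e <# (y <# (x <# B)) = y <# (x <# B)" if e: "e \<in> J" for e
    proof -
      have ec: "e \<in> carrier G" using e Jc by auto
      have "inv y \<otimes> e \<otimes> y \<in> J"
        using mem_cj[OF yc Jc ec] fixJ e by simp
      then have "y <# ((inv y \<otimes> e \<otimes> y) <# (x <# B)) = y <# (x <# B)" using x by simp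
      moreover have "y <# ((inv y \<otimes> e \<otimes> y) <# (x <# B)) = e <# (y <# (x <# B))"
        using X yc ec by (simp add: lcos_m_assoc m_assoc)
      ultimately show ?thesis by simp
    qed
    ultimately show "y <# (x <# B) \<in> ?C \<and> (\<forall>d\<in>J. d <# (y <# (x <# B)) = y <# (x <# B))" by blast
  qed
  moreover have "((\<lambda>X. y <# X) ^^ p) X = X" if "X \<in> ?X" for X
    using funpow_l_coset[OF yc, of X p] Cc[of X] that y by (simp add: lcos_mult_one)
  ultimately obtain Y where
    "\<forall>v :: 'a set \<Rightarrow> int. (\<forall>X\<in>?X. v (y <# X) = v X) \<longrightarrow>
      (\<Sum>X\<in>?X. v X) = (\<Sum>X\<in>{X \<in> ?X. y <# X = X}. v X) + int p * (\<Sum>X\<in>Y. v X)"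
    using prime_orbit_decomposition[of ?X p "\<lambda>X. y <# X"] finC p by auto
  from this[rule_format, of "\<lambda>_. 1"]
  have "int (card ?X) = int (card {X \<in> ?X. y <# X = X}) + int p * int (card Y)" by simp
  moreover have "{X \<in> ?X. y <# X = X} = {X \<in> ?C. \<forall>d\<in>D. d <# X = X}"
  proof -
    have iff: "(\<forall>d\<in>J. d <# X = X) \<and> y <# X = X \<longleftrightarrow> (\<forall>d\<in>D. d <# X = X)" if X: "X \<in> ?C" for X
    proof
      assume fx: "(\<forall>d\<in>J. d <# X = X) \<and> y <# X = X"
      have yi: "y [^] i <# X = X" for i :: nat
      proof -
        have "((\<lambda>X. y <# X) ^^ i) X = X" using fx by (induction i) auto
        then show ?thesis using funpow_l_coset[OF yc Cc[OF X]] by simp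
      qed
      show "\<forall>d\<in>D. d <# X = X"
      proof
        fix e assume "e \<in> D"
        then obtain j and i :: nat where ji: "j \<in> J" "e = j \<otimes> y [^] i"
          unfolding D_def set_mult_def by auto
        then have "e <# X = j <# (y [^] i <# X)"
          using Jc yc Cc[OF X] by (simp add: lcos_m_assoc subset_iff)
        then show "e <# X = X" using yi fx ji by simp
      qed
    qed (use JD yD in blast)
    show ?thesis
    proof (rule Collect_cong)
      fix X
      show "(X \<in> ?X \<and> y <# X = X) \<longleftrightarrow> (X \<in> ?C \<and> (\<forall>d\<in>D. d <# X = X))"
        unfolding mem_Collect_eq conj_assoc by (rule conj_cong[OF refl iff])
    qed
  qed
  ultimately show ?thesis
    unfolding D_def[symmetric] by (simp add: mark_def)
qed


section \<open>Unimodularity up to powers of n\<close>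

context exact_p_group
begin

text \<open>The rows \<open>V A\<close> generate a lattice, and this is membership in it after
  inverting \<open>n\<close>. Staying in the integers with a denominator \<open>n ^ k\<close>
  permits cancelling \<open>p\<close>, which is not possible in the coefficient ring.\<close>

definition attained :: "'a set \<Rightarrow> ('a set \<Rightarrow> 'a set \<Rightarrow> int) \<Rightarrow> ('a set \<Rightarrow> int) \<Rightarrow> bool" where
  "attained L V w \<longleftrightarrow> (\<exists>k c. \<forall>B\<in>subs L. (\<Sum>A\<in>subs L. c A * V A B) = int n ^ k * w B)"

lemma attainedI:
  assumes "\<And>B. B \<in> subs L \<Longrightarrow> (\<Sum>A\<in>subs L. a A * V A B) = int n ^ k * w B"
  shows "attained L V w"
  unfolding attained_def using assms by (intro exI[of _ k] exI[of _ a]) blast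

lemma attained_add:
  assumes "attained L V w" "attained L V w'"
  shows "attained L V (\<lambda>B. w B + w' B)"
proof -
  obtain k a k' a' where
    eq: "\<And>B. B \<in> subs L \<Longrightarrow> (\<Sum>A\<in>subs L. a A * V A B) = int n ^ k * w B"
    "\<And>B. B \<in> subs L \<Longrightarrow> (\<Sum>A\<in>subs L. a' A * V A B) = int n ^ k' * w' B"
    using assms unfolding attained_def by blast
  have "(\<Sum>A\<in>subs L. (int n ^ k' * a A + int n ^ k * a' A) * V A B) = int n ^ (k + k') * (w B + w' B)"
    if "B \<in> subs L" for B
  proof -
    have "(\<Sum>A\<in>subs L. (int n ^ k' * a A + int n ^ k * a' A) * V A B)
      = int n ^ k' * (\<Sum>A\<in>subs L. a A * V A B) + int n ^ k * (\<Sum>A\<in>subs L. a' A * V A B)"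
      by (simp add: distrib_right sum.distrib sum_distrib_left mult.assoc)
    then show ?thesis using eq[OF that] by (simp add: power_add algebra_simps)
  qed
  then show ?thesis by (rule attainedI)
qed

lemma attained_scale:
  assumes "attained L V w"
  shows "attained L V (\<lambda>B. s * w B)"
proof -
  obtain k a where "\<And>B. B \<in> subs L \<Longrightarrow> (\<Sum>A\<in>subs L. a A * V A B) = int n ^ k * w B"
    using assms unfolding attained_def by metis
  then have "(\<Sum>A\<in>subs L. (s * a A) * V A B) = int n ^ k * (s * w B)" if "B \<in> subs L" for B
    using that by (simp add: mult.assoc sum_distrib_left[symmetric])
  then show ?thesis by (rule attainedI)
qed

lemma attained_cong:
  assumes "attained L V w" "\<And>B. B \<in> subs L \<Longrightarrow> w' B = w B"
  shows "attained L V w'"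
  using assms unfolding attained_def by auto

lemma attained_diff:
  "\<lbrakk>attained L V w; attained L V w'\<rbrakk> \<Longrightarrow> attained L V (\<lambda>B. w B - w' B)"
  using attained_add[of L V w "\<lambda>B. -1 * w' B"] attained_scale[of L V w' "-1"] by simp

lemma attained_zero: "attained L V (\<lambda>B. 0)"
  unfolding attained_def by (rule exI[of _ 0], rule exI[of _ "\<lambda>_. 0"]) simp

lemma attained_sum:
  assumes "\<And>i. i \<in> I \<Longrightarrow> attained L V (w i)"
  shows "attained L V (\<lambda>B. \<Sum>i\<in>I. w i B)"
  using assms
proof (induction I rule: infinite_finite_induct)
  case (insert i I)
  then show ?case using attained_add[of L V "w i" "\<lambda>B. \<Sum>i\<in>I. w i B"] by simp
qed (simp_all add: attained_zero)

text \<open>A divisor of a power of \<open>n\<close> becomes invertible together with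
  \<open>n\<close>.\<close>

lemma attained_cancel:
  assumes "attained L V (\<lambda>B. s * w B)" "s dvd int n ^ j"
  shows "attained L V w"
proof -
  obtain t' where t': "int n ^ j = s * t'" using assms(2) by blast
  obtain k a where "\<And>B. B \<in> subs L \<Longrightarrow> (\<Sum>A\<in>subs L. a A * V A B) = int n ^ k * (s * w B)"
    using assms unfolding attained_def by metis
  then have "(\<Sum>A\<in>subs L. (t' * a A) * V A B) = int n ^ (k + j) * w B" if "B \<in> subs L" for B
    using that t' by (simp add: mult.assoc sum_distrib_left[symmetric] power_add)
  then show ?thesis by (rule attainedI)
qed

lemma attained_row:
  assumes "A \<in> subs L"
  shows "attained L V (V A)"
proof -
  have "(\<Sum>A'\<in>subs L. of_bool (A' = A) * V A' B) = int n ^ 0 * V A B" for B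
  proof -
    have "(\<Sum>A'\<in>subs L. of_bool (A' = A) * V A' B) = (\<Sum>A'\<in>subs L. if A' = A then V A' B else 0)"
      by (rule sum.cong) auto
    then show ?thesis using assms by simp
  qed
  then show ?thesis by (rule attainedI)
qed

text \<open>For split \<open>D\<close> the division is exact by \<open>mark_congruence\<close>. The
  determinant of a table of marks can be divisible by \<open>p\<close>; replacing marks by such
  quotients removes that factor.\<close>

definition mark_quotient :: "'a set \<Rightarrow> 'a set \<Rightarrow> 'a set \<Rightarrow> int" where
  "mark_quotient L B D = (mark L B (ker D) - mark L B D) div int p"

lemma mark_quotient:
  assumes L: "sub L" and B: "B \<in> subs L" and D: "D \<in> subs L" "split D"
  shows "int p * mark_quotient L B D = mark L B (ker D) - mark L B D"
proof -
  note c = ker[OF D(2)]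
  note d = complementD[OF c]
  obtain y where y: "y \<in> D" "y [^] p = \<one>" "sub (range (\<lambda>i::nat. y [^] i))"
    "card (range (\<lambda>i::nat. y [^] i)) = p" "range (\<lambda>i::nat. y [^] i) \<subseteq> D"
    using cauchy[OF p d(1,7)] by blast
  have "y \<in> L" using y(1) subsD(2)[OF D(1)] by blast
  then have "int p dvd mark L B (ker D) - mark L B D"
    using mark_congruence[OF p L B d(2) _ y(2) d(5)[OF y(1)]] complement_product_eq[OF c y(3,5,4)] by simp
  then show ?thesis by (simp add: mark_quotient_def)
qed

text \<open>Induction on the order of \<open>A\<close>. The row of \<open>A\<close> expands into
  terms of smaller subgroups and one term of \<open>A\<close> itself, with coefficient
  \<open>n\<close>, which can be cancelled. If \<open>p\<close> does not divide |A|, all weights are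
  1 and this term is the mark. Otherwise the expansion comes from
  \<open>weighted_sum_decomposition\<close>, and the term of \<open>A\<close> is its mark or, for
  split \<open>A\<close>, its \<open>mark_quotient\<close>.\<close>

lemma attained_marks:
  assumes L: "sub L"
    and V: "\<And>A B. \<lbrakk>A \<in> subs L; B \<in> subs L\<rbrakk> \<Longrightarrow>
      int (card A) * V A B = int n * (\<Sum>D\<in>subs A. weight D * mark L B D)"
    and A: "A \<in> subs L"
  shows "(split A \<longrightarrow> attained L V (\<lambda>B. mark_quotient L B A)) \<and> attained L V (\<lambda>B. mark L B A)"
  using A
proof (induction "card A" arbitrary: A rule: less_induct)
  case less
  note A = less.prems
  note a = subsD[OF A]
  have sL: "D \<in> subs L" if "D \<in> subs A" for D
    using that a by (auto simp: subs_def)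
  have smaller: "card D < card A" if "D \<in> subs A" "D \<noteq> A" for D
    using that sub_finite[OF a(1)] psubset_card_mono[of A D] by (auto simp: subs_def)
  have IH: "split D \<Longrightarrow> attained L V (\<lambda>B. mark_quotient L B D)" "attained L V (\<lambda>B. mark L B D)"
    if "D \<in> subs A" "D \<noteq> A" for D
    using less.hyps[OF smaller[OF that] sL[OF that(1)]] by auto
  have AA: "A \<in> subs A" using a by (simp add: subs_def)
  have n1: "int n dvd int n ^ 1" by simp
  show ?case
  proof (cases "p dvd card A")
    case False
    have w1: "weight D = 1" if "D \<in> subs A" for D
      using False dvd_trans[OF _ lagrange_subs[OF a(1) that]] by (auto simp: weight_def)
    have eq: "int n * mark L B A = int (card A) * V A B - int n * (\<Sum>D\<in>subs A - {A}. mark L B D)"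
      if "B \<in> subs L" for B
      using V[OF A that] w1 AA by (simp add: sum.remove algebra_simps)
    have "attained L V (\<lambda>B. int (card A) * V A B - int n * (\<Sum>D\<in>subs A - {A}. mark L B D))"
      by (intro attained_diff attained_scale attained_sum attained_row A IH) auto
    then have "attained L V (\<lambda>B. int n * mark L B A)"
      by (rule attained_cong) (rule eq)
    then have "attained L V (\<lambda>B. mark L B A)" by (rule attained_cancel[OF _ n1])
    moreover have "\<not> split A" using False complementD(7)[OF ker] by blast
    ultimately show ?thesis by blast
  next
    case True
    then obtain m where m: "card A = p * m" by blast
    obtain Y S N where Y: "Y \<subseteq> subs A - {A}" and S: "S \<subseteq> {D \<in> subs A. split D}"
      and N: "N \<subseteq> {D \<in> subs A. p dvd card D \<and> \<not> split D}" and ASN: "A \<in> S \<union> N"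
      and dec: "\<forall>v. (\<forall>D\<in>subs A. \<forall>a\<in>A. v (cj a D) = v D) \<longrightarrow>
        (\<Sum>D\<in>subs A. weight D * v D)
          = int p * (\<Sum>D\<in>Y. weight D * v D) + (\<Sum>D\<in>S. v (ker D) - v D) + int p * (\<Sum>D\<in>N. v D)"
      using weighted_sum_decomposition[OF a(1) True] by (elim exE conjE)
    have finSN: "finite S" "finite N"
      using finite_subset[OF S] finite_subset[OF N] by simp_all
    \<comment> \<open>A factor \<open>p\<close> is cancelled on both sides: on the left it comes
      from |A|, on the right from the decomposition, where the differences are exact multiples of
      \<open>p\<close>.\<close>
    have key: "int m * V A B = int n * ((\<Sum>D\<in>Y. weight D * mark L B D)
        + (\<Sum>D\<in>S. mark_quotient L B D) + (\<Sum>D\<in>N. mark L B D))" if B: "B \<in> subs L" for B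
    proof -
      have inv: "\<forall>D\<in>subs A. \<forall>a\<in>A. mark L B (cj a D) = mark L B D"
      proof (intro ballI)
        fix D x assume "D \<in> subs A" "x \<in> A"
        then show "mark L B (cj x D) = mark L B D"
          using mark_cj_right[OF L B subD[OF subsD(1)]] a(2) by blast
      qed
      have "(\<Sum>D\<in>S. mark L B (ker D) - mark L B D) = (\<Sum>D\<in>S. int p * mark_quotient L B D)"
        by (rule sum.cong[OF refl]) (use S sL mark_quotient[OF L B] in auto)
      then have "(\<Sum>D\<in>subs A. weight D * mark L B D) = int p * ((\<Sum>D\<in>Y. weight D * mark L B D)
        + (\<Sum>D\<in>S. mark_quotient L B D) + (\<Sum>D\<in>N. mark L B D))"
        using dec[rule_format, of "mark L B"] inv by (simp add: algebra_simps sum_distrib_left[symmetric])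
      then have "int p * (int m * V A B) = int p * (int n * ((\<Sum>D\<in>Y. weight D * mark L B D)
        + (\<Sum>D\<in>S. mark_quotient L B D) + (\<Sum>D\<in>N. mark L B D)))"
        using V[OF A B] m by (simp add: algebra_simps)
      then show ?thesis using p_pos by (subst (asm) mult_cancel_left) simp
    qed
    have attY: "attained L V (\<lambda>B. \<Sum>D\<in>Y. weight D * mark L B D)"
      by (intro attained_sum attained_scale IH) (use Y in auto)
    have attS: "attained L V (\<lambda>B. \<Sum>D\<in>S - {A}. mark_quotient L B D)"
      by (intro attained_sum IH) (use S in auto)
    have attN: "attained L V (\<lambda>B. \<Sum>D\<in>N - {A}. mark L B D)"
      by (intro attained_sum IH) (use N in auto)
    have att: "attained L V (\<lambda>B. int m * V A B - int n * ((\<Sum>D\<in>Y. weight D * mark L B D)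
        + (\<Sum>D\<in>S - {A}. mark_quotient L B D) + (\<Sum>D\<in>N - {A}. mark L B D)))"
      by (intro attained_diff attained_scale attained_add attained_row A attY attS attN)
    show ?thesis
    proof (cases "split A")
      case True
      then have AS: "A \<in> S" "A \<notin> N" using ASN N by auto
      have "int n * mark_quotient L B A = int m * V A B - int n * ((\<Sum>D\<in>Y. weight D * mark L B D)
        + (\<Sum>D\<in>S - {A}. mark_quotient L B D) + (\<Sum>D\<in>N - {A}. mark L B D))" if "B \<in> subs L" for B
        using key[OF that] AS finSN by (simp add: sum.remove[of S A] algebra_simps)
      then have "attained L V (\<lambda>B. int n * mark_quotient L B A)"
        by (rule attained_cong[OF att])
      then have q: "attained L V (\<lambda>B. mark_quotient L B A)" by (rule attained_cancel[OF _ n1])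
      \<comment> \<open>The mark at \<open>A\<close> differs from the mark at the smaller group
        \<open>ker A\<close> by \<open>p\<close> times the quotient just attained.\<close>
      note k = complementD[OF ker[OF True]]
      have "ker A \<in> subs A" "ker A \<noteq> A"
        using k by (auto simp: subs_def)
      then have "attained L V (\<lambda>B. mark L B (ker A) - int p * mark_quotient L B A)"
        by (intro attained_diff attained_scale IH q)
      then have "attained L V (\<lambda>B. mark L B A)"
        by (rule attained_cong) (use mark_quotient[OF L _ A True] in simp)
      then show ?thesis using q by blast
    next
      case False
      then have AN: "A \<in> N" "A \<notin> S" using ASN S by auto
      have "int n * mark L B A = int m * V A B - int n * ((\<Sum>D\<in>Y. weight D * mark L B D)
        + (\<Sum>D\<in>S - {A}. mark_quotient L B D) + (\<Sum>D\<in>N - {A}. mark L B D))" if "B \<in> subs L" for B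
        using key[OF that] AN finSN by (simp add: sum.remove[of N A] algebra_simps)
      then have "attained L V (\<lambda>B. int n * mark L B A)"
        by (rule attained_cong[OF att])
      then have "attained L V (\<lambda>B. mark L B A)" by (rule attained_cancel[OF _ n1])
      then show ?thesis using False by blast
    qed
  qed
qed

text \<open>The diagonal mark is the index of \<open>B\<close> in its normaliser and divides
  \<open>p * n\<close>, so it is a good pivot unless \<open>p\<close> divides it. In that case the
  normaliser has an element of order \<open>p\<close>, which enlarges \<open>B\<close> to a split
  group \<open>D\<close> with \<open>ker D = B\<close>; the quotient at \<open>D\<close> then takes
  at \<open>B\<close> the diagonal mark divided by \<open>p\<close>, a divisor of
  \<open>n\<close>.\<close>

lemma pivot:
  assumes L: "sub L"
    and V: "\<And>A B. \<lbrakk>A \<in> subs L; B \<in> subs L\<rbrakk> \<Longrightarrow>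
      int (card A) * V A B = int n * (\<Sum>D\<in>subs A. weight D * mark L B D)"
    and B: "B \<in> subs L"
  shows "\<exists>Z. attained L V Z \<and> Z B dvd int n \<and>
    (\<forall>B'\<in>subs L. Z B' \<noteq> 0 \<longrightarrow> (\<exists>x\<in>L. cj x B \<subseteq> B')) \<and>
    (\<forall>B'\<in>subs L. \<forall>x\<in>L. Z (cj x B') = Z B')"
proof -
  note b = subsD[OF B]
  note Bc = subD[OF b(1)]
  define M where "M = normalizer_in L B"
  have M: "sub M" "M \<subseteq> L" unfolding M_def using normalizer_in_sub[OF L Bc] by (auto simp: normalizer_in_def)
  have q: "int (card B) * mark L B B = int (card M)" unfolding M_def by (rule mark_self[OF L B])
  have cM: "int (card M) dvd int p * int n" using card_sub_dvd[OF M(1)] by (metis of_nat_dvd_iff of_nat_mult)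
  show ?thesis
  proof (cases "int p dvd mark L B B")
    case False
    have "mark L B B dvd int p * int n" using q cM by (metis dvd_mult_left dvd_trans dvd_triv_right mult.commute)
    moreover have "coprime (mark L B B) (int p)"
      using False p by (metis coprime_commute prime_imp_coprime prime_nat_int_transfer)
    ultimately have "mark L B B dvd int n" by (simp add: coprime_dvd_mult_right_iff)
    then show ?thesis
      using attained_marks[OF L V B] mark_nonzero[OF L _ Bc] mark_cj_left[OF L _ Bc]
      by (intro exI[of _ "\<lambda>B'. mark L B' B"]) auto
  next
    case True
    then obtain e where e: "mark L B B = int p * e" by blast
    have "int p * (int (card B) * e) dvd int p * int n" using q cM e by (simp add: algebra_simps)
    then have "int (card B) * e dvd int n" using p_pos by simp
    then have en: "e dvd int n" using dvd_mult_right by blast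
    have "int p * (int (card B) * e) = int (card M)" using q e by (simp add: algebra_simps)
    then have "int p dvd int (card M)" by (metis dvd_triv_left)
    then have pM: "p dvd card M" by simp
    \<comment> \<open>The index uses up the only factor \<open>p\<close> that |M| can have.\<close>
    have pB: "\<not> p dvd card B"
    proof
      assume "p dvd card B"
      then have "int p * int p dvd int (card B) * (int p * e)" by (simp add: mult_dvd_mono)
      moreover have "int (card M) = int (card B) * (int p * e)" using q e by simp
      ultimately have "int (p * p) dvd int (card M)" by (simp only: of_nat_mult)
      then show False using not_p_squared[OF M(1)] of_nat_dvd_iff by blast
    qed
    obtain y where y: "y \<in> M" "sub (range (\<lambda>i::nat. y [^] i))"
      "card (range (\<lambda>i::nat. y [^] i)) = p" "range (\<lambda>i::nat. y [^] i) \<subseteq> M"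
      using cauchy[OF p M(1) pM] by blast
    let ?P = "range (\<lambda>i::nat. y [^] i)"
    define D where "D = B <#> ?P"
    have c: "complement D B"
      unfolding D_def
      by (rule complement_product[OF b(1) pB y(2,3)]) (use y(4) in \<open>auto simp: M_def normalizer_in_def\<close>)
    note d = complementD[OF c]
    have sp: "split D" and kD: "ker D = B" using c ker_eqI by (auto simp: split_def)
    have "D \<subseteq> L" unfolding D_def using set_mult_subset[OF L b(2)] y(4) M(2) by blast
    then have DL: "D \<in> subs L" using d by (simp add: subs_def)
    note Dc = subD[OF d(1)]
    \<comment> \<open>\<open>D\<close> is larger than \<open>B\<close>, so no conjugate of it fits
      into \<open>B\<close>; the quotient at \<open>B\<close> is therefore the whole diagonal mark
      over \<open>p\<close>.\<close>
    have "mark L B D = 0"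
    proof (rule ccontr)
      assume "mark L B D \<noteq> 0"
      then obtain x where "x \<in> L" "cj x D \<subseteq> B" using mark_nonzero[OF L B Dc] by blast
      then have "card (cj x D) \<le> card B" "x \<in> carrier G"
        using card_mono[OF sub_finite[OF b(1)]] L sub_mem by auto
      then have "p * card B \<le> card B" using Dc d by simp
      then show False using p b(1) by (metis One_nat_def add.right_neutral leD mult.commute nat_mult_less_cancel1
            prime_gt_1_nat sub_card_nz(2) nat_mult_1_right)
    qed
    then have Ze: "mark_quotient L B D = e"
      using mark_quotient[OF L B DL sp] kD e p_pos by simp
    have "\<exists>x\<in>L. cj x B \<subseteq> B'" if B': "B' \<in> subs L" and nz: "mark_quotient L B' D \<noteq> 0" for B'
    proof (cases "mark L B' B = 0")
      case True
      then have "mark L B' D \<noteq> 0" using mark_quotient[OF L B' DL sp] kD nz p_pos by auto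
      then obtain x where x: "x \<in> L" "cj x D \<subseteq> B'" using mark_nonzero[OF L B' Dc] by blast
      then have "cj x B \<subseteq> cj x D" using d Dc L sub_mem by (intro cj_mono) auto
      then show ?thesis using x by blast
    qed (use mark_nonzero[OF L B' Bc] in blast)
    moreover have "mark_quotient L (cj x B') D = mark_quotient L B' D" if "B' \<in> subs L" "x \<in> L" for B' x
      using mark_cj_left[OF L that(1) Bc that(2)] mark_cj_left[OF L that(1) Dc that(2)]
      by (simp add: mark_quotient_def kD)
    ultimately show ?thesis
      using attained_marks[OF L V DL] sp Ze en
      by (intro exI[of _ "\<lambda>B'. mark_quotient L B' D"]) auto
  qed
qed

text \<open>Gaussian elimination: a subgroup of minimal order in the support is cleared with its
  pivot, at the price of a factor \<open>n\<close>. Pivots live on the subgroups containing a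
  conjugate of \<open>B\<close>, so nothing new appears below.\<close>

lemma all_invariants_attained:
  assumes L: "sub L"
    and V: "\<And>A B. \<lbrakk>A \<in> subs L; B \<in> subs L\<rbrakk> \<Longrightarrow>
      int (card A) * V A B = int n * (\<Sum>D\<in>subs A. weight D * mark L B D)"
    and w: "\<And>B x. \<lbrakk>B \<in> subs L; x \<in> L\<rbrakk> \<Longrightarrow> w (cj x B) = w B"
  shows "attained L V w"
proof -
  \<comment> \<open>The upward closure of the support, up to conjugacy. The support itself may grow
    during elimination, but only inside this set, which loses \<open>B\<close>.\<close>
  define U where "U w = {B \<in> subs L. \<exists>B0\<in>subs L. w B0 \<noteq> 0 \<and> (\<exists>x\<in>L. cj x B0 \<subseteq> B)}"
    for w :: "'a set \<Rightarrow> int"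
  have finU: "finite (U w)" for w unfolding U_def by simp
  note Lc = sub_mem[OF L]
  have subc: "B \<subseteq> carrier G" if "B \<in> subs L" for B using that subsD subD by blast
  have fin: "finite B" if "B \<in> subs L" for B using that subsD sub_finite by blast
  show ?thesis using w
  proof (induction "card (U w)" arbitrary: w rule: less_induct)
    case less
    show ?case
    proof (cases "\<exists>B\<in>subs L. w B \<noteq> 0")
      case False
      then show ?thesis by (intro attained_cong[OF attained_zero]) simp
    next
      case True
      then obtain B where B: "B \<in> subs L" "w B \<noteq> 0"
        and minimal: "\<And>B'. \<lbrakk>B' \<in> subs L; w B' \<noteq> 0\<rbrakk> \<Longrightarrow> card B \<le> card B'"
        using ex_has_least_nat[of "\<lambda>B. B \<in> subs L \<and> w B \<noteq> 0" _ card] by metis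
      obtain Z where Z: "attained L V Z" "Z B dvd int n"
        "\<And>B'. \<lbrakk>B' \<in> subs L; Z B' \<noteq> 0\<rbrakk> \<Longrightarrow> \<exists>x\<in>L. cj x B \<subseteq> B'"
        "\<And>B' x. \<lbrakk>B' \<in> subs L; x \<in> L\<rbrakk> \<Longrightarrow> Z (cj x B') = Z B'"
        using pivot[OF L V B(1)] by metis
      obtain e where e: "int n = Z B * e" using Z(2) by blast
      \<comment> \<open>The coefficients are chosen so that the value at \<open>B\<close> cancels:
        \<open>n\<close> equals \<open>Z B * e\<close>.\<close>
      define w' where "w' B' = int n * w B' - (e * w B) * Z B'" for B'
      have inv': "w' (cj x B') = w' B'" if "B' \<in> subs L" "x \<in> L" for B' x
        using less.prems Z(4) that by (simp add: w'_def)
      have w'B: "w' B = 0" using e by (simp add: w'_def)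
      have big: "card B \<le> card B'" if B': "B' \<in> subs L" "w' B' \<noteq> 0" for B'
      proof (cases "w B' = 0")
        case True
        then have "Z B' \<noteq> 0" using B' by (auto simp: w'_def)
        then obtain x where "x \<in> L" "cj x B \<subseteq> B'" using Z(3) B' by blast
        then show ?thesis using card_mono[OF fin[OF B'(1)], of "cj x B"] Lc subc[OF B(1)] by simp
      qed (use minimal B' in blast)
      have "U w' \<subseteq> U w"
      proof
        fix B1 assume "B1 \<in> U w'"
        then obtain B0 x where B0: "B1 \<in> subs L" "B0 \<in> subs L" "w' B0 \<noteq> 0" "x \<in> L" "cj x B0 \<subseteq> B1"
          unfolding U_def by blast
        show "B1 \<in> U w"
        proof (cases "w B0 = 0")
          case True
          then have "Z B0 \<noteq> 0" using B0 by (auto simp: w'_def)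
          then obtain z where z: "z \<in> L" "cj z B \<subseteq> B0" using Z(3) B0 by blast
          have "cj (x \<otimes> z) B = cj x (cj z B)" using B0 z Lc subc[OF B(1)] by (simp add: cj_cj)
          also have "\<dots> \<subseteq> cj x B0" using B0 z Lc subc by (intro cj_mono) auto
          finally have "cj (x \<otimes> z) B \<subseteq> B1" using B0 by blast
          moreover have "x \<otimes> z \<in> L" using B0 z subgroup.m_closed[OF L] by blast
          ultimately show ?thesis unfolding U_def using B B0 by blast
        qed (use B0 in \<open>auto simp: U_def\<close>)
      qed
      moreover have "B \<in> U w"
        using B subgroup.one_closed[OF L] subc[OF B(1)] by (auto simp: U_def intro!: bexI[of _ B] bexI[of _ \<one>])
      moreover have "B \<notin> U w'"
      proof
        assume "B \<in> U w'"
        then obtain B0 x where B0: "B0 \<in> subs L" "w' B0 \<noteq> 0" "x \<in> L" "cj x B0 \<subseteq> B"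
          unfolding U_def by blast
        have "card (cj x B0) = card B0" using B0 Lc subc by simp
        then have "cj x B0 = B"
          using big[OF B0(1,2)] B0(4) card_seteq[OF fin[OF B(1)] B0(4)] by simp
        then show False using inv'[OF B0(1,3)] w'B B0(2) by simp
      qed
      ultimately have "card (U w') < card (U w)"
        by (intro psubset_card_mono finU) blast
      then have "attained L V w'" using less.hyps inv' by blast
      then have "attained L V (\<lambda>B'. w' B' + (e * w B) * Z B')"
        by (intro attained_add attained_scale Z)
      then have "attained L V (\<lambda>B'. int n * w B')"
        by (rule attained_cong) (simp add: w'_def)
      then show ?thesis by (rule attained_cancel[of _ _ _ _ 1]) simp
    qed
  qed
qed

end

section \<open>A basis of the Mackey algebra\<close>

context cring
begin

abbreviation embed :: "int \<Rightarrow> 'a" where "embed k \<equiv> [k] \<cdot> \<one>"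

lemma embed_simps [simp]:
  "embed k \<in> carrier R" "embed 0 = \<zero>" "embed 1 = \<one>"
  "embed (a + b) = embed a \<oplus> embed b" "embed (a * b) = embed a \<otimes> embed b"
  by (simp_all add: add.int_pow_mult add_pow_ldistr_int add_pow_rdistr_int add.int_pow_pow
      add_pow_int_ge flip: add.int_pow_pow)

lemma embed_sum: "embed (\<Sum>i\<in>S. f i) = (\<Oplus>i\<in>S. embed (f i))"
  by (induction S rule: infinite_finite_induct) simp_all

lemma embed_power: "embed (a ^ k) = embed a [^] k"
  by (induction k) (simp_all add: m_comm)

end

section \<open>Consistency: the defining relations hold in the action on forms\<close>

locale mackey_free = fin_group G + R?: cring R + FA: assoc_algebra R "free_algebra R (mackey_gens G)"
  for G :: "('g, 'n) monoid_scheme" (structure) and R :: "('r, 'm) ring_scheme"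
begin

abbreviation gens :: "'g mackey_gen set" where "gens \<equiv> mackey_gens G"
abbreviation words :: "'g mackey_gen list set" where "words \<equiv> lists (mackey_gens G)"
abbreviation FA :: "('r, 'g mackey_gen list \<Rightarrow> 'r) module" where "FA \<equiv> free_algebra R (mackey_gens G)"
abbreviation MA :: "('r, ('g mackey_gen list \<Rightarrow> 'r) set) module" where "MA \<equiv> mackey_algebra R G"

declare free_algebra_simps [simp del]

lemma word_FA: "w \<in> words \<Longrightarrow> word R w \<in> carrier FA"
  by (rule word_closed)

lemma word_append: "word R u \<otimes>\<^bsub>FA\<^esub> word R v = word R (u @ v)"
  by (rule word_mult_word)

text \<open>Both sides of every defining relation are sums of distinct words with coefficient 1, so
  a set of words describes each side.\<close>

definition word_sum :: "'g mackey_gen list set \<Rightarrow> 'g mackey_gen list \<Rightarrow> 'r" where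
  "word_sum S = (\<Oplus>\<^bsub>FA\<^esub>w\<in>S. word R w)"

lemma word_sum_closed: "S \<subseteq> words \<Longrightarrow> word_sum S \<in> carrier FA"
  unfolding word_sum_def by (intro FA.M.finsum_closed) (auto intro: word_FA)

lemma word_sum_singleton: "w \<in> words \<Longrightarrow> word_sum {w} = word R w"
  unfolding word_sum_def using word_FA[of w] by simp

text \<open>\<open>fold act w\<close> lets the first letter of \<open>w\<close> act first, so this
  is the form \<open>q\<close> evaluated at \<open>w\<close> times the unit; the unit is the sum of
  the spans belonging to the triples \<open>H H H\<close>.\<close>

definition eval_form :: "('g set \<Rightarrow> 'g set \<Rightarrow> 'g set \<Rightarrow> int) \<Rightarrow> 'g mackey_gen list \<Rightarrow> int" where
  "eval_form q w = (\<Sum>H\<in>{H. sub H}. fold act w q H H H)"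

lemma gensI [simp]:
  "\<lbrakk>sub H; sub K; H \<subseteq> K\<rbrakk> \<Longrightarrow> Tr K H \<in> gens"
  "\<lbrakk>sub H; sub K; H \<subseteq> K\<rbrakk> \<Longrightarrow> Res K H \<in> gens"
  "\<lbrakk>g \<in> carrier G; sub H\<rbrakk> \<Longrightarrow> Con g H \<in> gens"
  by (auto simp: mackey_gens_def)

lemma conj_sub_carrier [simp]: "\<lbrakk>g \<in> carrier G; sub H\<rbrakk> \<Longrightarrow> sub (cj g H)"
  by (rule cj_sub)

lemma double_coset_parts:
  assumes "sub K" "sub L" "x \<in> carrier G"
  shows "sub (L \<inter> cj x K)" "sub (cj (inv x) L \<inter> K)" "cj x (cj (inv x) L \<inter> K) = L \<inter> cj x K"
    "cj (inv x) L \<inter> K \<subseteq> K" "cj (inv x) L \<inter> K \<subseteq> carrier G"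
  using assms subD by (auto simp: sub_Int cj_Int cj_closed)

definition double_coset_word :: "'g set \<Rightarrow> 'g set \<Rightarrow> 'g \<Rightarrow> 'g mackey_gen list" where
  "double_coset_word L K x =
    [Tr L (L \<inter> cj x K), Con x (cj (inv x) L \<inter> K), Res K (cj (inv x) L \<inter> K)]"

lemma double_coset_word: "\<lbrakk>sub K; sub L; x \<in> carrier G\<rbrakk> \<Longrightarrow> double_coset_word L K x \<in> words"
  using double_coset_parts[of K L x] by (simp add: double_coset_word_def)

definition form_relation :: "'g mackey_gen list set \<Rightarrow> 'g mackey_gen list set \<Rightarrow> bool" where
  "form_relation S T \<longleftrightarrow> S \<subseteq> words \<and> T \<subseteq> words \<and>
    (\<forall>q. invariant q \<longrightarrow> veq (\<lambda>H A C. \<Sum>w\<in>S. fold act w q H A C) (\<lambda>H A C. \<Sum>w\<in>T. fold act w q H A C))"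

lemma form_relationI:
  assumes "S \<subseteq> words" "T \<subseteq> words"
    "\<And>q. invariant q \<Longrightarrow> veq (\<lambda>H A C. \<Sum>w\<in>S. fold act w q H A C) (\<lambda>H A C. \<Sum>w\<in>T. fold act w q H A C)"
  shows "form_relation S T"
  using assms by (simp add: form_relation_def)

lemma form_relation_words:
  assumes "u \<in> words" "v \<in> words" "\<And>q. invariant q \<Longrightarrow> veq (fold act u q) (fold act v q)"
  shows "form_relation {u} {v}"
  using assms by (intro form_relationI) auto

text \<open>The relations are verified one by one on all invariant forms. This check is what
  prevents the presented algebra from collapsing.\<close>

lemma mackey_rel_word_sums:
  assumes "mackey_rel R G u v"
  shows "\<exists>S T. u = word_sum S \<and> v = word_sum T \<and> form_relation S T"
  using assms
proof (cases rule: mackey_rel.cases)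
  case unit
  let ?S = "(\<lambda>H. [Tr H H]) ` {H. sub H}"
  have inj: "inj_on (\<lambda>H. [Tr H H]) {H. sub H}" by (simp add: inj_on_def)
  have "u = word_sum ?S"
    unfolding unit word_sum_def letter_eq_word
    by (rule FA.M.add.finprod_reindex[symmetric, OF _ inj]) (auto intro: word_FA)
  moreover have "v = word_sum {[]}"
    unfolding unit by (simp add: word_sum_singleton free_algebra_simps)
  moreover have "form_relation ?S {[]}"
  proof (rule form_relationI)
    fix q :: "'g set \<Rightarrow> 'g set \<Rightarrow> 'g set \<Rightarrow> int"
    have "(\<Sum>w\<in>?S. fold act w q H A C) = q H A C" if "sub H" for H A C
    proof -
      have "(\<Sum>w\<in>?S. fold act w q H A C) = (\<Sum>K\<in>{K. sub K}. if H = K then q H A C else 0)"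
        by (subst sum.reindex[OF inj]) (auto intro: sum.cong)
      then show ?thesis using that finite_subs by simp
    qed
    then show "veq (\<lambda>H A C. \<Sum>w\<in>?S. fold act w q H A C) (\<lambda>H A C. \<Sum>w\<in>{[]}. fold act w q H A C)"
      by (auto simp: veq_def dest: validD(1))
  qed auto
  ultimately show ?thesis by blast
next
  case (tr_res_refl H)
  then have "form_relation {[Tr H H]} {[Res H H]}"
    using act_tr_res_refl by (intro form_relation_words) auto
  then show ?thesis using tr_res_refl by (metis gensI order_refl letter_eq_word word_sum_singleton lists.simps)
next
  case (tr_con_refl H h)
  then have h: "h \<in> carrier G" using sub_mem by blast
  then have "form_relation {[Tr H H]} {[Con h H]}"
    using tr_con_refl act_tr_con_refl by (intro form_relation_words) auto
  then show ?thesis using tr_con_refl h by (metis gensI order_refl letter_eq_word word_sum_singleton lists.simps)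
next
  case (tr_tr H K L)
  then have HL: "H \<subseteq> L" by blast
  have "form_relation {[Tr L K, Tr K H]} {[Tr L H]}"
    using tr_tr HL by (intro form_relation_words) (auto simp: veq_def)
  moreover have "u = word_sum {[Tr L K, Tr K H]}" "v = word_sum {[Tr L H]}"
    using tr_tr HL by (simp_all add: word_sum_singleton letter_eq_word word_append)
  ultimately show ?thesis by blast
next
  case (res_res H K L)
  then have HL: "H \<subseteq> L" by blast
  have "form_relation {[Res K H, Res L K]} {[Res L H]}"
    using res_res HL act_res_res by (intro form_relation_words) auto
  moreover have "u = word_sum {[Res K H, Res L K]}" "v = word_sum {[Res L H]}"
    using res_res HL by (simp_all add: word_sum_singleton letter_eq_word word_append)
  ultimately show ?thesis by blast
next
  case (con_con H g g')
  have "form_relation {[Con g' (cj g H), Con g H]} {[Con (g' \<otimes> g) H]}"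
    using con_con act_con_con by (intro form_relation_words) auto
  moreover have "u = word_sum {[Con g' (cj g H), Con g H]}" "v = word_sum {[Con (g' \<otimes> g) H]}"
    using con_con by (simp_all add: word_sum_singleton letter_eq_word word_append)
  ultimately show ?thesis by blast
next
  case (tr_con H K g)
  have gHK: "cj g H \<subseteq> cj g K" using tr_con subD by (intro cj_mono) auto
  have "form_relation {[Tr (cj g K) (cj g H), Con g H]} {[Con g K, Tr K H]}"
    using tr_con gHK act_tr_con by (intro form_relation_words) (auto simp: veq_def)
  moreover have "u = word_sum {[Tr (cj g K) (cj g H), Con g H]}" "v = word_sum {[Con g K, Tr K H]}"
    using tr_con gHK by (simp_all add: word_sum_singleton letter_eq_word word_append)
  ultimately show ?thesis by blast
next
  case (res_con H K g)
  have gHK: "cj g H \<subseteq> cj g K" using res_con subD by (intro cj_mono) auto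
  have "form_relation {[Res (cj g K) (cj g H), Con g K]} {[Con g H, Res K H]}"
    using res_con gHK act_res_con by (intro form_relation_words) auto
  moreover have "u = word_sum {[Res (cj g K) (cj g H), Con g K]}" "v = word_sum {[Con g H, Res K H]}"
    using res_con gHK by (simp_all add: word_sum_singleton letter_eq_word word_append)
  ultimately show ?thesis by blast
next
  case (mackey H K L D)
  have Dc: "x \<in> carrier G" if "x \<in> D" for x
    using that mackey sub_mem by (auto simp: double_coset_reps_iff)
  have inj: "inj_on (double_coset_word L K) D" by (auto simp: inj_on_def double_coset_word_def)
  have dw: "double_coset_word L K x \<in> words" if "x \<in> D" for x
    using double_coset_word mackey Dc that by blast
  let ?T = "double_coset_word L K ` D"
  have "u = word_sum {[Res H L, Tr H K]}"
    using mackey by (simp add: word_sum_singleton letter_eq_word word_append)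
  moreover have "v = word_sum ?T"
  proof -
    have "v = (\<Oplus>\<^bsub>FA\<^esub>x\<in>D. word R (double_coset_word L K x))"
      unfolding mackey letter_eq_word word_append double_coset_word_def by simp
    also have "\<dots> = word_sum ?T"
      unfolding word_sum_def
      by (rule FA.M.add.finprod_reindex[symmetric, OF _ inj]) (use dw in \<open>auto intro: word_FA\<close>)
    finally show ?thesis .
  qed
  moreover have "form_relation {[Res H L, Tr H K]} ?T"
  proof (rule form_relationI)
    fix q assume q: "invariant q"
    have "(\<Sum>w\<in>?T. fold act w q H' A C) = (\<Sum>x\<in>D. act (Res K (cj (inv x) L \<inter> K))
        (act (Con x (cj (inv x) L \<inter> K)) (act (Tr L (L \<inter> cj x K)) q)) H' A C)" for H' A C
      by (subst sum.reindex[OF inj]) (simp add: double_coset_word_def)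
    then show "veq (\<lambda>H' A C. \<Sum>w\<in>{[Res H L, Tr H K]}. fold act w q H' A C)
        (\<lambda>H' A C. \<Sum>w\<in>?T. fold act w q H' A C)"
      using act_mackey[OF q, of H K L D] mackey by (simp del: act.simps)
  qed (use mackey dw in auto)
  ultimately show ?thesis by blast
next
  case (other x y)
  \<comment> \<open>Arrows that cannot be composed give zero because each clause of
    \<open>act\<close> vanishes unless the left leg of the triple is the source of the
    generator.\<close>
  have source: "act z q H A C = 0" if "H \<noteq> gen_source z" for z q H A C
    using that by (cases z) auto
  have target: "act z q H A C = 0" if "\<And>A C. q (gen_target G z) A C = 0" for z q H A C
    using that by (cases z) auto
  have "act y (act x q) H A C = 0" for q H A C
    by (rule target, rule source) (use other in auto)
  then have "form_relation {[x, y]} {}"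
    using other by (intro form_relationI) (auto simp: veq_def)
  moreover have "u = word_sum {[x, y]}" "v = word_sum {}"
    using other by (simp_all add: word_sum_singleton letter_eq_word word_append)
      (simp_all add: word_sum_def)
  ultimately show ?thesis by blast
qed

lemma mackey_rel_closed: "\<forall>u v. mackey_rel R G u v \<longrightarrow> u \<in> carrier FA \<and> v \<in> carrier FA"
  using mackey_rel_word_sums word_sum_closed unfolding form_relation_def by blast

abbreviation proj :: "('g mackey_gen list \<Rightarrow> 'r) \<Rightarrow> ('g mackey_gen list \<Rightarrow> 'r) set" where
  "proj \<equiv> presented_map (mackey_gens G) (mackey_rel R G)"

lemmas proj_facts = presented_map[of "mackey_rel R G" "mackey_gens G", OF mackey_rel_closed,
    folded mackey_algebra_def]

lemma assoc_algebra_MA: "assoc_algebra R MA"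
  by (rule proj_facts(1))

definition E :: "'g mackey_gen list \<Rightarrow> ('g mackey_gen list \<Rightarrow> 'r) set" where
  "E w = proj (word R w)"

lemma E_closed [simp]: "w \<in> words \<Longrightarrow> E w \<in> carrier MA"
  unfolding E_def proj_facts(2) by (intro imageI word_FA)

lemma E_append: "\<lbrakk>u \<in> words; v \<in> words\<rbrakk> \<Longrightarrow> E (u @ v) = E u \<otimes>\<^bsub>MA\<^esub> E v"
  unfolding E_def word_append[symmetric] by (intro proj_facts(6) word_FA)

lemma E_Nil: "E [] = \<one>\<^bsub>MA\<^esub>"
  unfolding E_def using proj_facts(3) by (simp add: free_algebra_simps)

lemma proj_sum:
  assumes "finite S" "f \<in> S \<rightarrow> carrier FA"
  shows "proj (\<Oplus>\<^bsub>FA\<^esub>i\<in>S. f i) = (\<Oplus>\<^bsub>MA\<^esub>i\<in>S. proj (f i))"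
proof -
  interpret MA: abelian_monoid MA
    using assoc_algebra_MA by (simp add: assoc_algebra_def module_def abelian_group_def)
  show ?thesis using assms
proof (induction S rule: finite_induct)
  case empty
  then show ?case using proj_facts(4) by simp
next
  case (insert i S)
  then have "f i \<in> carrier FA" "f \<in> S \<rightarrow> carrier FA" by auto
  moreover have "proj ` carrier FA = carrier MA" using proj_facts(2) by simp
  ultimately have "(\<lambda>i. proj (f i)) \<in> S \<rightarrow> carrier MA" "proj (f i) \<in> carrier MA" by auto
  then show ?case
    using insert \<open>f i \<in> carrier FA\<close> \<open>f \<in> S \<rightarrow> carrier FA\<close> by (simp add: proj_facts(5))
qed
qed

text \<open>The prefix \<open>w\<close> keeps the form invariant, so the relation applies after it.
  The suffix \<open>w'\<close> respects equality on valid triples, and the triples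
  \<open>H H H\<close> used for evaluation are valid.\<close>

lemma eval_form_relation:
  assumes "form_relation S T" "invariant q" "w \<in> words" "w' \<in> words"
  shows "(\<Sum>s\<in>S. eval_form q (w @ s @ w')) = (\<Sum>s\<in>T. eval_form q (w @ s @ w'))"
proof -
  have expand: "(\<Sum>s\<in>S. eval_form q (w @ s @ w'))
      = (\<Sum>H\<in>{H. sub H}. fold act w' (\<lambda>H A C. \<Sum>s\<in>S. fold act s (fold act w q) H A C) H H H)" for S
    unfolding eval_form_def acts_sum by (subst sum.swap) simp
  have "invariant (fold act w q)" using assms acts_invariant by blast
  then have "veq (fold act w' (\<lambda>H A C. \<Sum>s\<in>S. fold act s (fold act w q) H A C))
      (fold act w' (\<lambda>H A C. \<Sum>s\<in>T. fold act s (fold act w q) H A C))"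
    using assms by (intro acts_veq) (auto simp: form_relation_def)
  moreover have "valid H H H" if "sub H" for H
    using that subD[OF that] lcos_mult_one by (auto simp: valid_def coset_join3 sub_mem)
  ultimately show ?thesis
    unfolding expand by (intro sum.cong) (auto simp: veq_def)
qed

text \<open>Every invariant \<open>q\<close> descends to the presented algebra, because
  \<open>eval_form_relation\<close> is exactly the two-sided test demanded by
  \<open>presented_map\<close>. All linear forms used later, coordinates and trace, arise in this
  way.\<close>

lemma form_functional:
  assumes q: "invariant q"
  shows "\<exists>L\<in>module_hom R MA (regular_module R). \<forall>w\<in>words. L (E w) = embed (eval_form q w)"
proof -
  define l where "l w = embed (eval_form q w)" for w
  have lc: "l w \<in> carrier R" for w by (simp add: l_def)
  have h: "linear_ext l \<in> module_hom R FA (regular_module R)" using lc by (rule linear_ext_hom)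
  have expand: "linear_ext l (word R w \<otimes>\<^bsub>FA\<^esub> word_sum S \<otimes>\<^bsub>FA\<^esub> word R w')
      = embed (\<Sum>s\<in>S. eval_form q (w @ s @ w'))"
    if S: "S \<subseteq> words" and w: "w \<in> words" "w' \<in> words" for S w w'
  proof (cases "finite S")
    case True
    have "word R w \<otimes>\<^bsub>FA\<^esub> word_sum S \<otimes>\<^bsub>FA\<^esub> word R w' = (\<Oplus>\<^bsub>FA\<^esub>s\<in>S. word R w \<otimes>\<^bsub>FA\<^esub> word R s \<otimes>\<^bsub>FA\<^esub> word R w')"
    proof -
      have c: "word R \<in> S \<rightarrow> carrier FA" using S word_FA by blast
      then have "(\<lambda>s. word R w \<otimes>\<^bsub>FA\<^esub> word R s) \<in> S \<rightarrow> carrier FA"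
        using word_FA[OF w(1)] by auto
      then show ?thesis
        unfolding word_sum_def using True c word_FA w by (simp add: FA.finsum_rdistr FA.finsum_ldistr)
    qed
    also have "\<dots> = (\<Oplus>\<^bsub>FA\<^esub>s\<in>S. word R (w @ s @ w'))"
      unfolding word_append by simp
    finally have "linear_ext l (word R w \<otimes>\<^bsub>FA\<^esub> word_sum S \<otimes>\<^bsub>FA\<^esub> word R w')
      = (\<Oplus>\<^bsub>R\<^esub>s\<in>S. linear_ext l (word R (w @ s @ w')))"
      using FA.functional_finsum[OF h True] S w word_FA by (simp add: Pi_def subset_iff)
    then show ?thesis
      unfolding embed_sum using lc by (simp add: linear_ext_word l_def)
  next
    \<comment> \<open>Sums over infinite sets are zero by convention on both sides.\<close>
    case False
    then have "word_sum S = \<zero>\<^bsub>FA\<^esub>" unfolding word_sum_def by simp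
    then show ?thesis using False w word_FA FA.functional_simps(4)[OF h] by simp
  qed
  have "\<exists>L\<in>module_hom R MA (regular_module R). \<forall>f\<in>carrier FA. L (proj f) = linear_ext l f"
  proof (rule proj_facts(9)[of l])
    fix u v w w' assume "mackey_rel R G u v" and w: "w \<in> words" "w' \<in> words"
    then obtain S T where ST: "u = word_sum S" "v = word_sum T" "form_relation S T"
      using mackey_rel_word_sums by blast
    then show "linear_ext l (word R w \<otimes>\<^bsub>FA\<^esub> u \<otimes>\<^bsub>FA\<^esub> word R w')
        = linear_ext l (word R w \<otimes>\<^bsub>FA\<^esub> v \<otimes>\<^bsub>FA\<^esub> word R w')"
      using expand w eval_form_relation[OF ST(3) q w] by (simp add: form_relation_def)
  qed (rule lc)
  then obtain L where L: "L \<in> module_hom R MA (regular_module R)"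
    "\<forall>f\<in>carrier FA. L (proj f) = linear_ext l f" by blast
  have "L (E w) = embed (eval_form q w)" if "w \<in> words" for w
    using L(2) word_FA[OF that] linear_ext_word[of l w, OF lc] by (simp add: E_def l_def)
  then show ?thesis using L(1) by blast
qed

definition form :: "('g set \<Rightarrow> 'g set \<Rightarrow> 'g set \<Rightarrow> int) \<Rightarrow> ('g mackey_gen list \<Rightarrow> 'r) set \<Rightarrow> 'r" where
  "form q = (SOME L. L \<in> module_hom R MA (regular_module R) \<and> (\<forall>w\<in>words. L (E w) = embed (eval_form q w)))"

lemma form:
  assumes "invariant q"
  shows "form q \<in> module_hom R MA (regular_module R)" "w \<in> words \<Longrightarrow> form q (E w) = embed (eval_form q w)"
  using someI_ex[of "\<lambda>L. L \<in> module_hom R MA (regular_module R) \<and> (\<forall>w\<in>words. L (E w) = embed (eval_form q w))"]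
    form_functional[OF assms] unfolding form_def by blast+

lemma MA_induct [consumes 1, case_names zero add word]:
  assumes x: "x \<in> carrier MA"
    and zero: "P \<zero>\<^bsub>MA\<^esub>"
    and add: "\<And>x y. \<lbrakk>x \<in> carrier MA; y \<in> carrier MA; P x; P y\<rbrakk> \<Longrightarrow> P (x \<oplus>\<^bsub>MA\<^esub> y)"
    and word: "\<And>a w. \<lbrakk>a \<in> carrier R; w \<in> words\<rbrakk> \<Longrightarrow> P (a \<odot>\<^bsub>MA\<^esub> E w)"
  shows "P x"
proof -
  obtain f where f: "f \<in> carrier FA" "x = proj f" using x proj_facts(2) by auto
  have "P (proj f)" using f(1)
  proof (induction rule: free_algebra_induct)
    case zero
    then show ?case using assms(2) proj_facts(4) by simp
  next
    case (add f g)
    then show ?case using assms(3)[of "proj f" "proj g"] proj_facts(2) by (auto simp: proj_facts(5))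
  next
    case (word a w)
    then show ?case using assms(4)[of a w] word_FA by (simp add: proj_facts(7) E_def)
  qed
  then show ?thesis using f by simp
qed

lemma E_one: "(\<Oplus>\<^bsub>MA\<^esub>H\<in>{H. sub H}. E [Tr H H]) = \<one>\<^bsub>MA\<^esub>"
proof -
  have "proj (\<Oplus>\<^bsub>FA\<^esub>H\<in>{H. sub H}. word R [Tr H H]) = \<one>\<^bsub>MA\<^esub>"
    using proj_facts(8)[OF mackey_rel.unit] proj_facts(3) by (simp add: letter_eq_word)
  then show ?thesis
    using proj_sum[OF finite_subs, of "\<lambda>H. word R [Tr H H]"] by (simp add: E_def word_FA Pi_def)
qed

lemma E_relations:
  "sub H \<Longrightarrow> E [Tr H H] = E [Res H H]"
  "\<lbrakk>sub H; h \<in> H\<rbrakk> \<Longrightarrow> E [Tr H H] = E [Con h H]"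
  "\<lbrakk>sub H; sub K; sub L; H \<subseteq> K; K \<subseteq> L\<rbrakk> \<Longrightarrow> E [Tr L K, Tr K H] = E [Tr L H]"
  "\<lbrakk>sub H; sub K; sub L; H \<subseteq> K; K \<subseteq> L\<rbrakk> \<Longrightarrow> E [Res K H, Res L K] = E [Res L H]"
  "\<lbrakk>sub H; g \<in> carrier G; g' \<in> carrier G\<rbrakk> \<Longrightarrow> E [Con g' (cj g H), Con g H] = E [Con (g' \<otimes> g) H]"
  "\<lbrakk>sub H; sub K; H \<subseteq> K; g \<in> carrier G\<rbrakk> \<Longrightarrow> E [Tr (cj g K) (cj g H), Con g H] = E [Con g K, Tr K H]"
  "\<lbrakk>sub H; sub K; H \<subseteq> K; g \<in> carrier G\<rbrakk> \<Longrightarrow> E [Res (cj g K) (cj g H), Con g K] = E [Con g H, Res K H]"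
  "\<lbrakk>x \<in> gens; y \<in> gens; gen_source x \<noteq> gen_target G y\<rbrakk> \<Longrightarrow> E [x, y] = \<zero>\<^bsub>MA\<^esub>"
  using proj_facts(8)[OF mackey_rel.tr_res_refl] proj_facts(8)[OF mackey_rel.tr_con_refl]
    proj_facts(8)[OF mackey_rel.tr_tr] proj_facts(8)[OF mackey_rel.res_res]
    proj_facts(8)[OF mackey_rel.con_con] proj_facts(8)[OF mackey_rel.tr_con]
    proj_facts(8)[OF mackey_rel.res_con] proj_facts(8)[OF mackey_rel.other] proj_facts(4)
  by (simp_all add: E_def letter_eq_word word_append)

lemma E_mackey:
  assumes "sub H" "sub K" "sub L" "K \<subseteq> H" "L \<subseteq> H" "double_coset_reps G L H K D"
  shows "E [Res H L, Tr H K] = (\<Oplus>\<^bsub>MA\<^esub>x\<in>D. E (double_coset_word L K x))"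
proof -
  have DH: "D \<subseteq> H" using assms by (simp add: double_coset_reps_iff)
  then have fin: "finite D" using assms sub_finite finite_subset by blast
  have "word R (double_coset_word L K x) \<in> carrier FA" if "x \<in> D" for x
    using double_coset_word[OF assms(2,3)] that DH sub_mem[OF assms(1)] word_FA by blast
  then show ?thesis
    using proj_facts(8)[OF mackey_rel.mackey[OF assms]]
      proj_sum[OF fin, of "\<lambda>x. word R (double_coset_word L K x)"]
    by (simp add: E_def letter_eq_word word_append double_coset_word_def Pi_def)
qed

end

lemma (in module) span_closure:
  assumes "S \<subseteq> carrier M"
  shows "S \<subseteq> span S" "\<zero>\<^bsub>M\<^esub> \<in> span S" "\<lbrakk>x \<in> span S; y \<in> span S\<rbrakk> \<Longrightarrow> x \<oplus>\<^bsub>M\<^esub> y \<in> span S"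
    "\<lbrakk>a \<in> carrier R; x \<in> span S\<rbrakk> \<Longrightarrow> a \<odot>\<^bsub>M\<^esub> x \<in> span S" "span S \<subseteq> carrier M"
  using span_is_submodule[OF assms] in_own_span[OF assms] span_is_subset2[OF assms]
  by (simp_all add: LinearCombinations.submodule_def)

lemma (in module) span_finsum:
  assumes "S \<subseteq> carrier M" "finite I" "\<And>i. i \<in> I \<Longrightarrow> x i \<in> span S"
  shows "(\<Oplus>\<^bsub>M\<^esub>i\<in>I. x i) \<in> span S"
  using assms(2,3)
proof (induction I rule: finite_induct)
  case (insert i I)
  then have "x \<in> I \<rightarrow> carrier M" "x i \<in> carrier M" using span_closure(5)[OF assms(1)] by auto
  then show ?case using insert span_closure(3)[OF assms(1)] by simp
qed (simp add: span_closure(2)[OF assms(1)])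

lemmas (in fin_group) group_assoc = m_assoc

section \<open>Spans generate the Mackey algebra\<close>

locale mackey_context = fin_group G + R?: cring R + MA: assoc_algebra R "mackey_algebra R G"
  for G :: "('g, 'n) monoid_scheme" (structure) and R :: "('r, 'm) ring_scheme"
begin

lemma mackey_free: "mackey_free G R"
  by (intro mackey_free.intro fin_group_axioms R.cring_axioms R.free_algebra_assoc_algebra)

abbreviation gens :: "'g mackey_gen set" where "gens \<equiv> mackey_gens G"
abbreviation words :: "'g mackey_gen list set" where "words \<equiv> lists (mackey_gens G)"
abbreviation MA :: "('r, ('g mackey_gen list \<Rightarrow> 'r) set) module" where "MA \<equiv> mackey_algebra R G"
abbreviation E :: "'g mackey_gen list \<Rightarrow> ('g mackey_gen list \<Rightarrow> 'r) set" where "E \<equiv> mackey_free.E G R"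
abbreviation form :: "('g set \<Rightarrow> 'g set \<Rightarrow> 'g set \<Rightarrow> int) \<Rightarrow> ('g mackey_gen list \<Rightarrow> 'r) set \<Rightarrow> 'r"
  where "form \<equiv> mackey_free.form G R"
abbreviation eval_form :: "('g set \<Rightarrow> 'g set \<Rightarrow> 'g set \<Rightarrow> int) \<Rightarrow> 'g mackey_gen list \<Rightarrow> int"
  where "eval_form \<equiv> mackey_free.eval_form G"

lemmas E_closed [simp] = mackey_free.E_closed[OF mackey_free]
lemmas E_append = mackey_free.E_append[OF mackey_free]
lemmas E_Nil = mackey_free.E_Nil[OF mackey_free]
lemmas E_one = mackey_free.E_one[OF mackey_free]
lemmas E_relations = mackey_free.E_relations[OF mackey_free]
lemmas E_mackey = mackey_free.E_mackey[OF mackey_free, unfolded mackey_free.double_coset_word_def[OF mackey_free]]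
lemmas MA_induct = mackey_free.MA_induct[OF mackey_free, consumes 1, case_names zero add word]
lemmas form = mackey_free.form[OF mackey_free]
lemmas gensI [simp] = mackey_free.gensI[OF mackey_free]
lemmas eval_form_def = mackey_free.eval_form_def[OF mackey_free]

lemma conj_sub_carrier [simp]: "\<lbrakk>g \<in> carrier G; sub H\<rbrakk> \<Longrightarrow> sub (cj g H)"
  by (rule cj_sub)

lemma E_context:
  assumes "E u = E v" "u \<in> words" "v \<in> words" "w \<in> words" "w' \<in> words"
  shows "E (w @ u @ w') = E (w @ v @ w')"
proof -
  have 1: "E (u @ w') = E (v @ w')" by (simp only: E_append assms)
  have "u @ w' \<in> words" "v @ w' \<in> words" using assms by auto
  then show ?thesis using 1 assms by (simp only: E_append)
qed

definition parameters :: "'g set \<Rightarrow> 'g set \<Rightarrow> 'g \<Rightarrow> 'g set \<Rightarrow> bool" where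
  "parameters H A g K \<longleftrightarrow> sub H \<and> sub A \<and> sub K \<and> g \<in> carrier G \<and> A \<subseteq> H \<and> cj (inv g) A \<subseteq> K"

definition bword :: "'g set \<Rightarrow> 'g set \<Rightarrow> 'g \<Rightarrow> 'g set \<Rightarrow> 'g mackey_gen list" where
  "bword H A g K = [Tr H A, Con g (cj (inv g) A), Res K (cj (inv g) A)]"

definition b :: "'g set \<Rightarrow> 'g set \<Rightarrow> 'g \<Rightarrow> 'g set \<Rightarrow> ('g mackey_gen list \<Rightarrow> 'r) set" where
  "b H A g K = E (bword H A g K)"

lemma parametersD:
  assumes "parameters H A g K"
  shows "sub H" "sub A" "sub K" "g \<in> carrier G" "A \<subseteq> H" "cj (inv g) A \<subseteq> K"
    "sub (cj (inv g) A)" "A \<subseteq> carrier G" "H \<subseteq> carrier G" "K \<subseteq> carrier G" "cj (inv g) A \<subseteq> carrier G"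
  using assms subD by (auto simp: parameters_def)

lemma bword_words: "parameters H A g K \<Longrightarrow> bword H A g K \<in> words"
  using parametersD[of H A g K] by (simp add: bword_def)

lemma b_closed: "parameters H A g K \<Longrightarrow> b H A g K \<in> carrier MA"
  by (simp add: b_def bword_words)

lemma b_Tr:
  assumes "parameters H A g K" "sub H'" "H \<subseteq> H'"
  shows "E [Tr H' H] \<otimes>\<^bsub>MA\<^esub> b H A g K = b H' A g K"
proof -
  note d = parametersD[OF assms(1)]
  have AH: "A \<subseteq> H'" using d assms by blast
  have "E [Tr H' H] \<otimes>\<^bsub>MA\<^esub> b H A g K = E ([] @ [Tr H' H, Tr H A] @ [Con g (cj (inv g) A), Res K (cj (inv g) A)])"
    using d assms E_append[of "[Tr H' H]" "bword H A g K"] bword_words[OF assms(1)] by (simp add: b_def bword_def)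
  also have "\<dots> = E ([] @ [Tr H' A] @ [Con g (cj (inv g) A), Res K (cj (inv g) A)])"
    using d assms AH by (intro E_context E_relations) simp_all
  finally show ?thesis by (simp add: b_def bword_def)
qed

lemma parameters_Con:
  assumes "parameters H A g K" "x \<in> carrier G"
  shows "parameters (cj x H) (cj x A) (x \<otimes> g) K" "cj (inv (x \<otimes> g)) (cj x A) = cj (inv g) A"
proof -
  note d = parametersD[OF assms(1)]
  show "cj (inv (x \<otimes> g)) (cj x A) = cj (inv g) A"
    using d assms by (simp add: cj_cj inv_mult_group group_assoc)
  then show "parameters (cj x H) (cj x A) (x \<otimes> g) K"
    using d assms by (simp add: parameters_def cj_mono)
qed

lemma b_Con:
  assumes "parameters H A g K" "x \<in> carrier G"
  shows "E [Con x H] \<otimes>\<^bsub>MA\<^esub> b H A g K = b (cj x H) (cj x A) (x \<otimes> g) K"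
proof -
  note d = parametersD[OF assms(1)] and p = parameters_Con[OF assms]
  let ?B = "cj (inv g) A"
  have xAH: "cj x A \<subseteq> cj x H" using d assms by (simp add: cj_mono)
  have A: "cj g ?B = A" using d by simp
  have "E [Con x H] \<otimes>\<^bsub>MA\<^esub> b H A g K = E ([] @ [Con x H, Tr H A] @ [Con g ?B, Res K ?B])"
    using d assms E_append[of "[Con x H]" "bword H A g K"] bword_words[OF assms(1)] by (simp add: b_def bword_def)
  also have "\<dots> = E ([] @ [Tr (cj x H) (cj x A), Con x A] @ [Con g ?B, Res K ?B])"
    using d assms xAH by (intro E_context E_relations(6)[symmetric]) simp_all
  also have "\<dots> = E ([Tr (cj x H) (cj x A)] @ [Con x A, Con g ?B] @ [Res K ?B])" by simp
  also have "\<dots> = E ([Tr (cj x H) (cj x A)] @ [Con (x \<otimes> g) ?B] @ [Res K ?B])"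
    using d assms xAH E_relations(5)[of ?B g x] A by (intro E_context) simp_all
  finally show ?thesis by (simp add: b_def bword_def p)
qed

lemma parameters_Res:
  assumes "parameters H A g K" "sub L" "x \<in> carrier G"
  shows "parameters L (L \<inter> cj x A) (x \<otimes> g) K"
    "cj (inv (x \<otimes> g)) (L \<inter> cj x A) = cj (inv g) (cj (inv x) L \<inter> A)"
proof -
  note d = parametersD[OF assms(1)]
  have Lc: "L \<subseteq> carrier G" using assms subD by blast
  show eq: "cj (inv (x \<otimes> g)) (L \<inter> cj x A) = cj (inv g) (cj (inv x) L \<inter> A)"
    using d assms Lc by (simp add: cj_Int cj_closed cj_cj inv_mult_group group_assoc)
  have "cj (inv g) (cj (inv x) L \<inter> A) \<subseteq> cj (inv g) A"
    using d by (intro cj_mono) auto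
  then show "parameters L (L \<inter> cj x A) (x \<otimes> g) K"
    unfolding parameters_def eq using d assms sub_Int by auto
qed

text \<open>The Mackey formula produces an inner restriction, which is carried past
  \<open>Con g\<close> and then merged with the restriction at the end of the word.\<close>

lemma b_Res:
  assumes "parameters H A g K" "sub L" "L \<subseteq> H" "double_coset_reps G L H A D"
  shows "E [Res H L] \<otimes>\<^bsub>MA\<^esub> b H A g K = (\<Oplus>\<^bsub>MA\<^esub>x\<in>D. b L (L \<inter> cj x A) (x \<otimes> g) K)"
proof -
  note d = parametersD[OF assms(1)]
  have DH: "D \<subseteq> H" using assms by (simp add: double_coset_reps_iff)
  have fin: "finite D" using DH d(1) sub_finite finite_subset by blast
  have Dc: "x \<in> carrier G" if "x \<in> D" for x using that DH d by auto
  let ?B = "cj (inv g) A"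
  have A: "cj g ?B = A" using d by simp
  let ?dw = "\<lambda>x. [Tr L (L \<inter> cj x A), Con x (cj (inv x) L \<inter> A), Res A (cj (inv x) L \<inter> A)]"
  have tail: "[Con g ?B, Res K ?B] \<in> words" using d by simp
  have dw: "?dw x \<in> words" if "x \<in> D" for x
    using mackey_free.double_coset_word[OF mackey_free d(2) assms(2) Dc[OF that]]
    by (simp only: mackey_free.double_coset_word_def[OF mackey_free])
  have "E [Res H L] \<otimes>\<^bsub>MA\<^esub> b H A g K = E ([Res H L, Tr H A] @ [Con g ?B, Res K ?B])"
    using d assms E_append[of "[Res H L]" "bword H A g K"] bword_words[OF assms(1)] by (simp add: b_def bword_def)
  also have "\<dots> = E [Res H L, Tr H A] \<otimes>\<^bsub>MA\<^esub> E [Con g ?B, Res K ?B]"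
    using d assms by (intro E_append) simp_all
  also have "E [Res H L, Tr H A] = (\<Oplus>\<^bsub>MA\<^esub>x\<in>D. E (?dw x))"
    by (rule E_mackey) (use d assms in auto)
  also have "\<dots> \<otimes>\<^bsub>MA\<^esub> E [Con g ?B, Res K ?B] = (\<Oplus>\<^bsub>MA\<^esub>x\<in>D. E (?dw x) \<otimes>\<^bsub>MA\<^esub> E [Con g ?B, Res K ?B])"
    using fin dw tail by (intro MA.finsum_ldistr) auto
  also have "\<dots> = (\<Oplus>\<^bsub>MA\<^esub>x\<in>D. b L (L \<inter> cj x A) (x \<otimes> g) K)"
  proof (rule MA.M.add.finprod_cong')
    fix x assume x: "x \<in> D"
    note xc = Dc[OF x]
    let ?M = "cj (inv x) L \<inter> A"
    let ?M' = "cj (inv g) ?M"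
    note p = parameters_Res[OF assms(1,2) xc]
    have M: "sub ?M" "?M \<subseteq> A" "?M \<subseteq> carrier G" using d assms xc sub_Int by auto
    have M': "sub ?M'" "?M' \<subseteq> ?B" "cj g ?M' = ?M" "cj x ?M = L \<inter> cj x A" "?M' \<subseteq> K"
    proof -
      show "sub ?M'" using M d by simp
      show "?M' \<subseteq> ?B" using M d by (intro cj_mono) auto
      then show "?M' \<subseteq> K" using d by blast
      show "cj g ?M' = ?M" using M d by simp
      show "cj x ?M = L \<inter> cj x A" using d assms xc subD[OF assms(2)] by (simp add: cj_Int cj_closed)
    qed
    have LxA: "sub (L \<inter> cj x A)" "L \<inter> cj x A \<subseteq> L" using d assms xc sub_Int by auto
    have "E (?dw x) \<otimes>\<^bsub>MA\<^esub> E [Con g ?B, Res K ?B]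
        = E ([Tr L (L \<inter> cj x A), Con x ?M] @ [Res A ?M, Con g ?B] @ [Res K ?B])"
      using E_append[OF dw[OF x] tail] by simp
    also have "\<dots> = E ([Tr L (L \<inter> cj x A), Con x ?M] @ [Con g ?M', Res ?B ?M'] @ [Res K ?B])"
      using d assms xc M M' LxA E_relations(7)[of ?M' ?B g] A by (intro E_context) simp_all
    also have "\<dots> = E ([Tr L (L \<inter> cj x A), Con x ?M, Con g ?M'] @ [Res ?B ?M', Res K ?B] @ [])" by simp
    also have "\<dots> = E ([Tr L (L \<inter> cj x A), Con x ?M, Con g ?M'] @ [Res K ?M'] @ [])"
      using d assms xc M M' LxA by (intro E_context E_relations(4)) simp_all
    also have "\<dots> = E ([Tr L (L \<inter> cj x A)] @ [Con x ?M, Con g ?M'] @ [Res K ?M'])" by simp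
    also have "\<dots> = E ([Tr L (L \<inter> cj x A)] @ [Con (x \<otimes> g) ?M'] @ [Res K ?M'])"
      using d assms xc M M' LxA E_relations(5)[of ?M' g x] by (intro E_context) simp_all
    also have "\<dots> = b L (L \<inter> cj x A) (x \<otimes> g) K"
      by (simp add: b_def bword_def p(2))
    finally show "E (?dw x) \<otimes>\<^bsub>MA\<^esub> E [Con g ?B, Res K ?B] = b L (L \<inter> cj x A) (x \<otimes> g) K" .
  qed (use b_closed parameters_Res[OF assms(1,2) Dc] in auto)
  finally show ?thesis .
qed

lemma b_source_mismatch:
  assumes "parameters H A g K" "x \<in> gens" "gen_source x \<noteq> H"
  shows "E [x] \<otimes>\<^bsub>MA\<^esub> b H A g K = \<zero>\<^bsub>MA\<^esub>"
proof -
  note d = parametersD[OF assms(1)]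
  let ?w = "[Con g (cj (inv g) A), Res K (cj (inv g) A)]"
  have "E [x] \<otimes>\<^bsub>MA\<^esub> b H A g K = E ([x, Tr H A] @ ?w)"
    using d assms E_append[of "[x]" "bword H A g K"] bword_words[OF assms(1)] by (simp add: b_def bword_def)
  also have "\<dots> = E [x, Tr H A] \<otimes>\<^bsub>MA\<^esub> E ?w" using d assms by (intro E_append) simp_all
  also have "E [x, Tr H A] = \<zero>\<^bsub>MA\<^esub>" using d assms by (intro E_relations) simp_all
  finally show ?thesis using d by simp
qed

text \<open>For \<open>h\<close> in \<open>H\<close> the generator \<open>Con h H\<close> equals the
  idempotent \<open>Tr H H\<close>, which fixes the span.\<close>

lemma b_left_invariant:
  assumes "parameters H A g K" "h \<in> H"
  shows "b H (cj h A) (h \<otimes> g) K = b H A g K"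
proof -
  note d = parametersD[OF assms(1)]
  have h: "h \<in> carrier G" using assms d by auto
  have "b H (cj h A) (h \<otimes> g) K = E [Con h H] \<otimes>\<^bsub>MA\<^esub> b H A g K"
    using b_Con[OF assms(1) h] cj_self[OF d(1) assms(2)] by simp
  also have "\<dots> = E [Tr H H] \<otimes>\<^bsub>MA\<^esub> b H A g K" using E_relations(2) d assms by simp
  also have "\<dots> = b H A g K" using b_Tr[OF assms(1) d(1)] by simp
  finally show ?thesis .
qed

text \<open>Split off from \<open>Con (g \<otimes> k)\<close>, the factor belonging to
  \<open>k\<close> can be pushed to the right through the restriction; there it becomes
  \<open>Con k K\<close>, which is the idempotent of \<open>K\<close>.\<close>

lemma b_right_invariant:
  assumes "parameters H A g K" "k \<in> K"
  shows "b H A (g \<otimes> k) K = b H A g K"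
proof -
  note d = parametersD[OF assms(1)]
  have k: "k \<in> carrier G" using assms d by auto
  let ?B = "cj (inv g) A"
  let ?B' = "cj (inv k) ?B"
  have eq: "cj (inv (g \<otimes> k)) A = ?B'" using d k by (simp add: cj_cj inv_mult_group group_assoc)
  have kB': "cj k ?B' = ?B" using d k by simp
  have kK: "cj k K = K" by (rule cj_self[OF d(3) assms(2)])
  have "?B' \<subseteq> cj (inv k) K" using d k by (intro cj_mono) auto
  also have "cj (inv k) K = K" by (intro cj_self d(3) subgroup.m_inv_closed[OF d(3) assms(2)])
  finally have B'K: "?B' \<subseteq> K" .
  have B': "sub ?B'" using d k by simp
  have "b H A (g \<otimes> k) K = E ([Tr H A] @ [Con (g \<otimes> k) ?B'] @ [Res K ?B'])"
    by (simp add: b_def bword_def eq)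
  also have "\<dots> = E ([Tr H A] @ [Con g ?B, Con k ?B'] @ [Res K ?B'])"
    using d k B' B'K E_relations(5)[of ?B' k g] kB' by (intro E_context) simp_all
  also have "\<dots> = E ([Tr H A, Con g ?B] @ [Con k ?B', Res K ?B'] @ [])" by simp
  also have "\<dots> = E ([Tr H A, Con g ?B] @ [Res K ?B, Con k K] @ [])"
    using d k B' B'K E_relations(7)[of ?B' K k] kB' kK by (intro E_context) simp_all
  also have "\<dots> = E ([Tr H A, Con g ?B, Res K ?B] @ [Con k K] @ [])" by simp
  also have "\<dots> = E ([Tr H A, Con g ?B, Res K ?B] @ [Res K K] @ [])"
    using d k E_relations(1)[of K] E_relations(2)[of K k] assms by (intro E_context) simp_all
  also have "\<dots> = E ([Tr H A, Con g ?B] @ [Res K ?B, Res K K] @ [])" by simp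
  also have "\<dots> = E ([Tr H A, Con g ?B] @ [Res K ?B] @ [])"
    using d k by (intro E_context E_relations(4)) simp_all
  finally show ?thesis by (simp add: b_def bword_def)
qed

definition basis :: "('g mackey_gen list \<Rightarrow> 'r) set set" where
  "basis = {b H A g K | H A g K. parameters H A g K}"

lemma basisI: "parameters H A g K \<Longrightarrow> b H A g K \<in> basis"
  by (auto simp: basis_def)

lemma basis_closed: "basis \<subseteq> carrier MA"
  using b_closed by (auto simp: basis_def)

lemma finite_basis: "finite basis"
proof (rule finite_subset)
  let ?S = "{H. sub H} \<times> {H. sub H} \<times> carrier G \<times> {H. sub H}"
  show "basis \<subseteq> (\<lambda>(H, A, g, K). b H A g K) ` ?S"
    unfolding basis_def parameters_def by force
  show "finite ((\<lambda>(H, A, g, K). b H A g K) ` ?S)"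
    using finite_subs finite_carrier by blast
qed

text \<open>The span is stable under left multiplication by generators and contains the unit, the
  sum of the elements \<open>b H H \<one> H\<close>.\<close>

lemma span_basis: "MA.span basis = carrier MA"
proof
  note s = MA.span_closure[OF basis_closed]
  show "MA.span basis \<subseteq> carrier MA" by (rule s(5))
  have gen_b: "E [x] \<otimes>\<^bsub>MA\<^esub> b H A g K \<in> MA.span basis" if x: "x \<in> gens" and p: "parameters H A g K" for x H A g K
  proof (cases "gen_source x = H")
    case False
    then show ?thesis using b_source_mismatch[OF p x] s(2) by simp
  next
    case True
    note d = parametersD[OF p]
    have up: "parameters H' A g K" if "sub H'" "H \<subseteq> H'" for H'
      using p that by (auto simp: parameters_def)
    show ?thesis using x
    proof (cases rule: mackey_gensE)
      case (Tr H' J)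
      then show ?thesis using True b_Tr[OF p] up basisI s(1) by auto
    next
      case (Con y J)
      then show ?thesis using True b_Con[OF p] parameters_Con[OF p] basisI s(1) by auto
    next
      case (Res J L)
      have H: "J = H" using True Res by simp
      note D = reps[OF d(1) Res(2) d(2) Res(4)[unfolded H] d(5)]
      have Dc: "y \<in> carrier G" if "y \<in> reps L H A" for y
        using D that d by (auto simp: double_coset_reps_iff)
      have "finite (reps L H A)"
        using D d(1) sub_finite finite_subset by (auto simp: double_coset_reps_iff)
      then show ?thesis
        unfolding Res(1) H b_Res[OF p Res(2) Res(4)[unfolded H] D]
        using parameters_Res[OF p Res(2) Dc] basisI s(1)
        by (intro MA.span_finsum[OF basis_closed]) blast+
    qed
  qed
  have gen_span: "E [x] \<otimes>\<^bsub>MA\<^esub> y \<in> MA.span basis" if x: "x \<in> gens" and y: "y \<in> MA.span basis" for x y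
    using basis_closed y
  proof (induction rule: MA.span_induct)
    case zero
    then show ?case using x s(2) by simp
  next
    case (add y z)
    then show ?case using x s(3) by (simp add: MA.r_distr)
  next
    case (smult a e)
    then obtain H A g K where e: "e = b H A g K" "parameters H A g K" by (auto simp: basis_def)
    then show ?case using x smult s(4)[OF _ gen_b[OF x e(2)]] b_closed[OF e(2)] by (simp add: MA.smult_mult_right)
  qed
  have bHH: "E [Tr H H] = b H H \<one> H" "parameters H H \<one> H" if H: "sub H" for H
  proof -
    have Hc: "H \<subseteq> carrier G" using subD H by blast
    show p: "parameters H H \<one> H" using H Hc by (simp add: parameters_def)
    have "b H H \<one> H = E ([Tr H H] @ [Con \<one> H] @ [Res H H])" using Hc by (simp add: b_def bword_def)
    also have "\<dots> = E ([Tr H H] @ [Tr H H] @ [Res H H])"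
      using E_relations(2)[of H \<one>] H subgroup.one_closed[OF H] by (intro E_context) simp_all
    also have "\<dots> = E ([Tr H H, Tr H H] @ [Res H H] @ [])" by simp
    also have "\<dots> = E ([Tr H H, Tr H H] @ [Tr H H] @ [])"
      using E_relations(1)[of H] H by (intro E_context) simp_all
    also have "\<dots> = E ([Tr H H] @ [Tr H H, Tr H H] @ [])" by simp
    also have "\<dots> = E ([Tr H H] @ [Tr H H] @ [])"
      using H by (intro E_context E_relations) simp_all
    also have "\<dots> = E [Tr H H, Tr H H]" by simp
    also have "\<dots> = E [Tr H H]" using H by (intro E_relations) simp_all
    finally show "E [Tr H H] = b H H \<one> H" ..
  qed
  have word: "E w \<in> MA.span basis" if "w \<in> words" for w
    using that
  proof (induction w)
    case Nil
    have "(\<Oplus>\<^bsub>MA\<^esub>H\<in>{H. sub H}. E [Tr H H]) \<in> MA.span basis"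
      using bHH basisI s(1) by (intro MA.span_finsum[OF basis_closed finite_subs]) auto
    then show ?case using E_one E_Nil by simp
  next
    case (Cons x w)
    then have xw: "x \<in> gens" "w \<in> words" by auto
    have "E (x # w) = E [x] \<otimes>\<^bsub>MA\<^esub> E w" using xw E_append[of "[x]" w] by simp
    then show ?case using gen_span[OF xw(1) Cons.IH] xw by simp
  qed
  show "carrier MA \<subseteq> MA.span basis"
  proof
    fix x assume "x \<in> carrier MA"
    then show "x \<in> MA.span basis"
      by (induction rule: MA_induct) (use s(2,3,4) word in auto)
  qed
qed

end

lemma sum_of_bool:
  fixes f :: "'b \<Rightarrow> int"
  assumes "finite S"
  shows "(\<Sum>x\<in>S. of_bool (P x) * f x) = (\<Sum>x\<in>{x \<in> S. P x}. f x)"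
  unfolding sum.inter_filter[OF assms] by (rule sum.cong) auto

section \<open>Coordinate forms and linear independence\<close>

context fin_group
begin

lemma l_coset_eqD:
  assumes "sub K" "sub K'" "x \<in> carrier G" "y \<in> carrier G" "x <# K = y <# K'"
  shows "K = K'" "x \<in> y <# K'"
proof -
  have "x \<in> x <# K"
    using mem_l_coset[OF assms(3) subD[OF assms(1)] assms(3)] assms(3) subgroup.one_closed[OF assms(1)] by simp
  then show 1: "x \<in> y <# K'" using assms by simp
  then have "x <# K' = x <# K" using l_coset_eq_iff[OF assms(2,4,3)] assms(5) by simp
  then show "K = K'" using l_coset_inv(1)[OF assms(3) subD] assms by metis
qed

lemma l_coset_self_iff:
  assumes "sub H" "x \<in> carrier G"
  shows "x <# H = H \<longleftrightarrow> x \<in> H"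
  using l_coset_eq_iff[OF assms(1) one_closed assms(2)] subD[OF assms(1)] lcos_mult_one by simp

text \<open>The indicator function of an orbit of \<open>H0\<close> on pairs of apex and coset;
  these become the coordinate functions of the basis of spans.\<close>

definition orbit_form :: "'a set \<Rightarrow> 'a set \<Rightarrow> 'a set \<Rightarrow> 'a set \<Rightarrow> 'a set \<Rightarrow> 'a set \<Rightarrow> int" where
  "orbit_form H0 A0 C0 = (\<lambda>H A C. of_bool (H = H0 \<and> (\<exists>h\<in>H0. A = cj h A0 \<and> C = h <# C0)))"

lemma orbit_form_translate:
  assumes "sub H0" "A0 \<subseteq> carrier G" "C0 \<subseteq> carrier G" "A \<subseteq> carrier G" "C \<subseteq> carrier G" "k \<in> H0"
  shows "orbit_form H0 A0 C0 H0 (cj k A) (k <# C) = orbit_form H0 A0 C0 H0 A C"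
proof -
  note [simp] = sub_mem[OF assms(1)]
  have k: "k \<in> carrier G" "inv k \<in> H0" using assms by (auto simp: subgroup.m_inv_closed)
  have "(\<exists>h\<in>H0. cj k A = cj h A0 \<and> k <# C = h <# C0) \<longleftrightarrow> (\<exists>h\<in>H0. A = cj h A0 \<and> C = h <# C0)"
  proof
    assume "\<exists>h\<in>H0. cj k A = cj h A0 \<and> k <# C = h <# C0"
    then obtain h where h: "h \<in> H0" "cj k A = cj h A0" "k <# C = h <# C0" by blast
    then have "A = cj (inv k) (cj h A0)" "C = inv k <# (h <# C0)"
      using assms k by (metis cj_inv(1), metis l_coset_inv(1))
    then show "\<exists>h\<in>H0. A = cj h A0 \<and> C = h <# C0"
      using h k assms subgroup.m_closed[OF assms(1) k(2) h(1)]
      by (intro bexI[of _ "inv k \<otimes> h"]) (auto simp: cj_cj lcos_m_assoc)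
  next
    assume "\<exists>h\<in>H0. A = cj h A0 \<and> C = h <# C0"
    then obtain h where h: "h \<in> H0" "A = cj h A0" "C = h <# C0" by blast
    then show "\<exists>h\<in>H0. cj k A = cj h A0 \<and> k <# C = h <# C0"
      using assms subgroup.m_closed[OF assms(1) assms(6) h(1)]
      by (intro bexI[of _ "k \<otimes> h"]) (auto simp: cj_cj lcos_m_assoc)
  qed
  then show ?thesis by (simp add: orbit_form_def)
qed

lemma orbit_form_invariant:
  assumes "sub H0" "A0 \<subseteq> carrier G" "C0 \<subseteq> carrier G"
  shows "invariant (orbit_form H0 A0 C0)"
  unfolding invariant_def
proof (intro allI ballI impI)
  fix H A C h assume h: "h \<in> H" and v: "valid H A C"
  show "orbit_form H0 A0 C0 H (cj h A) (h <# C) = orbit_form H0 A0 C0 H A C"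
  proof (cases "H = H0")
    case True
    then show ?thesis using orbit_form_translate[OF assms] validD[OF v] h by simp
  qed (simp add: orbit_form_def)
qed

end

context mackey_context
begin

text \<open>For a coset \<open>g <# H\<close>, the stability demanded by \<open>valid\<close> is the
  inclusion of \<open>A\<close> in \<open>cj g H\<close>.\<close>

lemma parameters_valid:
  assumes "parameters K A g H"
  shows "valid K A (g <# H)"
proof -
  note d = parametersD[OF assms]
  have "A \<subseteq> cj g H" using d cj_mono[of g H "cj (inv g) A"] by simp
  then show ?thesis
    using d coset_fixed_iff[of H g A] l_coset_closed by (simp add: valid_def)
qed

lemma fold_bword:
  "fold act (bword H A g K) q = act (Res K (cj (inv g) A)) (act (Con g (cj (inv g) A)) (act (Tr H A) q))"
  by (simp add: bword_def)

lemma fold_bword_invariant: "\<lbrakk>invariant q; parameters H A g K\<rbrakk> \<Longrightarrow> invariant (fold act (bword H A g K) q)"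
  using acts_invariant bword_words by blast

lemma fold_bword_mismatch: "K' \<noteq> K \<Longrightarrow> fold act (bword H A g K) q K' A' C' = 0"
  by (simp add: fold_bword)

text \<open>The dual form of the composition of spans: scaled by the orders of both apexes, the
  decomposition of the pullback into orbits turns into a sum over the middle group
  \<open>K\<close>.\<close>

lemma fold_bword_scaled:
  assumes q: "invariant q" and P: "parameters H A g K" and v: "valid K A' C'"
  shows "int (card A) * int (card A') * fold act (bword H A g K) q K A' C'
    = (\<Sum>k\<in>K. int (card (A \<inter> cj (g \<otimes> k) A')) * q H (A \<inter> cj (g \<otimes> k) A') ((g \<otimes> k) <# C'))"
proof -
  note d = parametersD[OF P] and dv = validD[OF v]
  let ?B = "cj (inv g) A"
  have A: "cj g ?B = A" using d by simp
  have inv: "invariant (act (Con g ?B) (act (Tr H A) q))"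
    by (intro act_invariant q gensI d)
  have "int (card ?B) * int (card A') * fold act (bword H A g K) q K A' C'
    = (\<Sum>k\<in>K. int (card (?B \<inter> cj k A')) * act (Con g ?B) (act (Tr H A) q) ?B (?B \<inter> cj k A') (k <# C'))"
    unfolding fold_bword by (rule act_Res_scaled[OF inv v d(7,6)])
  also have "\<dots> = (\<Sum>k\<in>K. int (card (A \<inter> cj (g \<otimes> k) A')) * q H (A \<inter> cj (g \<otimes> k) A') ((g \<otimes> k) <# C'))"
  proof (rule sum.cong[OF refl])
    fix k assume "k \<in> K"
    then have k: "k \<in> carrier G" using d by auto
    have eq: "cj g (?B \<inter> cj k A') = A \<inter> cj (g \<otimes> k) A'"
      using k d dv by (subst cj_Int) (simp_all add: cj_closed cj_cj)
    have "card (?B \<inter> cj k A') = card (cj g (?B \<inter> cj k A'))"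
      using d by (intro card_cj[symmetric]) auto
    then show "int (card (?B \<inter> cj k A')) * act (Con g ?B) (act (Tr H A) q) ?B (?B \<inter> cj k A') (k <# C')
      = int (card (A \<inter> cj (g \<otimes> k) A')) * q H (A \<inter> cj (g \<otimes> k) A') ((g \<otimes> k) <# C')"
      using k d dv A eq by (simp add: lcos_m_assoc)
  qed
  finally show ?thesis using d by simp
qed

text \<open>The triple \<open>K K K\<close> belongs to the idempotent of \<open>K\<close>, and
  multiplying a span by it gives the span back.\<close>

lemma fold_bword_top:
  assumes q: "invariant q" and P: "parameters H A g K"
  shows "fold act (bword H A g K) q K K K = q H A (g <# K)"
proof -
  note d = parametersD[OF P]
  have v: "valid K K K" using d l_coset_self_iff sub_mem by (auto simp: valid_def)
  have AgK: "A \<subseteq> cj g K" using d cj_mono[of g K "cj (inv g) A"] by simp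
  have "int (card A) * int (card K) * fold act (bword H A g K) q K K K
    = (\<Sum>k\<in>K. int (card A) * q H A (g <# K))"
    unfolding fold_bword_scaled[OF q P v]
  proof (rule sum.cong[OF refl])
    fix k assume k: "k \<in> K"
    then have kc: "k \<in> carrier G" using d by auto
    have "cj (g \<otimes> k) K = cj g K" using cj_self[OF d(3) k] d kc by (simp add: cj_cj[symmetric])
    moreover have "(g \<otimes> k) <# K = g <# K"
      using l_coset_self_iff[OF d(3) kc] k d kc by (simp add: lcos_m_assoc[symmetric])
    ultimately show "int (card (A \<inter> cj (g \<otimes> k) K)) * q H (A \<inter> cj (g \<otimes> k) K) ((g \<otimes> k) <# K)
        = int (card A) * q H A (g <# K)" using AgK by (simp add: Int_absorb2)
  qed
  then show ?thesis using d by simp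
qed

lemma eval_form_append:
  assumes q: "invariant q" and P: "parameters H A g K" and w: "w \<in> words"
  shows "eval_form q (w @ bword H A g K) = fold act w q H A (g <# K)"
proof -
  note d = parametersD[OF P]
  have "eval_form q (w @ bword H A g K)
     = (\<Sum>J\<in>{J. sub J}. if J = K then fold act (bword H A g K) (fold act w q) K K K else 0)"
    unfolding eval_form_def by (rule sum.cong) (auto simp: fold_bword_mismatch)
  also have "\<dots> = fold act (bword H A g K) (fold act w q) K K K"
    using d finite_subs by simp
  also have "\<dots> = fold act w q H A (g <# K)"
    using fold_bword_top[OF acts_invariant[OF q w] P] .
  finally show ?thesis .
qed

lemma form_b:
  assumes "invariant q" "parameters H A g K"
  shows "form q (b H A g K) = embed (q H A (g <# K))"
  using eval_form_append[OF assms, of "[]"] form(2)[OF assms(1) bword_words[OF assms(2)]]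
  by (simp add: b_def)

lemma form_b_mult:
  assumes "invariant q" "parameters H A g K" "parameters H' A' g' K'"
  shows "form q (b H A g K \<otimes>\<^bsub>MA\<^esub> b H' A' g' K')
    = embed (fold act (bword H A g K) q H' A' (g' <# K'))"
  using eval_form_append[OF assms(1,3) bword_words[OF assms(2)]]
    form(2)[OF assms(1), of "bword H A g K @ bword H' A' g' K'"]
    E_append[OF bword_words[OF assms(2)] bword_words[OF assms(3)]] bword_words assms
  by (simp add: b_def)

text \<open>A left coset determines its subgroup, and its representative up to a right factor in
  that subgroup, so the two invariance properties of \<open>b\<close> apply.\<close>

lemma b_eqI:
  assumes P: "parameters H A g K" and P0: "parameters H A0 g0 K0"
    and h: "h \<in> H" "A = cj h A0" "g <# K = h <# (g0 <# K0)"
  shows "b H A g K = b H A0 g0 K0"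
proof -
  note d = parametersD[OF P] and d0 = parametersD[OF P0]
  have hc: "h \<in> carrier G" using h d by auto
  have "g <# K = (h \<otimes> g0) <# K0" using h hc d0 by (simp add: lcos_m_assoc)
  then have K: "K = K0" and g: "g \<in> (h \<otimes> g0) <# K0"
    using l_coset_eqD[OF d(3) d0(3) d(4), of "h \<otimes> g0"] hc d0 by auto
  then obtain k where k: "k \<in> K0" "g = (h \<otimes> g0) \<otimes> k" by (auto simp: l_coset_def)
  have P1: "parameters H (cj h A0) (h \<otimes> g0) K0"
    using parameters_Con(1)[OF P0 hc] cj_self[OF d(1) h(1)] by simp
  show ?thesis
    unfolding K k(2) h(2) using b_right_invariant[OF P1 k(1)] b_left_invariant[OF P0 h(1)] by simp
qed

text \<open>A basis element does not remember its parameters, so some are chosen; every choice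
  serves.\<close>

definition coordinate :: "('g mackey_gen list \<Rightarrow> 'r) set \<Rightarrow> ('g mackey_gen list \<Rightarrow> 'r) set \<Rightarrow> 'r" where
  "coordinate e = (SOME f. \<exists>H A g K. parameters H A g K \<and> e = b H A g K \<and> f = form (orbit_form H A (g <# K)))"

lemma coordinateE:
  assumes "e \<in> basis"
  obtains H A g K where "parameters H A g K" "e = b H A g K" "coordinate e = form (orbit_form H A (g <# K))"
proof -
  have "\<exists>f H A g K. parameters H A g K \<and> e = b H A g K \<and> f = form (orbit_form H A (g <# K))"
    using assms by (auto simp: basis_def)
  then show thesis
    using someI_ex[of "\<lambda>f. \<exists>H A g K. parameters H A g K \<and> e = b H A g K \<and> f = form (orbit_form H A (g <# K))"]
      that unfolding coordinate_def by blast
qed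

lemma parameters_orbit_form_invariant:
  assumes "parameters H A g K"
  shows "invariant (orbit_form H A (g <# K))"
  by (intro orbit_form_invariant l_coset_closed parametersD[OF assms])

lemma orbit_form_self:
  assumes "parameters H A g K"
  shows "orbit_form H A (g <# K) H A (g <# K) = 1"
proof -
  note d = parametersD[OF assms]
  have "A = cj \<one> A \<and> g <# K = \<one> <# (g <# K)" using d l_coset_closed by (simp add: lcos_mult_one)
  then show ?thesis using subgroup.one_closed[OF d(1)] unfolding orbit_form_def by auto
qed

lemma dual_basis_MA:
  assumes "\<one>\<^bsub>R\<^esub> \<noteq> \<zero>\<^bsub>R\<^esub>"
  shows "dual_basis R MA basis coordinate"
proof (unfold_locales)
  show "finite basis" "basis \<subseteq> carrier MA" "MA.span basis = carrier MA"
    by (rule finite_basis basis_closed span_basis)+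
  show "coordinate e \<in> module_hom R MA (regular_module R)" if e: "e \<in> basis" for e
  proof -
    obtain H A g K where "parameters H A g K" "coordinate e = form (orbit_form H A (g <# K))"
      using coordinateE[OF e] by metis
    then show ?thesis using form(1)[OF parameters_orbit_form_invariant] by simp
  qed
  fix e e' assume e: "e \<in> basis" and e': "e' \<in> basis"
  obtain H0 A0 g0 K0 where P0: "parameters H0 A0 g0 K0" "e = b H0 A0 g0 K0"
    "coordinate e = form (orbit_form H0 A0 (g0 <# K0))" using coordinateE[OF e] by metis
  obtain H A g K where P: "parameters H A g K" "e' = b H A g K" using e' by (auto simp: basis_def)
  let ?q = "orbit_form H0 A0 (g0 <# K0)"
  note inv = parameters_orbit_form_invariant[OF P0(1)]
  have 1: "coordinate e e' = embed (?q H A (g <# K))"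
    using form_b[OF inv P(1)] P0 P by simp
  have 2: "coordinate e e = embed 1"
    using form_b[OF inv P0(1)] P0 orbit_form_self[OF P0(1)] by simp
  show "coordinate e e' = (if e = e' then \<one>\<^bsub>R\<^esub> else \<zero>\<^bsub>R\<^esub>)"
  proof (cases "?q H A (g <# K) = 0")
    \<comment> \<open>Value zero excludes \<open>e = e'\<close>, because the value at
      \<open>e\<close> itself is one and the ring is non-trivial.\<close>
    case True
    then show ?thesis using 1 2 assms by auto
  next
    case False
    then have "H = H0" "\<exists>h\<in>H0. A = cj h A0 \<and> g <# K = h <# (g0 <# K0)"
      unfolding orbit_form_def by (auto split: if_splits)
    then obtain h where "h \<in> H" "A = cj h A0" "g <# K = h <# (g0 <# K0)" "H = H0" by blast
    then have "e' = e" using b_eqI[of H A g K A0 g0 K0 h] P P0 by simp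
    then show ?thesis using 2 by simp
  qed
qed

end

section \<open>The symmetrizing trace when the square of p does not divide the order\<close>

locale mackey_exact = exact_p_group G p n + mackey_context G R
  for G :: "('g, 'n) monoid_scheme" (structure) and R :: "('r, 'm) ring_scheme" and p n :: nat +
  assumes n_unit: "embed (int n) \<in> Units R" and nontrivial: "\<one>\<^bsub>R\<^esub> \<noteq> \<zero>\<^bsub>R\<^esub>"
begin

text \<open>This is \<phi>(G / A); the division is exact by \<open>card_dvd_ghost\<close>.\<close>

definition burnside_form :: "'g set \<Rightarrow> int" where
  "burnside_form A = int n * ghost A div int (card A)"

lemma burnside_form: "sub A \<Longrightarrow> int (card A) * burnside_form A = int n * ghost A"
  unfolding burnside_form_def using card_dvd_ghost by simp

definition trace_form :: "'g set \<Rightarrow> 'g set \<Rightarrow> 'g set \<Rightarrow> int" where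
  "trace_form = (\<lambda>H A C. of_bool (C = H) * burnside_form A)"

lemma trace_form_invariant: "invariant trace_form"
  unfolding invariant_def
proof (intro allI ballI impI)
  fix H A C h assume h: "h \<in> H" and v: "valid H A C"
  note d = validD[OF v]
  have hc: "h \<in> carrier G" using h d by auto
  have hH: "h <# H = H" using l_coset_self_iff[OF d(1) hc] h by simp
  have "h <# C = H \<longleftrightarrow> C = H" using hH l_coset_inv(1)[OF hc d(4)] l_coset_inv(1)[OF hc d(6)] by metis
  moreover have "burnside_form (cj h A) = burnside_form A"
    using ghost_cj[OF hc d(2)] hc d by (simp add: burnside_form_def)
  ultimately show "trace_form H (cj h A) (h <# C) = trace_form H A C" by (simp add: trace_form_def)
qed

definition pairing :: "'g set \<Rightarrow> 'g set \<Rightarrow> 'g \<Rightarrow> 'g set \<Rightarrow> 'g set \<Rightarrow> 'g set \<Rightarrow> 'g set \<Rightarrow> int" where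
  "pairing H A g K = fold act (bword H A g K) trace_form"

lemma pairing_scaled:
  assumes P: "parameters H A g K" and P': "parameters K A' g' H'"
  shows "int (card A) * int (card A') * pairing H A g K K A' (g' <# H')
    = int n * (\<Sum>k\<in>{k \<in> K. (g \<otimes> k \<otimes> g') <# H' = H}. ghost (A \<inter> cj (g \<otimes> k) A'))"
proof -
  note d = parametersD[OF P] and d' = parametersD[OF P']
  have "int (card A) * int (card A') * pairing H A g K K A' (g' <# H')
    = (\<Sum>k\<in>K. of_bool ((g \<otimes> k \<otimes> g') <# H' = H) * (int n * ghost (A \<inter> cj (g \<otimes> k) A')))"
    unfolding pairing_def fold_bword_scaled[OF trace_form_invariant P parameters_valid[OF P']]
  proof (rule sum.cong[OF refl])
    fix k assume "k \<in> K"
    then have k: "k \<in> carrier G" using d by auto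
    have "sub (A \<inter> cj (g \<otimes> k) A')" using d d' k sub_Int by auto
    from burnside_form[OF this]
    show "int (card (A \<inter> cj (g \<otimes> k) A')) * trace_form H (A \<inter> cj (g \<otimes> k) A') ((g \<otimes> k) <# (g' <# H'))
        = of_bool ((g \<otimes> k \<otimes> g') <# H' = H) * (int n * ghost (A \<inter> cj (g \<otimes> k) A'))"
      using k d d' by (simp add: trace_form_def lcos_m_assoc)
  qed
  also have "\<dots> = (\<Sum>k\<in>{k \<in> K. (g \<otimes> k \<otimes> g') <# H' = H}. int n * ghost (A \<inter> cj (g \<otimes> k) A'))"
    by (rule sum_of_bool[OF sub_finite[OF d(3)]])
  finally show ?thesis by (simp add: sum_distrib_left)
qed

text \<open>A summand survives only if the composite coset is trivial. This forces matching end
  groups and places \<open>g'\<close> in the double coset inverse to that of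
  \<open>g\<close>.\<close>

lemma pairing_zero:
  assumes P: "parameters H A g K" and P': "parameters K' A' g' H'"
    and ne: "K' \<noteq> K \<or> H' \<noteq> H \<or> \<not> (\<exists>k\<in>K. g \<otimes> k \<otimes> g' \<in> H)"
  shows "pairing H A g K K' A' (g' <# H') = 0"
proof (cases "K' = K")
  case True
  note d = parametersD[OF P] and d' = parametersD[OF P']
  have "False" if k: "k \<in> K" "(g \<otimes> k \<otimes> g') <# H' = H" for k
  proof -
    have kc: "k \<in> carrier G" using k d by auto
    then have gc: "g \<otimes> k \<otimes> g' \<in> carrier G" using d d' by simp
    have "(g \<otimes> k \<otimes> g') <# H' = \<one> <# H" using k d by (simp add: lcos_mult_one)
    then have H': "H' = H" using l_coset_eqD(1)[OF d'(3) d(1) gc, of \<one>] by simp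
    then have "g \<otimes> k \<otimes> g' \<in> H" using l_coset_self_iff[OF d(1) gc] k by simp
    then show False using ne H' True k by blast
  qed
  then have none: "{k \<in> K. (g \<otimes> k \<otimes> g') <# H' = H} = {}" by blast
  have "int (card A) * int (card A') * pairing H A g K K A' (g' <# H') = 0"
    unfolding pairing_scaled[OF P P'[unfolded True]] none by simp
  then show ?thesis using True d d' by simp
qed (simp add: pairing_def fold_bword_mismatch)

lemma pairing_scaled':
  assumes P: "parameters H A g K" and P': "parameters K A' g' H"
  shows "int (card A) * int (card A') * pairing H A g K K A' (g' <# H)
    = int n * (\<Sum>k\<in>{k \<in> K. g \<otimes> k \<otimes> g' \<in> H}. ghost (A \<inter> cj (g \<otimes> k) A'))"
proof -
  note d = parametersD[OF P] and d' = parametersD[OF P']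
  have "(g \<otimes> k \<otimes> g') <# H = H \<longleftrightarrow> g \<otimes> k \<otimes> g' \<in> H" if "k \<in> K" for k
    using l_coset_self_iff[OF d(1)] d d' sub_mem[OF d(3) that] by simp
  then have "{k \<in> K. (g \<otimes> k \<otimes> g') <# H = H} = {k \<in> K. g \<otimes> k \<otimes> g' \<in> H}"
    by (intro Collect_cong conj_cong refl)
  then show ?thesis using pairing_scaled[OF P P'] by simp
qed

text \<open>The substitution \<open>h = inv (g \<otimes> k \<otimes> g')\<close> exchanges the two
  index sets. The corresponding intersections of apexes are conjugate, and \<open>ghost\<close> is
  constant on conjugates.\<close>

lemma pairing_commute:
  assumes P: "parameters H A g K" and P': "parameters K' A' g' H'"
  shows "pairing H A g K K' A' (g' <# H') = pairing K' A' g' H' H A (g <# K)"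
proof (cases "K' = K \<and> H' = H")
  case False
  have "pairing H A g K K' A' (g' <# H') = 0" by (rule pairing_zero[OF P P']) (use False in blast)
  moreover have "pairing K' A' g' H' H A (g <# K) = 0" by (rule pairing_zero[OF P' P]) (use False in blast)
  ultimately show ?thesis by simp
next
  case True
  then have P': "parameters K A' g' H" using P' by simp
  note d = parametersD[OF P] and d' = parametersD[OF P']
  have "(\<Sum>k\<in>{k \<in> K. g \<otimes> k \<otimes> g' \<in> H}. ghost (A \<inter> cj (g \<otimes> k) A'))
      = (\<Sum>h\<in>{h \<in> H. g' \<otimes> h \<otimes> g \<in> K}. ghost (A' \<inter> cj (g' \<otimes> h) A))"
  proof (rule sum.reindex_bij_witness[of _ "\<lambda>h. inv (g' \<otimes> h \<otimes> g)" "\<lambda>k. inv (g \<otimes> k \<otimes> g')"])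
    fix k assume k: "k \<in> {k \<in> K. g \<otimes> k \<otimes> g' \<in> H}"
    then have kc [simp]: "k \<in> carrier G" using d by auto
    show "inv (g' \<otimes> inv (g \<otimes> k \<otimes> g') \<otimes> g) = k"
      using d d' by (simp add: inv_mult_group group_assoc)
    have "g' \<otimes> inv (g \<otimes> k \<otimes> g') \<otimes> g = inv k" using d d' by (simp add: inv_mult_group group_assoc)
    then show "inv (g \<otimes> k \<otimes> g') \<in> {h \<in> H. g' \<otimes> h \<otimes> g \<in> K}"
      using k subgroup.m_inv_closed[OF d(1)] subgroup.m_inv_closed[OF d(3)] by simp
    have 1: "g' \<otimes> inv (g \<otimes> k \<otimes> g') = inv (g \<otimes> k)" using d d' by (simp add: inv_mult_group group_assoc)
    have "A' \<inter> cj (inv (g \<otimes> k)) A = cj (inv (g \<otimes> k)) (A \<inter> cj (g \<otimes> k) A')"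
      using d d' by (subst cj_Int) (auto simp: cj_closed)
    then show "ghost (A' \<inter> cj (g' \<otimes> inv (g \<otimes> k \<otimes> g')) A) = ghost (A \<inter> cj (g \<otimes> k) A')"
      unfolding 1 using d d' sub_Int by (simp add: ghost_cj)
  next
    fix h assume h: "h \<in> {h \<in> H. g' \<otimes> h \<otimes> g \<in> K}"
    then have hc [simp]: "h \<in> carrier G" using d by auto
    show "inv (g \<otimes> inv (g' \<otimes> h \<otimes> g) \<otimes> g') = h"
      using d d' by (simp add: inv_mult_group group_assoc)
    have "g \<otimes> inv (g' \<otimes> h \<otimes> g) \<otimes> g' = inv h" using d d' by (simp add: inv_mult_group group_assoc)
    then show "inv (g' \<otimes> h \<otimes> g) \<in> {k \<in> K. g \<otimes> k \<otimes> g' \<in> H}"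
      using h subgroup.m_inv_closed[OF d(1)] subgroup.m_inv_closed[OF d(3)] by simp
  qed
  then have "int (card A) * int (card A') * pairing H A g K K A' (g' <# H)
    = int (card A) * int (card A') * pairing K A' g' H H A (g <# K)"
    using pairing_scaled'[OF P P'] pairing_scaled'[OF P' P] by (simp add: algebra_simps)
  then show ?thesis using True d d' by simp
qed

text \<open>Written in this way, the conditions on \<open>D\<close> assemble into marks when
  \<open>B\<close> runs through the conjugates of a subgroup.\<close>

lemma ghost_Int:
  assumes "A \<subseteq> carrier G"
  shows "ghost (A \<inter> B) = (\<Sum>D\<in>subs A. weight D * of_bool (D \<subseteq> B))"
proof -
  have "(\<Sum>D\<in>subs A. weight D * of_bool (D \<subseteq> B)) = (\<Sum>D\<in>subs A. of_bool (D \<subseteq> B) * weight D)"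
    by (simp add: mult.commute)
  also have "\<dots> = (\<Sum>D\<in>{D \<in> subs A. D \<subseteq> B}. weight D)" by (rule sum_of_bool) simp
  also have "{D \<in> subs A. D \<subseteq> B} = subs (A \<inter> B)" by (auto simp: subs_def)
  finally show ?thesis by (simp add: ghost_def)
qed

text \<open>Against \<open>t\<^sup>K c r\<^sup>H\<close> supported on the double coset \<open>K g\<^sup>-\<^sup>1 H\<close>, the elements supported on
  \<open>H g K\<close> pair like the Burnside ring of \<open>L = H \<inter> gKg\<^sup>-\<^sup>1\<close>.\<close>

lemma coordinate_represented:
  assumes P0: "parameters K B0 g' H"
  shows "\<exists>z\<in>carrier MA. \<forall>e\<in>basis. form trace_form (z \<otimes>\<^bsub>MA\<^esub> e) = form (orbit_form K B0 (g' <# H)) e"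
proof -
  note d0 = parametersD[OF P0]
  \<comment> \<open>Representing elements are sought in the double coset inverse to that of
    \<open>g'\<close>, the only one that can pair non-trivially with the given element.\<close>
  define g where "g = inv g'"
  have g: "g \<in> carrier G" "inv g = g'" using d0 by (auto simp: g_def)
  define L where "L = H \<inter> cj g K"
  have L: "sub L" "L \<subseteq> carrier G" unfolding L_def using d0 g sub_Int subD by auto
  have PA: "parameters H A g K" if "A \<in> subs L" for A
  proof -
    note s = subsD[OF that]
    have "cj (inv g) A \<subseteq> cj (inv g) (cj g K)"
      using s d0 g by (intro cj_mono cj_closed) (auto simp: L_def)
    also have "\<dots> = K" by (rule cj_inv(1)[OF g(1) d0(9)])
    finally show ?thesis using s d0 g by (simp add: parameters_def L_def)
  qed
  have PB: "parameters K (cj g' B) g' H" if "B \<in> subs L" for B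
  proof -
    note s = subsD[OF that]
    have "cj g' B \<subseteq> K" using parametersD(6)[OF PA[OF that]] g by simp
    then show ?thesis using s d0 g subD[OF s(1)] by (simp add: parameters_def L_def)
  qed
  define V where "V A B = pairing H A g K K (cj g' B) (g' <# H)" for A B
  \<comment> \<open>The map sending \<open>k\<close> to \<open>g \<otimes> k \<otimes> g'\<close>
    identifies the index set of the pairing with \<open>L\<close>. Expanding \<open>ghost\<close>
    and counting by \<open>mark_count\<close> yields the matrix treated in
    \<open>all_invariants_attained\<close>.\<close>
  have V: "int (card A) * V A B = int n * (\<Sum>D\<in>subs A. weight D * mark L B D)"
    if A: "A \<in> subs L" and B: "B \<in> subs L" for A B
  proof -
    note sA = subsD[OF A] and sB = subsD[OF B]
    note Ac = subD[OF sA(1)] and Bc = subD[OF sB(1)]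
    have "(\<Sum>k\<in>{k \<in> K. g \<otimes> k \<otimes> g' \<in> H}. ghost (A \<inter> cj (g \<otimes> k) (cj g' B)))
        = (\<Sum>l\<in>L. ghost (A \<inter> cj l B))"
    proof (rule sum.reindex_bij_witness[of _ "\<lambda>l. g' \<otimes> l \<otimes> g" "\<lambda>k. g \<otimes> k \<otimes> g'"])
      fix k assume k: "k \<in> {k \<in> K. g \<otimes> k \<otimes> g' \<in> H}"
      then have [simp]: "k \<in> carrier G" using d0 by auto
      show "g' \<otimes> (g \<otimes> k \<otimes> g') \<otimes> g = k" using d0 by (simp add: g_def group_assoc)
      have "inv g \<otimes> (g \<otimes> k \<otimes> g') \<otimes> g = k" using d0 by (simp add: g_def group_assoc)
      then show "g \<otimes> k \<otimes> g' \<in> L" using k g d0 by (simp add: L_def mem_cj)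
      show "ghost (A \<inter> cj (g \<otimes> k \<otimes> g') B) = ghost (A \<inter> cj (g \<otimes> k) (cj g' B))"
        using g d0 Bc by (simp add: cj_cj group_assoc)
    next
      fix l assume l: "l \<in> L"
      then have [simp]: "l \<in> carrier G" using L by auto
      show eq: "g \<otimes> (g' \<otimes> l \<otimes> g) \<otimes> g' = l" using d0 by (simp add: g_def group_assoc)
      show "g' \<otimes> l \<otimes> g \<in> {k \<in> K. g \<otimes> k \<otimes> g' \<in> H}"
        using l g d0 eq by (simp add: L_def mem_cj)
    qed
    also have "\<dots> = (\<Sum>l\<in>L. \<Sum>D\<in>subs A. weight D * of_bool (D \<subseteq> cj l B))"
      by (simp add: ghost_Int[OF Ac])
    also have "\<dots> = (\<Sum>D\<in>subs A. \<Sum>l\<in>L. weight D * of_bool (D \<subseteq> cj l B))" by (rule sum.swap)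
    also have "\<dots> = (\<Sum>D\<in>subs A. weight D * (int (card B) * mark L B D))"
    proof (rule sum.cong[OF refl])
      fix D assume "D \<in> subs A"
      then have "D \<subseteq> carrier G" using subsD(1) subD by blast
      then show "(\<Sum>l\<in>L. weight D * of_bool (D \<subseteq> cj l B)) = weight D * (int (card B) * mark L B D)"
        unfolding mark_count[OF L(1) B \<open>D \<subseteq> carrier G\<close>] by (simp add: sum_distrib_left)
    qed
    also have "\<dots> = int (card B) * (\<Sum>D\<in>subs A. weight D * mark L B D)"
      by (simp add: sum_distrib_left algebra_simps)
    finally have "int (card A) * int (card (cj g' B)) * V A B
        = int n * (int (card B) * (\<Sum>D\<in>subs A. weight D * mark L B D))"
      unfolding V_def pairing_scaled'[OF PA[OF A] PB[OF B]] by simp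
    then have "int (card B) * (int (card A) * V A B)
        = int (card B) * (int n * (\<Sum>D\<in>subs A. weight D * mark L B D))"
      using Bc d0 by (simp add: algebra_simps)
    then show ?thesis using sB by simp
  qed
  \<comment> \<open>The function to be attained: the indicator of the \<open>L\<close>-class of the
    apex \<open>B0\<close> after transport by \<open>g\<close>.\<close>
  define w where "w B = (of_bool (\<exists>l\<in>L. B = cj l (cj g B0)) :: int)" for B
  have B0L: "cj g B0 \<in> subs L"
    using d0 g cj_mono[of g K B0] by (simp add: subs_def L_def g_def)
  have "w (cj x B) = w B" if "B \<in> subs L" "x \<in> L" for B x
  proof -
    have xc: "x \<in> carrier G" and Lc: "\<And>l. l \<in> L \<Longrightarrow> l \<in> carrier G" using that L by auto
    have Bc: "B \<subseteq> carrier G" using subsD(1)[OF that(1)] subD by blast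
    have B0c: "cj g B0 \<subseteq> carrier G" using subsD(1)[OF B0L] subD by blast
    have "(\<exists>l\<in>L. cj x B = cj l (cj g B0)) \<longleftrightarrow> (\<exists>l\<in>L. B = cj l (cj g B0))"
    proof
      assume "\<exists>l\<in>L. cj x B = cj l (cj g B0)"
      then obtain l where l: "l \<in> L" "cj x B = cj l (cj g B0)" by blast
      then have "B = cj (inv x) (cj l (cj g B0))" using cj_inv(1)[OF xc Bc] by simp
      then have "B = cj (inv x \<otimes> l) (cj g B0)" using l xc Lc B0c by (simp add: cj_cj)
      moreover have "inv x \<otimes> l \<in> L"
        using l that subgroup.m_closed[OF L(1) subgroup.m_inv_closed[OF L(1)]] by blast
      ultimately show "\<exists>l\<in>L. B = cj l (cj g B0)" by blast
    next
      assume "\<exists>l\<in>L. B = cj l (cj g B0)"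
      then obtain l where l: "l \<in> L" "B = cj l (cj g B0)" by blast
      then have "cj x B = cj (x \<otimes> l) (cj g B0)" using xc Lc B0c by (simp add: cj_cj)
      moreover have "x \<otimes> l \<in> L" using l that subgroup.m_closed[OF L(1)] by blast
      ultimately show "\<exists>l\<in>L. cj x B = cj l (cj g B0)" by blast
    qed
    then show ?thesis by (simp add: w_def)
  qed
  from all_invariants_attained[OF L(1) V this]
  obtain m a where att: "\<And>B. B \<in> subs L \<Longrightarrow> (\<Sum>A\<in>subs L. a A * V A B) = int n ^ m * w B"
    unfolding attained_def by blast
  \<comment> \<open>The coefficients found on subgroups of \<open>L\<close> are right against every
    basis element. Off the double coset both sides vanish; on it, translation by an element of
    \<open>K\<close> brings the coset to \<open>g' <# H\<close> and the apex into
    \<open>L\<close>.\<close>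
  have claim: "(\<Sum>A\<in>subs L. a A * pairing H A g K K' B' (g'' <# H'))
      = int n ^ m * orbit_form K B0 (g' <# H) K' B' (g'' <# H')"
    if P: "parameters K' B' g'' H'" for K' B' g'' H'
  proof -
    note d = parametersD[OF P]
    have coset: "K' = K \<and> H' = H \<and> (\<exists>k\<in>K. g \<otimes> k \<otimes> g'' \<in> H)"
      if nz: "orbit_form K B0 (g' <# H) K' B' (g'' <# H') \<noteq> 0"
    proof -
      have K': "K' = K" using nz by (auto simp: orbit_form_def)
      obtain k where k: "k \<in> K" "g'' <# H' = k <# (g' <# H)"
        using nz by (auto simp: orbit_form_def split: if_splits)
      have kc: "k \<in> carrier G" "inv k \<in> K"
        using k d0 subgroup.m_inv_closed[OF d0(1)] by auto
      have eq: "g'' <# H' = (k \<otimes> g') <# H" using k kc d0 by (simp add: lcos_m_assoc)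
      have H': "H' = H" and "g'' \<in> (k \<otimes> g') <# H"
        using l_coset_eqD[OF d(3) d0(3) d(4) _ eq] kc d0 by auto
      then obtain h where h: "h \<in> H" "g'' = k \<otimes> g' \<otimes> h" by (auto simp: l_coset_def)
      have "h \<in> carrier G" using h d0 by auto
      then have "g \<otimes> inv k \<otimes> g'' = h" using h kc d0 by (simp add: g_def group_assoc)
      then show ?thesis using K' H' kc h by blast
    qed
    show ?thesis
    proof (cases "K' = K \<and> H' = H \<and> (\<exists>k\<in>K. g \<otimes> k \<otimes> g'' \<in> H)")
      case False
      then have "pairing H A g K K' B' (g'' <# H') = 0" if "A \<in> subs L" for A
        using pairing_zero[OF PA[OF that] P] by blast
      then show ?thesis using coset False by auto
    next
      case True
      then obtain k0 where k0: "k0 \<in> K" "g \<otimes> k0 \<otimes> g'' \<in> H" and eqs: "K' = K" "H' = H" by blast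
      define k where "k = inv k0"
      have k: "k \<in> K" "k \<in> carrier G" "k0 \<in> carrier G"
        using k0 d0 subgroup.m_inv_closed[OF d0(1)] by (auto simp: k_def)
      have "g'' <# H = k <# (g' <# ((g \<otimes> k0 \<otimes> g'') <# H))"
        using k d d0 eqs by (simp add: lcos_m_assoc g_def k_def group_assoc)
      then have C: "g'' <# H = k <# (g' <# H)"
        using iffD2[OF l_coset_self_iff[OF d0(3)] k0(2)] k d d0 g by simp
      let ?B = "cj g (cj k0 B')"
      have B'c: "B' \<subseteq> carrier G" using d by simp
      have "cj k0 B' \<subseteq> cj k0 K" using d eqs k d0 by (intro cj_mono) auto
      then have k0B: "cj k0 B' \<subseteq> K" using cj_self[OF d0(1) k0(1)] by simp
      have "?B = cj (g \<otimes> k0 \<otimes> g'') (cj (inv g'') B')"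
        using d k g by (simp add: cj_cj group_assoc)
      also have "\<dots> \<subseteq> cj (g \<otimes> k0 \<otimes> g'') H"
        using d eqs k g d0 by (intro cj_mono) auto
      also have "\<dots> = H" by (rule cj_self[OF d0(3) k0(2)])
      finally have BL: "?B \<in> subs L"
        using k0B cj_mono[OF g(1) d0(9), of "cj k0 B'"] g k d by (simp add: subs_def L_def)
      have gB: "cj g' ?B = cj k0 B'" using k d d0 by (simp add: g_def cj_closed)
      have kB: "cj k (cj k0 B') = B'" using k d by (simp add: k_def)
      have v: "valid K (cj k0 B') (g' <# H)"
        using parameters_valid[OF PB[OF BL]] gB by simp
      have "pairing H A g K K B' (g'' <# H) = V A ?B" if "A \<in> subs L" for A
        using invariantD[OF fold_bword_invariant[OF trace_form_invariant PA[OF that]] v k(1)] C kB gB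
        by (simp add: V_def pairing_def)
      then have "(\<Sum>A\<in>subs L. a A * pairing H A g K K B' (g'' <# H)) = int n ^ m * w ?B"
        using att[OF BL] by simp
      moreover have "w ?B = orbit_form K B0 (g' <# H) K B' (g'' <# H)"
      proof -
        have "orbit_form K B0 (g' <# H) K B' (g'' <# H) = orbit_form K B0 (g' <# H) K (cj k0 B') (g' <# H)"
          unfolding C
          using orbit_form_translate[OF d0(1,8) l_coset_closed[OF d0(4,10)], of "cj k0 B'" "g' <# H" k]
            validD[OF v] k kB by simp
        also have "\<dots> = of_bool (\<exists>h\<in>K. cj k0 B' = cj h B0 \<and> g' <# H = h <# (g' <# H))"
          by (simp add: orbit_form_def)
        \<comment> \<open>Conjugation by \<open>g\<close> carries the stabiliser of
          \<open>g' <# H\<close> in \<open>K\<close> onto \<open>L\<close>.\<close>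
        also have "(\<exists>h\<in>K. cj k0 B' = cj h B0 \<and> g' <# H = h <# (g' <# H))
            \<longleftrightarrow> (\<exists>l\<in>L. ?B = cj l (cj g B0))"
        proof
          assume "\<exists>h\<in>K. cj k0 B' = cj h B0 \<and> g' <# H = h <# (g' <# H)"
          then obtain h where h: "h \<in> K" "cj k0 B' = cj h B0" "g' <# H = h <# (g' <# H)" by blast
          have hc: "h \<in> carrier G" using h d0 by auto
          have "(g \<otimes> h \<otimes> g') <# H = g <# (h <# (g' <# H))"
            using hc g d0 by (simp add: lcos_m_assoc group_assoc)
          also have "\<dots> = g <# (g' <# H)" using h(3) by simp
          also have "\<dots> = H" using d0 by (simp add: g_def)
          finally have "g \<otimes> h \<otimes> g' \<in> H" using l_coset_self_iff[OF d0(3)] hc g d0 by simp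
          moreover have "g \<otimes> h \<otimes> g' \<in> cj g K"
            using h hc g d0 by (simp add: mem_cj g_def group_assoc)
          ultimately have "g \<otimes> h \<otimes> g' \<in> L" by (simp add: L_def)
          moreover have "?B = cj (g \<otimes> h \<otimes> g') (cj g B0)"
            using h hc d0 by (simp add: cj_cj g_def group_assoc)
          ultimately show "\<exists>l\<in>L. ?B = cj l (cj g B0)" by blast
        next
          assume "\<exists>l\<in>L. ?B = cj l (cj g B0)"
          then obtain l where l: "l \<in> L" "?B = cj l (cj g B0)" by blast
          have lc: "l \<in> carrier G" using l L by auto
          have "g' \<otimes> l \<otimes> g \<in> K" using l lc g d0 by (simp add: L_def mem_cj)
          moreover have "cj k0 B' = cj (g' \<otimes> l \<otimes> g) B0"
          proof -
            have "cj k0 B' = cj g' (cj l (cj g B0))" using gB l(2) by simp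
            then show ?thesis using lc g d0 by (simp add: cj_cj group_assoc)
          qed
          moreover have "(g' \<otimes> l \<otimes> g) <# (g' <# H) = g' <# H"
          proof -
            have "(g' \<otimes> l \<otimes> g) <# (g' <# H) = g' <# (l <# H)"
              using lc g d0 by (simp add: lcos_m_assoc g_def group_assoc)
            then show ?thesis using l l_coset_self_iff[OF d0(3) lc] by (simp add: L_def)
          qed
          ultimately show "\<exists>h\<in>K. cj k0 B' = cj h B0 \<and> g' <# H = h <# (g' <# H)" by metis
        qed
        finally show ?thesis by (simp add: w_def)
      qed
      ultimately show ?thesis using eqs by simp
    qed
  qed
  note tr = form(1)[OF trace_form_invariant]
  note tr_simps = MA.functional_simps[OF tr]
  define N where "N = embed (int n ^ m)"
  have N: "N \<in> Units R"
    unfolding N_def embed_power using n_unit by (rule R.Units_pow_closed)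
  define y where "y = (\<Oplus>\<^bsub>MA\<^esub>A\<in>subs L. embed (a A) \<odot>\<^bsub>MA\<^esub> b H A g K)"
  have bc: "b H A g K \<in> carrier MA" if "A \<in> subs L" for A using b_closed[OF PA[OF that]] .
  have y: "y \<in> carrier MA" unfolding y_def using bc by (intro MA.M.finsum_closed) auto
  \<comment> \<open>The only division in the coefficient ring, by a power of the unit
    \<open>n\<close>.\<close>
  define z where "z = inv\<^bsub>R\<^esub> N \<odot>\<^bsub>MA\<^esub> y"
  have Nc: "inv\<^bsub>R\<^esub> N \<in> carrier R" "N \<in> carrier R" using N by auto
  have z: "z \<in> carrier MA" unfolding z_def using Nc y by simp
  have "form trace_form (z \<otimes>\<^bsub>MA\<^esub> e) = form (orbit_form K B0 (g' <# H)) e" if e: "e \<in> basis" for e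
  proof -
    obtain K' B' g'' H' where P: "parameters K' B' g'' H'" "e = b K' B' g'' H'"
      using e by (auto simp: basis_def)
    have ec: "e \<in> carrier MA" using b_closed P by simp
    have "y \<otimes>\<^bsub>MA\<^esub> e = (\<Oplus>\<^bsub>MA\<^esub>A\<in>subs L. embed (a A) \<odot>\<^bsub>MA\<^esub> (b H A g K \<otimes>\<^bsub>MA\<^esub> e))"
    proof -
      have "y \<otimes>\<^bsub>MA\<^esub> e = (\<Oplus>\<^bsub>MA\<^esub>A\<in>subs L. embed (a A) \<odot>\<^bsub>MA\<^esub> b H A g K \<otimes>\<^bsub>MA\<^esub> e)"
        unfolding y_def using bc ec by (intro MA.finsum_ldistr) auto
      also have "\<dots> = (\<Oplus>\<^bsub>MA\<^esub>A\<in>subs L. embed (a A) \<odot>\<^bsub>MA\<^esub> (b H A g K \<otimes>\<^bsub>MA\<^esub> e))"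
        by (rule MA.M.add.finprod_cong'[OF refl]) (use bc ec in \<open>simp_all add: MA.smult_mult_left Pi_def\<close>)
      finally show ?thesis .
    qed
    then have "form trace_form (y \<otimes>\<^bsub>MA\<^esub> e)
        = (\<Oplus>\<^bsub>R\<^esub>A\<in>subs L. form trace_form (embed (a A) \<odot>\<^bsub>MA\<^esub> (b H A g K \<otimes>\<^bsub>MA\<^esub> e)))"
      using bc ec by (simp add: MA.functional_finsum[OF tr] Pi_def)
    also have "\<dots> = (\<Oplus>\<^bsub>R\<^esub>A\<in>subs L. embed (a A * pairing H A g K K' B' (g'' <# H')))"
    proof (rule R.add.finprod_cong'[OF refl])
      fix A assume A: "A \<in> subs L"
      show "form trace_form (embed (a A) \<odot>\<^bsub>MA\<^esub> (b H A g K \<otimes>\<^bsub>MA\<^esub> e))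
          = embed (a A * pairing H A g K K' B' (g'' <# H'))"
        using bc[OF A] ec form_b_mult[OF trace_form_invariant PA[OF A] P(1)]
        by (simp add: tr_simps P(2) pairing_def)
    qed auto
    also have "\<dots> = embed (int n ^ m * orbit_form K B0 (g' <# H) K' B' (g'' <# H'))"
      by (simp only: embed_sum[symmetric] claim[OF P(1)])
    also have "\<dots> = N \<otimes>\<^bsub>R\<^esub> form (orbit_form K B0 (g' <# H)) e"
      using form_b[OF parameters_orbit_form_invariant[OF P0] P(1)] P(2) by (simp add: N_def)
    finally have 1: "form trace_form (y \<otimes>\<^bsub>MA\<^esub> e) = N \<otimes>\<^bsub>R\<^esub> form (orbit_form K B0 (g' <# H)) e" .
    have fc: "form (orbit_form K B0 (g' <# H)) e \<in> carrier R"
      using MA.functional_simps(1)[OF form(1)[OF parameters_orbit_form_invariant[OF P0]] ec] .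
    have "form trace_form (z \<otimes>\<^bsub>MA\<^esub> e) = inv\<^bsub>R\<^esub> N \<otimes>\<^bsub>R\<^esub> (N \<otimes>\<^bsub>R\<^esub> form (orbit_form K B0 (g' <# H)) e)"
      unfolding z_def 1[symmetric] using y ec Nc by (simp add: MA.smult_mult_left tr_simps)
    also have "\<dots> = form (orbit_form K B0 (g' <# H)) e"
      using Nc fc N by (simp add: R.m_assoc[symmetric])
    finally show ?thesis .
  qed
  then show ?thesis using z by blast
qed

theorem symmetric_mackey_algebra: "symmetric_algebra R MA"
proof (rule MA.symmetric_algebraI[OF dual_basis_MA[OF nontrivial] form(1)[OF trace_form_invariant]])
  fix x y assume "x \<in> basis" "y \<in> basis"
  then obtain H A g K H' A' g' K' where P: "parameters H A g K" "x = b H A g K"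
    "parameters H' A' g' K'" "y = b H' A' g' K'" by (auto simp: basis_def)
  show "form trace_form (x \<otimes>\<^bsub>MA\<^esub> y) = form trace_form (y \<otimes>\<^bsub>MA\<^esub> x)"
    using form_b_mult[OF trace_form_invariant P(1,3)] form_b_mult[OF trace_form_invariant P(3,1)]
      pairing_commute[OF P(1,3)] P by (simp add: pairing_def)
next
  fix e assume "e \<in> basis"
  then obtain H A g K where P: "parameters H A g K" "coordinate e = form (orbit_form H A (g <# K))"
    using coordinateE by metis
  then show "\<exists>z\<in>carrier MA. \<forall>x\<in>basis. form trace_form (z \<otimes>\<^bsub>MA\<^esub> x) = coordinate e x"
    using coordinate_represented[OF P(1)] by simp
qed

end

section \<open>Orders divisible by the square of a prime\<close>

context fin_group
begin

lemma subs_of_prime_square: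
  assumes "prime p" "sub Q" "card Q = p * p" "B \<in> subs Q"
  shows "B = {\<one>} \<or> card B = p \<or> B = Q"
proof -
  note b = subsD[OF assms(4)]
  have "card B dvd p ^ 2" using lagrange_subs[OF assms(2,4)] assms(3) by (simp add: power2_eq_square)
  then obtain i where i: "i \<le> 2" "card B = p ^ i" using divides_primepow_nat[OF assms(1)] by blast
  consider "i = 0" | "i = 1" | "i = 2" using i(1) by linarith
  then show ?thesis
  proof cases
    case 1
    then have "card B = 1" using i by simp
    then show ?thesis using subgroup.one_closed[OF b(1)] by (metis card_1_singletonE singletonD)
  next
    case 3
    then have "card B = card Q" using i assms(3) by (simp add: power2_eq_square)
    then show ?thesis using card_subset_eq[OF sub_finite[OF assms(2)] b(2)] by simp
  qed (use i in simp)
qed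

text \<open>If |B| = p, then \<open>B\<close> has \<open>p\<close> cosets, so by
  \<open>mark_congruence\<close> the number of those that it fixes is divisible by \<open>p\<close>.
  This number is the index of \<open>B\<close> in its normaliser, which must therefore be all of
  \<open>Q\<close>.\<close>

lemma normal_in_prime_square:
  assumes p: "prime p" and Q: "sub Q" "card Q = p * p" and B: "B \<in> subs Q" and k: "k \<in> Q"
  shows "cj k B = B"
proof -
  note b = subsD[OF B]
  have kc: "k \<in> carrier G" using k Q sub_mem by auto
  consider "B = {\<one>}" | "card B = p" | "B = Q"
    using subs_of_prime_square[OF p Q B] by blast
  then show ?thesis
  proof cases
    case 1
    then show ?thesis using kc by (simp add: cj_image)
  next
    case 2
    obtain y where y: "y \<in> B" "y [^] p = \<one>" "card (range (\<lambda>i::nat. y [^] i)) = p"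
      "range (\<lambda>i::nat. y [^] i) \<subseteq> B"
      using cauchy[OF p b(1)] 2 by (metis dvd_refl)
    have gen: "range (\<lambda>i::nat. y [^] i) = B"
      using y 2 card_subset_eq[OF sub_finite[OF b(1)]] by simp
    have yQ: "y \<in> Q" and yc: "y \<in> carrier G" using y b sub_mem by auto
    have triv: "sub {\<one>}" by (rule triv_subgroup)
    have "{\<one>} <#> B = B" using subD[OF b(1)] by (force simp: set_mult_def subset_iff)
    moreover have "cj y {\<one>} = {\<one>}" using yc by (simp add: cj_image)
    ultimately have cong: "int p dvd mark Q B {\<one>} - mark Q B B"
      using mark_congruence[OF p Q(1) B triv yQ y(2)] gen by simp
    have "{\<one>} \<subseteq> cj x B" if "x \<in> Q" for x
      using subgroup.one_closed[OF cj_sub[OF sub_mem[OF Q(1) that] b(1)]] by simp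
    then have "int p * mark Q B {\<one>} = int (card Q)"
      using mark_count[OF Q(1) B, of "{\<one>}"] 2 by simp
    then have "mark Q B {\<one>} = int p" using Q(2) p prime_gt_0_nat[OF p] by simp
    then have "int p dvd int p - mark Q B B" using cong by simp
    then have "int p dvd mark Q B B" by (metis dvd_diff_commute dvd_add_right_iff dvd_refl diff_add_cancel)
    then have "int p * int p dvd int (card (normalizer_in Q B))"
      using mark_self[OF Q(1) B] 2 by (metis dvd_refl mult_dvd_mono)
    then have "p * p dvd card (normalizer_in Q B)" by (metis of_nat_dvd_iff of_nat_mult)
    moreover have N: "sub (normalizer_in Q B)" by (rule normalizer_in_sub[OF Q(1) subD[OF b(1)]])
    ultimately have "card Q \<le> card (normalizer_in Q B)" using Q(2) by (simp add: dvd_imp_le)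
    then have "normalizer_in Q B = Q"
      using card_seteq[OF sub_finite[OF Q(1)]] by (simp add: normalizer_in_def)
    then show ?thesis using k by (auto simp: normalizer_in_def)
  next
    case 3
    then show ?thesis using cj_self[OF Q(1) k] by simp
  qed
qed

definition cyc :: "'a \<Rightarrow> 'a set" where "cyc x = generate G {x}"

lemma cyc:
  assumes "x \<in> carrier G"
  shows "sub (cyc x)" "x \<in> cyc x" "\<lbrakk>sub B; x \<in> B\<rbrakk> \<Longrightarrow> cyc x \<subseteq> B"
  using assms generate_is_subgroup[of "{x}"] generate.incl[of x "{x}" G] generate_subgroup_incl[of "{x}" B]
  by (auto simp: cyc_def)

lemma card_cyc:
  assumes "prime p" "x \<in> carrier G" "x [^] p = \<one>"
  shows "card (cyc x) = (if x = \<one> then 1 else p)"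
proof -
  have "ord x dvd p" using pow_eq_id[OF assms(2)] assms(3) by simp
  then have "ord x = 1 \<or> ord x = p" using assms(1) by (metis prime_nat_iff)
  then show ?thesis
    using generate_pow_card[OF assms(2)] ord_eq_1[OF assms(2)] assms(1) by (auto simp: cyc_def)
qed

lemma pow_prime_in_sub:
  assumes "prime p" "sub B" "card B = p" "x \<in> B"
  shows "x [^] p = \<one>"
  using prime_order_cyclic(2)[OF assms] nat_pow_one by (cases "x = \<one>") auto

lemma cyc_Int_trivial:
  assumes "prime p" "sub B" "card B = p" "x \<in> carrier G" "x [^] p = \<one>" "x \<notin> B"
  shows "cyc x \<inter> B = {\<one>}"
proof -
  note c = cyc[OF assms(4)]
  have x1: "x \<noteq> \<one>" using assms(6) subgroup.one_closed[OF assms(2)] by auto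
  have S: "sub (cyc x \<inter> B)" using c assms sub_Int by auto
  then have "card (cyc x \<inter> B) dvd p"
    using lagrange_subs[OF assms(2), of "cyc x \<inter> B"] assms(3) by (simp add: subs_def)
  moreover have "card (cyc x \<inter> B) \<noteq> p"
  proof
    assume "card (cyc x \<inter> B) = p"
    then have "cyc x \<inter> B = cyc x"
      using card_cyc[OF assms(1,4,5)] x1 sub_finite[OF c(1)] by (intro card_subset_eq) auto
    then show False using c assms by blast
  qed
  ultimately have "card (cyc x \<inter> B) = 1" using assms(1) by (metis prime_nat_iff)
  then show ?thesis using subgroup.one_closed[OF S] by (metis card_1_singletonE singletonD)
qed

definition torsion :: "nat \<Rightarrow> 'a set \<Rightarrow> 'a set" where
  "torsion p Q = {x \<in> Q. x [^] p = \<one>}"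

text \<open>A generator \<open>a\<close> of \<open>B\<close> commutes with the elements of order \<open>p\<close> outside \<open>B\<close>, because both generate
  normal subgroups; so it acts freely on them by translation.\<close>

lemma card_torsion_outside:
  assumes p: "prime p" and Q: "sub Q" "card Q = p * p" and B: "B \<in> subs Q" "card B = p"
  shows "p dvd card (torsion p Q - B)"
proof -
  note b = subsD[OF B(1)]
  obtain a where a: "a \<in> B" "a [^] p = \<one>" "card (range (\<lambda>i::nat. a [^] i)) = p"
    using cauchy[OF p b(1)] B(2) by (metis dvd_refl)
  have a1: "a \<noteq> \<one>"
  proof
    assume "a = \<one>"
    then have "range (\<lambda>i::nat. a [^] i) = {\<one>}" by auto
    then show False using a(3) p by (simp add: prime_nat_iff)
  qed
  have ac [simp]: "a \<in> carrier G" and aQ: "a \<in> Q" using a b sub_mem by auto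
  let ?X = "torsion p Q - B"
  have Xc: "x \<in> carrier G" "x \<in> Q" "x [^] p = \<one>" "x \<notin> B" if "x \<in> ?X" for x
    using that Q sub_mem by (auto simp: torsion_def)
  have closed: "(\<lambda>x. a \<otimes> x) ` ?X \<subseteq> ?X"
  proof
    fix z assume "z \<in> (\<lambda>x. a \<otimes> x) ` ?X"
    then obtain x where x: "x \<in> ?X" "z = a \<otimes> x" by blast
    note xs = Xc[OF x(1)]
    note [simp] = xs(1)
    \<comment> \<open>The commutator of \<open>a\<close> and \<open>x\<close> lies in
      \<open>cyc x\<close>, which \<open>a\<close> normalises, and in \<open>B\<close>, which
      \<open>x\<close> normalises; these two groups meet trivially.\<close>
    have C: "cyc x \<in> subs Q" using cyc[OF xs(1)] Q xs by (simp add: subs_def)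
    have "inv x \<in> cyc x" by (rule subgroup.m_inv_closed[OF cyc(1,2)[OF xs(1)]])
    moreover have "a \<otimes> x \<otimes> inv a \<in> cj a (cyc x)"
      using cyc(1,2)[OF xs(1)] subD by (auto simp: cj_image)
    then have "a \<otimes> x \<otimes> inv a \<in> cyc x" using normal_in_prime_square[OF p Q C aQ] by simp
    ultimately have 1: "a \<otimes> x \<otimes> inv a \<otimes> inv x \<in> cyc x"
      by (rule subgroup.m_closed[OF cyc(1)[OF xs(1)], rotated])
    have "x \<otimes> inv a \<otimes> inv x \<in> cj x B"
      using a b subgroup.m_inv_closed[OF b(1) a(1)] subD by (auto simp: cj_image)
    then have "x \<otimes> inv a \<otimes> inv x \<in> B" using normal_in_prime_square[OF p Q B(1) xs(2)] by simp
    then have "a \<otimes> (x \<otimes> inv a \<otimes> inv x) \<in> B" using subgroup.m_closed[OF b(1) a(1)] by blast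
    then have "a \<otimes> x \<otimes> inv a \<otimes> inv x \<in> B" by (simp add: m_assoc)
    then have "a \<otimes> x \<otimes> inv a \<otimes> inv x = \<one>"
      using 1 cyc_Int_trivial[OF p b(1) B(2) xs(1,3,4)] by blast
    then have "a \<otimes> x \<otimes> inv a \<otimes> inv x \<otimes> (x \<otimes> a) = x \<otimes> a" by simp
    then have "a \<otimes> x = x \<otimes> a" by (simp add: m_assoc)
    then have "(a \<otimes> x) [^] p = a [^] p \<otimes> x [^] p" by (intro pow_mult_distrib) simp_all
    then have "(a \<otimes> x) [^] p = \<one>" using a xs by simp
    moreover have "a \<otimes> x \<in> Q" using subgroup.m_closed[OF Q(1) aQ xs(2)] .
    moreover have "a \<otimes> x \<notin> B" using sub_mult_mem(1)[OF b(1) a(1) xs(1)] xs(4) by simp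
    ultimately show "z \<in> ?X" using x(2) by (simp add: torsion_def)
  qed
  have pow: "((\<lambda>x. a \<otimes> x) ^^ i) x = a [^] i \<otimes> x" if "x \<in> carrier G" for i x
  proof (induction i)
    case (Suc i)
    have "a \<otimes> a [^] i = a [^] Suc i" using nat_pow_mult[of a 1 i] by simp
    then show ?case using Suc that by (simp add: m_assoc[symmetric])
  qed (use that in simp)
  have "finite ?X" using sub_finite[OF Q(1)] by (simp add: torsion_def)
  moreover have "((\<lambda>x. a \<otimes> x) ^^ p) x = x" if "x \<in> ?X" for x
    using pow[OF Xc(1)[OF that], of p] a(2) Xc(1)[OF that] by simp
  ultimately obtain Y where
    "\<forall>v :: 'a \<Rightarrow> int. (\<forall>x\<in>?X. v (a \<otimes> x) = v x) \<longrightarrow>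
      (\<Sum>x\<in>?X. v x) = (\<Sum>x\<in>{x \<in> ?X. a \<otimes> x = x}. v x) + int p * (\<Sum>x\<in>Y. v x)"
    using prime_orbit_decomposition[OF _ p closed] by auto
  from this[rule_format, of "\<lambda>_. 1"]
  have "int (card ?X) = int (card {x \<in> ?X. a \<otimes> x = x}) + int p * int (card Y)" by simp
  moreover have none: "{x \<in> ?X. a \<otimes> x = x} = {}"
    using Xc(1) a1 r_cancel_one[of _ a] by auto
  ultimately have "int (card ?X) = int p * int (card Y)" unfolding none by simp
  then have "int p dvd int (card ?X)" by (metis dvd_triv_left)
  then show ?thesis by simp
qed

text \<open>As \<open>B\<close> is normal in \<open>Q\<close>, all double cosets have the same size
  |A| |B| / |A \<inter> B|.\<close>

lemma card_reps_prime_square: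
  assumes p: "prime p" and Q: "sub Q" "card Q = p * p" and A: "A \<in> subs Q" and B: "B \<in> subs Q"
  shows "card A * card B * card (reps A Q B) = card Q * card (A \<inter> B)"
proof -
  note a = subsD[OF A] and b = subsD[OF B]
  have "int (card A) * int (card B) * (\<Sum>x\<in>reps A Q B. 1) = (\<Sum>x\<in>Q. int (card (A \<inter> cj x B)) * 1)"
    by (rule double_coset_sum[OF Q(1) a b reps[OF Q(1) a(1) b(1) a(2) b(2)]]) simp
  also have "\<dots> = (\<Sum>x\<in>Q. int (card (A \<inter> B)))"
    using normal_in_prime_square[OF p Q B] by simp
  finally have "int (card A * card B * card (reps A Q B)) = int (card Q * card (A \<inter> B))" by simp
  then show ?thesis by linarith
qed

end

section \<open>Degeneracy modulo p for a subgroup of order the square of p\<close>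

context mackey_context
begin

text \<open>The elements \<open>E [Tr J J]\<close> are orthogonal idempotents with sum 1; on the
  right they select one end of a span, on the left the other.\<close>

lemma b_Tr_right:
  assumes "parameters H A g K" "sub J"
  shows "b H A g K \<otimes>\<^bsub>MA\<^esub> E [Tr J J] = (if J = K then b H A g K else \<zero>\<^bsub>MA\<^esub>)"
proof -
  note d = parametersD[OF assms(1)]
  let ?B = "cj (inv g) A"
  have "b H A g K \<otimes>\<^bsub>MA\<^esub> E [Tr J J] = E (bword H A g K @ [Tr J J])"
    using E_append[OF bword_words[OF assms(1)], of "[Tr J J]"] assms(2) by (simp add: b_def)
  also have "\<dots> = E ([Tr H A, Con g ?B] @ [Res K ?B, Tr J J])" by (simp add: bword_def)
  also have "\<dots> = E [Tr H A, Con g ?B] \<otimes>\<^bsub>MA\<^esub> E [Res K ?B, Tr J J]"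
    using d assms by (intro E_append) simp_all
  finally have 1: "b H A g K \<otimes>\<^bsub>MA\<^esub> E [Tr J J] = E [Tr H A, Con g ?B] \<otimes>\<^bsub>MA\<^esub> E [Res K ?B, Tr J J]" .
  show ?thesis
  proof (cases "J = K")
    case True
    have "E [Res K ?B, Tr K K] = E ([Res K ?B] @ [Tr K K] @ [])" by simp
    also have "\<dots> = E ([Res K ?B] @ [Res K K] @ [])"
      using d E_relations(1)[of K] by (intro E_context) simp_all
    also have "\<dots> = E [Res K ?B, Res K K]" by simp
    also have "\<dots> = E [Res K ?B]" using d by (intro E_relations(4)) simp_all
    finally show ?thesis
      using 1 True E_append[of "[Tr H A, Con g ?B]" "[Res K ?B]"] d by (simp add: b_def bword_def)
  next
    case False
    have "E [Res K ?B, Tr J J] = \<zero>\<^bsub>MA\<^esub>" using d assms False by (intro E_relations(8)) simp_all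
    then show ?thesis using 1 False d by simp
  qed
qed

lemma b_Tr_left:
  assumes "parameters H A g K" "sub J"
  shows "E [Tr J J] \<otimes>\<^bsub>MA\<^esub> b H A g K = (if J = H then b H A g K else \<zero>\<^bsub>MA\<^esub>)"
  using b_Tr[OF assms(1), of H] b_source_mismatch[OF assms(1), of "Tr J J"] parametersD(1)[OF assms(1)] assms(2)
  by simp

text \<open>Between the spans \<open>x A\<close> and \<open>y B\<close> any associative form has
  entries \<open>card (reps A Q B)\<close> times \<open>f (A \<inter> B)\<close> with an unknown
  function \<open>f\<close>. Modulo \<open>p\<close> few counts survive, and those that matter
  involve only the value \<open>f1\<close>. Non-degeneracy puts the coordinates at all
  \<open>x A\<close> into \<open>pR\<close> for every element of \<open>U\<close> whose pairings
  with all \<open>y B\<close> lie in \<open>pR\<close>; used twice, this gives a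
  contradiction.\<close>

lemma not_symmetric:
  assumes p: "prime p" and pp: "p\<^sup>2 dvd order G" and np: "embed (int p) \<notin> Units R"
  shows "\<not> symmetric_algebra R MA"
proof
  assume sym: "symmetric_algebra R MA"
  obtain Q where Q0: "Q \<in> subs (carrier G)" "card Q = p ^ 2"
    using subgroup_of_prime_power_order[OF p sub_carrier, of 2] pp by (auto simp: order_def)
  note Q = subsD(1)[OF Q0(1)] Q0(2)[unfolded power2_eq_square]
  note Qc = sub_mem[OF Q(1)]
  have p0: "p > 0" using p prime_gt_0_nat by blast
  obtain \<beta> where bil: "bilinear_form R MA \<beta>"
    and assoc: "\<forall>x\<in>carrier MA. \<forall>y\<in>carrier MA. \<forall>z\<in>carrier MA.
      \<beta> (x \<otimes>\<^bsub>MA\<^esub> y) z = \<beta> x (y \<otimes>\<^bsub>MA\<^esub> z)"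
    and comm: "\<forall>x\<in>carrier MA. \<forall>y\<in>carrier MA. \<beta> x y = \<beta> y x"
    and nondeg: "nondegenerate_form R MA \<beta>"
    using sym unfolding symmetric_algebra_def by (elim exE conjE)
  note assoc = assoc[rule_format] and comm = comm[rule_format]
  have hom: "\<beta> x \<in> module_hom R MA (regular_module R)" if "x \<in> carrier MA" for x
    using bil that by (auto simp: bilinear_form_def)
  have hom': "(\<lambda>x. \<beta> x y) \<in> module_hom R MA (regular_module R)" if "y \<in> carrier MA" for y
    using bil that by (auto simp: bilinear_form_def)
  note right = MA.functional_simps[OF hom] and left = MA.functional_simps[OF hom']
  have represent: "\<exists>z\<in>carrier MA. \<forall>x\<in>carrier MA. \<beta> z x = L x"
    if L: "L \<in> module_hom R MA (regular_module R)" for L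
  proof -
    have "restrict L (carrier MA) \<in> carrier (dual_module R MA)"
      using MA.functional_simps[OF L] by (auto simp: dual_module_def module_hom_def regular_module_def)
    then have "restrict L (carrier MA) \<in> (\<lambda>x. \<lambda>y\<in>carrier MA. \<beta> x y) ` carrier MA"
      using nondeg by (simp add: nondegenerate_form_def module_iso_def bij_betw_def)
    then obtain z where z: "z \<in> carrier MA" "restrict L (carrier MA) = (\<lambda>y\<in>carrier MA. \<beta> z y)" by blast
    have "\<beta> z x = L x" if "x \<in> carrier MA" for x
      using fun_cong[OF z(2), of x] that by simp
    then show ?thesis using z by blast
  qed
  \<comment> \<open>Congruence modulo \<open>p\<close> is handled through this ideal alone, since
    the quotient ring may have zero divisors.\<close>
  define pR where "pR = {embed (int p) \<otimes>\<^bsub>R\<^esub> r | r. r \<in> carrier R}"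
  have pRI: "embed (int p) \<otimes>\<^bsub>R\<^esub> r \<in> pR" if "r \<in> carrier R" for r using that by (auto simp: pR_def)
  have pR_carrier: "r \<in> carrier R" if "r \<in> pR" for r using that by (auto simp: pR_def)
  have pR_zero: "\<zero>\<^bsub>R\<^esub> \<in> pR" using pRI[OF R.zero_closed] by simp
  have pR_add: "r \<oplus>\<^bsub>R\<^esub> s \<in> pR" if rs: "r \<in> pR" "s \<in> pR" for r s
  proof -
    obtain r' s' where "r' \<in> carrier R" "s' \<in> carrier R" "r = embed (int p) \<otimes>\<^bsub>R\<^esub> r'" "s = embed (int p) \<otimes>\<^bsub>R\<^esub> s'"
      using rs by (auto simp: pR_def)
    then show ?thesis using pRI[of "r' \<oplus>\<^bsub>R\<^esub> s'"] by (simp add: R.r_distr)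
  qed
  have pR_mult: "s \<otimes>\<^bsub>R\<^esub> r \<in> pR" if rs: "r \<in> pR" "s \<in> carrier R" for r s
  proof -
    obtain r' where "r' \<in> carrier R" "r = embed (int p) \<otimes>\<^bsub>R\<^esub> r'" using rs by (auto simp: pR_def)
    then show ?thesis using pRI[of "s \<otimes>\<^bsub>R\<^esub> r'"] rs by (simp add: R.m_lcomm)
  qed
  have pR_embed: "embed k \<otimes>\<^bsub>R\<^esub> r \<in> pR" if kr: "int p dvd k" "r \<in> carrier R" for k r
  proof -
    obtain l where "k = int p * l" using kr by blast
    then show ?thesis using pRI[of "embed l \<otimes>\<^bsub>R\<^esub> r"] kr by (simp add: R.m_assoc)
  qed
  have pR_sum: "(\<Oplus>\<^bsub>R\<^esub>i\<in>I. r i) \<in> pR" if "finite I" "\<And>i. i \<in> I \<Longrightarrow> r i \<in> pR" for I :: "'g set" and r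
    using that
  proof (induction I rule: finite_induct)
    case (insert i I)
    then show ?case using pR_carrier pR_add by (simp add: Pi_def)
  qed (simp add: pR_zero)

  define x where "x A = b (carrier G) A \<one>\<^bsub>G\<^esub> Q" for A
  define y where "y B = b Q B \<one>\<^bsub>G\<^esub> (carrier G)" for B
  define f where "f A = \<beta> \<one>\<^bsub>MA\<^esub> (b (carrier G) A \<one>\<^bsub>G\<^esub> (carrier G))" for A
  note GG = sub_carrier
  have subc: "A \<subseteq> carrier G" "sub A" if "A \<in> subs Q" for A
    using subsD[OF that] subD by blast+
  have Px: "parameters (carrier G) A \<one>\<^bsub>G\<^esub> Q" and Py: "parameters Q A \<one>\<^bsub>G\<^esub> (carrier G)"
    and Pf: "parameters (carrier G) A \<one>\<^bsub>G\<^esub> (carrier G)" if "A \<in> subs Q" for A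
    using subsD[OF that] subc[OF that] GG Q(1) by (simp_all add: parameters_def)
  have xc: "x A \<in> carrier MA" and yc: "y A \<in> carrier MA"
    and bfc: "b (carrier G) A \<one>\<^bsub>G\<^esub> (carrier G) \<in> carrier MA" if "A \<in> subs Q" for A
    using b_closed Px Py Pf that by (simp_all add: x_def y_def)
  have fc: "f A \<in> carrier R" if "A \<in> subs Q" for A
    unfolding f_def using right(1)[OF MA.one_closed bfc[OF that]] .
  \<comment> \<open>All subgroups of \<open>Q\<close> are normal in \<open>Q\<close>, so each double
    coset contributes the same span and the Mackey formula reduces to a count.\<close>
  have pair_value: "\<beta> (x A) (y B) = embed (int (card (reps A Q B))) \<otimes>\<^bsub>R\<^esub> f (A \<inter> B)"
    if A: "A \<in> subs Q" and B: "B \<in> subs Q" for A B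
  proof -
    note sA = subsD[OF A] and sB = subsD[OF B]
    note Ac = subc[OF A] and Bc = subc[OF B]
    let ?D = "reps A Q B"
    have D: "double_coset_reps G A Q B ?D" by (rule reps[OF Q(1) sA(1) sB(1) sA(2) sB(2)])
    have DQ: "?D \<subseteq> Q" using D by (simp add: double_coset_reps_iff)
    have finD: "finite ?D" using DQ sub_finite[OF Q(1)] finite_subset by blast
    have AB: "A \<inter> B \<in> subs Q" using sA sB sub_Int by (auto simp: subs_def)
    let ?b = "b (carrier G) (A \<inter> B) \<one>\<^bsub>G\<^esub> (carrier G)"
    let ?w = "\<lambda>k. b A (A \<inter> cj k B) (k \<otimes> \<one>\<^bsub>G\<^esub>) (carrier G)"
    have kD: "k \<in> carrier G" "cj k B = B" if "k \<in> ?D" for k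
      using that DQ Qc normal_in_prime_square[OF p Q B] by auto
    have Pw: "parameters A (A \<inter> cj k B) (k \<otimes> \<one>\<^bsub>G\<^esub>) (carrier G)" if "k \<in> ?D" for k
      using parameters_Res(1)[OF Py[OF B] sA(1) kD(1)[OF that]] .
    have "x A = E [Tr (carrier G) A] \<otimes>\<^bsub>MA\<^esub> (E [Con \<one>\<^bsub>G\<^esub> A] \<otimes>\<^bsub>MA\<^esub> E [Res Q A])"
      using E_append[of "[Tr (carrier G) A]" "[Con \<one>\<^bsub>G\<^esub> A, Res Q A]"] E_append[of "[Con \<one>\<^bsub>G\<^esub> A]" "[Res Q A]"]
        sA Ac GG Q by (simp add: x_def b_def bword_def)
    then have "x A \<otimes>\<^bsub>MA\<^esub> y B
      = E [Tr (carrier G) A] \<otimes>\<^bsub>MA\<^esub> (E [Con \<one>\<^bsub>G\<^esub> A] \<otimes>\<^bsub>MA\<^esub> (E [Res Q A] \<otimes>\<^bsub>MA\<^esub> y B))"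
      using yc[OF B] sA Ac GG Q by (simp add: MA.m_assoc)
    also have "E [Res Q A] \<otimes>\<^bsub>MA\<^esub> y B = (\<Oplus>\<^bsub>MA\<^esub>k\<in>?D. ?w k)"
      unfolding y_def by (rule b_Res[OF Py[OF B] sA D])
    also have "E [Con \<one>\<^bsub>G\<^esub> A] \<otimes>\<^bsub>MA\<^esub> (\<Oplus>\<^bsub>MA\<^esub>k\<in>?D. ?w k) = (\<Oplus>\<^bsub>MA\<^esub>k\<in>?D. E [Con \<one>\<^bsub>G\<^esub> A] \<otimes>\<^bsub>MA\<^esub> ?w k)"
      using finD b_closed[OF Pw] sA by (intro MA.finsum_rdistr) auto
    also have "E [Tr (carrier G) A] \<otimes>\<^bsub>MA\<^esub> (\<Oplus>\<^bsub>MA\<^esub>k\<in>?D. E [Con \<one>\<^bsub>G\<^esub> A] \<otimes>\<^bsub>MA\<^esub> ?w k)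
       = (\<Oplus>\<^bsub>MA\<^esub>k\<in>?D. E [Tr (carrier G) A] \<otimes>\<^bsub>MA\<^esub> (E [Con \<one>\<^bsub>G\<^esub> A] \<otimes>\<^bsub>MA\<^esub> ?w k))"
      using finD b_closed[OF Pw] sA Ac GG by (intro MA.finsum_rdistr) auto
    also have "\<dots> = (\<Oplus>\<^bsub>MA\<^esub>k\<in>?D. ?b)"
    proof (rule MA.M.add.finprod_cong'[OF refl])
      fix k assume k: "k \<in> ?D"
      note kk = kD[OF k] and P = Pw[OF k]
      have "E [Con \<one>\<^bsub>G\<^esub> A] \<otimes>\<^bsub>MA\<^esub> ?w k = b A (A \<inter> B) k (carrier G)"
        using b_Con[OF P, of "\<one>\<^bsub>G\<^esub>"] Ac kk by (simp add: le_infI1)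
      moreover have P': "parameters A (A \<inter> B) k (carrier G)" using P kk by simp
      moreover have "E [Tr (carrier G) A] \<otimes>\<^bsub>MA\<^esub> b A (A \<inter> B) k (carrier G) = b (carrier G) (A \<inter> B) k (carrier G)"
        by (rule b_Tr[OF P' GG Ac(1)])
      moreover have "b (carrier G) (A \<inter> B) k (carrier G) = ?b"
        using b_right_invariant[OF Pf[OF AB] kk(1)] kk by simp
      ultimately show "E [Tr (carrier G) A] \<otimes>\<^bsub>MA\<^esub> (E [Con \<one>\<^bsub>G\<^esub> A] \<otimes>\<^bsub>MA\<^esub> ?w k) = ?b" by simp
    qed (use bfc[OF AB] in auto)
    finally have prod: "x A \<otimes>\<^bsub>MA\<^esub> y B = (\<Oplus>\<^bsub>MA\<^esub>k\<in>?D. ?b)" .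
    have "\<beta> (x A) (y B) = \<beta> \<one>\<^bsub>MA\<^esub> (x A \<otimes>\<^bsub>MA\<^esub> y B)"
      using assoc[OF MA.one_closed xc[OF A] yc[OF B]] xc[OF A] by simp
    also have "\<dots> = (\<Oplus>\<^bsub>R\<^esub>k\<in>?D. embed 1 \<otimes>\<^bsub>R\<^esub> f (A \<inter> B))"
      unfolding prod using MA.functional_finsum[OF hom[OF MA.one_closed] finD, of "\<lambda>_. ?b"] bfc[OF AB] fc[OF AB]
      by (simp add: f_def)
    also have "\<dots> = (\<Oplus>\<^bsub>R\<^esub>k\<in>?D. embed 1) \<otimes>\<^bsub>R\<^esub> f (A \<inter> B)"
      using finD fc[OF AB] by (intro R.finsum_ldistr[symmetric]) auto
    also have "(\<Oplus>\<^bsub>R\<^esub>k\<in>?D. embed 1) = embed (\<Sum>k\<in>?D. 1)" by (rule embed_sum[symmetric])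
    finally show ?thesis by simp
  qed

  \<comment> \<open>The arrows from \<open>Q\<close> to the whole group, cut out by idempotents on
    both sides.\<close>
  define U where "U = {z \<in> carrier MA. z \<otimes>\<^bsub>MA\<^esub> E [Tr Q Q] = z \<and> E [Tr (carrier G) (carrier G)] \<otimes>\<^bsub>MA\<^esub> z = z}"
  have eQ: "E [Tr Q Q] \<in> carrier MA" and eG: "E [Tr (carrier G) (carrier G)] \<in> carrier MA"
    using Q GG by simp_all
  have Ux: "x A \<in> U" if "A \<in> subs Q" for A
    using xc[OF that] b_Tr_right[OF Px[OF that] Q(1)] b_Tr_left[OF Px[OF that] GG] by (simp add: U_def x_def)
  have Uadd: "z \<oplus>\<^bsub>MA\<^esub> z' \<in> U" if "z \<in> U" "z' \<in> U" for z z'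
    using that eQ eG by (simp add: U_def MA.l_distr MA.r_distr)
  have Usmult: "s \<odot>\<^bsub>MA\<^esub> z \<in> U" if "s \<in> carrier R" "z \<in> U" for s z
    using that eQ eG by (simp add: U_def MA.smult_mult_left MA.smult_mult_right)
  have Uc: "z \<in> carrier MA" if "z \<in> U" for z using that by (simp add: U_def)
  have Usum: "(\<Oplus>\<^bsub>MA\<^esub>i\<in>I. z i) \<in> U" if "finite I" "\<And>i. i \<in> I \<Longrightarrow> z i \<in> U" for I :: "'g set" and z
    using that
  proof (induction I rule: finite_induct)
    case empty
    then show ?case using eQ eG by (simp add: U_def)
  next
    case (insert i I)
    then show ?case using Uc Uadd by (simp add: Pi_def)
  qed
  \<comment> \<open>Basis elements other than the \<open>y B\<close> pair to zero with
    \<open>U\<close>: associativity and symmetry move an idempotent onto an end where it does not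
    belong.\<close>
  have reduce: "\<beta> z v \<in> pR" if z: "z \<in> U" and zB: "\<And>B. B \<in> subs Q \<Longrightarrow> \<beta> z (y B) \<in> pR" and v: "v \<in> carrier MA" for z v
    using basis_closed v[folded span_basis]
  proof (induction rule: MA.span_induct)
    case zero
    then show ?case using right(4)[OF Uc[OF z]] pR_zero by simp
  next
    case (add v v')
    then show ?case using right(2)[OF Uc[OF z]] pR_add by simp
  next
    case (smult s e)
    obtain H B g K where P: "parameters H B g K" "e = b H B g K" using smult by (auto simp: basis_def)
    note d = parametersD[OF P(1)]
    have ec: "e \<in> carrier MA" using P b_closed by simp
    have "\<beta> z e \<in> pR"
    proof (cases "H = Q \<and> K = carrier G")
      case True
      have B: "B \<in> subs Q" using d True by (simp add: subs_def)
      have "e = y B"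
        using b_right_invariant[OF Py[OF B], of g] d P True by (simp add: y_def)
      then show ?thesis using zB[OF B] by simp
    next
      case False
      have 1: "\<beta> z e = \<beta> z (E [Tr Q Q] \<otimes>\<^bsub>MA\<^esub> e)"
        using assoc[OF Uc[OF z] eQ ec] z by (simp add: U_def)
      have "\<beta> z e = \<beta> e (E [Tr (carrier G) (carrier G)] \<otimes>\<^bsub>MA\<^esub> z)"
        using comm[OF Uc[OF z] ec] z by (simp add: U_def)
      also have "\<dots> = \<beta> (e \<otimes>\<^bsub>MA\<^esub> E [Tr (carrier G) (carrier G)]) z"
        using assoc[OF ec eG Uc[OF z]] by simp
      finally have 2: "\<beta> z e = \<beta> (e \<otimes>\<^bsub>MA\<^esub> E [Tr (carrier G) (carrier G)]) z" .
      have "\<beta> z e = \<zero>\<^bsub>R\<^esub>"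
      proof (cases "H = Q")
        case True
        then have "carrier G \<noteq> K" using False by blast
        then show ?thesis using 2 b_Tr_right[OF P(1) GG] P(2) left(4)[OF Uc[OF z]] by simp
      next
        case False
        then show ?thesis using 1 b_Tr_left[OF P(1) Q(1)] P(2) right(4)[OF Uc[OF z]] by simp
      qed
      then show ?thesis using pR_zero by simp
    qed
    then show ?case using right(3)[OF Uc[OF z] smult(1) ec] pR_mult smult(1) by simp
  qed

  define \<delta> where "\<delta> A = form (orbit_form (carrier G) A Q)" for A
  have \<delta>_hom: "\<delta> A \<in> module_hom R MA (regular_module R)"
    and \<delta>_x: "\<And>A'. A' \<in> subs Q \<Longrightarrow> \<delta> A (x A') = embed (of_bool (A' = A))" if A: "A \<in> subs Q" for A
  proof -
    have Q1: "\<one>\<^bsub>G\<^esub> <# Q = Q" using subD[OF Q(1)] by (simp add: lcos_mult_one)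
    have inv: "invariant (orbit_form (carrier G) A Q)"
      using orbit_form_invariant[OF GG subc(1)[OF A] subD[OF Q(1)]] .
    show "\<delta> A \<in> module_hom R MA (regular_module R)" unfolding \<delta>_def by (rule form(1)[OF inv])
    fix A' assume A': "A' \<in> subs Q"
    have "(\<exists>h\<in>carrier G. A' = cj h A \<and> Q = h <# Q) \<longleftrightarrow> A' = A"
    proof
      assume "\<exists>h\<in>carrier G. A' = cj h A \<and> Q = h <# Q"
      then obtain h where h: "h \<in> carrier G" "A' = cj h A" "h <# Q = Q" by metis
      then have "h \<in> Q" using l_coset_self_iff[OF Q(1)] by blast
      then show "A' = A" using h normal_in_prime_square[OF p Q A] by simp
    next
      assume "A' = A"
      then show "\<exists>h\<in>carrier G. A' = cj h A \<and> Q = h <# Q"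
        using Q1 subc(1)[OF A] by (intro bexI[of _ "\<one>\<^bsub>G\<^esub>"]) auto
    qed
    then show "\<delta> A (x A') = embed (of_bool (A' = A))"
      unfolding \<delta>_def x_def form_b[OF inv Px[OF A']] by (simp add: orbit_form_def Q1)
  qed
  \<comment> \<open>Non-degeneracy represents the coordinate form by some \<open>v\<close>, and
    pairings with all elements are controlled by those with the \<open>y B\<close>.\<close>
  have transfer: "\<delta> A z \<in> pR" if A: "A \<in> subs Q" and z: "z \<in> U" and zB: "\<And>B. B \<in> subs Q \<Longrightarrow> \<beta> z (y B) \<in> pR" for A z
  proof -
    obtain v where v: "v \<in> carrier MA" "\<forall>u\<in>carrier MA. \<beta> v u = \<delta> A u"
      using represent[OF \<delta>_hom[OF A]] by blast
    then have "\<delta> A z = \<beta> z v" using comm[OF Uc[OF z] v(1)] Uc[OF z] by simp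
    then show ?thesis using reduce[OF z zB v(1)] by simp
  qed

  have one: "{\<one>\<^bsub>G\<^esub>} \<in> subs Q"
    using triv_subgroup subgroup.one_closed[OF Q(1)] by (simp add: subs_def)
  have QQ: "Q \<in> subs Q" using Q by (simp add: subs_def)
  define f1 where "f1 = f {\<one>\<^bsub>G\<^esub>}"
  have f1c: "f1 \<in> carrier R" using fc[OF one] by (simp add: f1_def)
  have meet_one: "{\<one>\<^bsub>G\<^esub>} \<inter> B = {\<one>\<^bsub>G\<^esub>}" if "B \<in> subs Q" for B
    using subgroup.one_closed[OF subc(2)[OF that]] by auto
  \<comment> \<open>The count is the quotient of |Q| by |B|, divisible by \<open>p\<close> unless
    \<open>B = Q\<close>.\<close>
  have x1: "\<beta> (x {\<one>\<^bsub>G\<^esub>}) (y B) \<in> pR" if B: "B \<in> subs Q" "B \<noteq> Q" for B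
  proof -
    have "card B * card (reps {\<one>\<^bsub>G\<^esub>} Q B) = p * p"
      using card_reps_prime_square[OF p Q one B(1)] meet_one[OF B(1)] Q(2) by simp
    then have "p dvd card (reps {\<one>\<^bsub>G\<^esub>} Q B)"
      using subs_of_prime_square[OF p Q B(1)] B(2) p0 by auto
    then show ?thesis
      unfolding pair_value[OF one B(1)] meet_one[OF B(1)] using fc[OF one] by (intro pR_embed) auto
  qed
  have x1Q: "\<beta> (x {\<one>\<^bsub>G\<^esub>}) (y Q) = f1"
  proof -
    have "p * p * card (reps {\<one>\<^bsub>G\<^esub>} Q Q) = p * p"
      using card_reps_prime_square[OF p Q one QQ] meet_one[OF QQ] Q(2) by simp
    then have "card (reps {\<one>\<^bsub>G\<^esub>} Q Q) = 1" using p0 by simp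
    then show ?thesis unfolding pair_value[OF one QQ] meet_one[OF QQ] using fc[OF one] by (simp add: f1_def)
  qed

  define T where "T = torsion p Q"
  have finT: "finite T" using sub_finite[OF Q(1)] by (simp add: T_def torsion_def)
  have T: "u \<in> Q" "u \<in> carrier G" "u [^]\<^bsub>G\<^esub> p = \<one>\<^bsub>G\<^esub>" "cyc u \<in> subs Q" if "u \<in> T" for u
    using that Qc cyc[of u] Q(1) by (auto simp: T_def torsion_def subs_def)
  \<comment> \<open>Summing over elements instead of subgroups counts each subgroup of order
    \<open>p\<close> with multiplicity p - 1, that is -1 modulo \<open>p\<close>, and the trivial
    one once. Against \<open>B\<close> of order \<open>p\<close>, elements inside \<open>B\<close>
    contribute multiples of \<open>p\<close>, and each element outside contributes
    \<open>f1\<close>; by \<open>card_torsion_outside\<close> the number of the latter is divisible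
    by \<open>p\<close>.\<close>
  define W where "W = (\<Oplus>\<^bsub>MA\<^esub>u\<in>T. x (cyc u))"
  have WU: "W \<in> U" unfolding W_def using finT T Ux by (intro Usum) auto
  have Wsum: "L W = (\<Oplus>\<^bsub>R\<^esub>u\<in>T. L (x (cyc u)))" if "L \<in> module_hom R MA (regular_module R)" for L
    unfolding W_def by (rule MA.functional_finsum[OF that finT]) (use T xc in auto)
  have W: "\<beta> W (y B) \<in> pR" if B: "B \<in> subs Q" "B \<noteq> Q" for B
  proof -
    have Wy: "\<beta> W (y B) = (\<Oplus>\<^bsub>R\<^esub>u\<in>T. \<beta> (x (cyc u)) (y B))"
      using Wsum[OF hom'[OF yc[OF B(1)]]] .
    have inner: "\<beta> (x (cyc u)) (y B) \<in> pR" if u: "u \<in> T" and uB: "B = {\<one>\<^bsub>G\<^esub>} \<or> u \<in> B" for u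
    proof -
      note c = T(4)[OF u]
      have m: "cyc u \<inter> B \<in> subs Q" using subsD[OF c] subsD[OF B(1)] sub_Int by (auto simp: subs_def)
      have "p dvd card (reps (cyc u) Q B)"
      proof (cases "B = {\<one>\<^bsub>G\<^esub>}")
        case True
        have "cyc u \<inter> B = {\<one>\<^bsub>G\<^esub>}" using meet_one[OF c] True by auto
        then have "card (cyc u) * card (reps (cyc u) Q B) = p * p"
          using card_reps_prime_square[OF p Q c B(1)] Q(2) True by simp
        then show ?thesis using card_cyc[OF p T(2,3)[OF u]] p0 by (auto split: if_splits)
      next
        case False
        then have "card B = p" using subs_of_prime_square[OF p Q B(1)] B(2) by blast
        moreover have "cyc u \<inter> B = cyc u"
          using cyc(3)[OF T(2)[OF u] subc(2)[OF B(1)]] uB False by auto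
        ultimately have "card (cyc u) * p * card (reps (cyc u) Q B) = p * p * card (cyc u)"
          using card_reps_prime_square[OF p Q c B(1)] Q(2) by simp
        then have "card (reps (cyc u) Q B) = p" using sub_card_nz(1)[OF subsD(1)[OF c]] p0 by simp
        then show ?thesis by simp
      qed
      then show ?thesis unfolding pair_value[OF c B(1)] using fc[OF m] by (intro pR_embed) auto
    qed
    show ?thesis
    proof (cases "B = {\<one>\<^bsub>G\<^esub>}")
      case True
      then show ?thesis unfolding Wy using inner finT by (intro pR_sum) auto
    next
      case False
      then have cB: "card B = p" using subs_of_prime_square[OF p Q B(1)] B(2) by blast
      have outer: "\<beta> (x (cyc u)) (y B) = f1" if u: "u \<in> T - B" for u
      proof -
        have uT: "u \<in> T" "u \<notin> B" using u by auto
        note c = T(4)[OF uT(1)]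
        have m: "cyc u \<inter> B = {\<one>\<^bsub>G\<^esub>}"
          by (rule cyc_Int_trivial[OF p subc(2)[OF B(1)] cB T(2,3)[OF uT(1)] uT(2)])
        have "u \<noteq> \<one>\<^bsub>G\<^esub>" using uT(2) subgroup.one_closed[OF subc(2)[OF B(1)]] by auto
        then have "card (cyc u) = p" using card_cyc[OF p T(2,3)[OF uT(1)]] by simp
        then have "p * p * card (reps (cyc u) Q B) = p * p"
          using card_reps_prime_square[OF p Q c B(1)] Q(2) cB m by simp
        then have "card (reps (cyc u) Q B) = 1" using p0 by simp
        then show ?thesis unfolding pair_value[OF c B(1)] m using fc[OF one] by (simp add: f1_def)
      qed
      have vc: "\<beta> (x (cyc u)) (y B) \<in> carrier R" if "u \<in> T" for u
        using right(1)[OF xc[OF T(4)[OF that]] yc[OF B(1)]] .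
      have "\<beta> W (y B) = (\<Oplus>\<^bsub>R\<^esub>u\<in>(T \<inter> B) \<union> (T - B). \<beta> (x (cyc u)) (y B))"
        unfolding Wy by (simp add: Int_Diff_Un)
      also have "\<dots> = (\<Oplus>\<^bsub>R\<^esub>u\<in>T \<inter> B. \<beta> (x (cyc u)) (y B)) \<oplus>\<^bsub>R\<^esub> (\<Oplus>\<^bsub>R\<^esub>u\<in>T - B. \<beta> (x (cyc u)) (y B))"
        using finT vc by (intro R.finsum_Un_disjoint) auto
      also have "(\<Oplus>\<^bsub>R\<^esub>u\<in>T - B. \<beta> (x (cyc u)) (y B)) = (\<Oplus>\<^bsub>R\<^esub>u\<in>T - B. embed 1 \<otimes>\<^bsub>R\<^esub> f1)"
        by (rule R.add.finprod_cong'[OF refl]) (use outer f1c in auto)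
      also have "\<dots> = (\<Oplus>\<^bsub>R\<^esub>u\<in>T - B. embed 1) \<otimes>\<^bsub>R\<^esub> f1"
        using finT f1c by (intro R.finsum_ldistr[symmetric]) auto
      also have "(\<Oplus>\<^bsub>R\<^esub>u\<in>T - B. embed 1) = embed (\<Sum>u\<in>T - B. 1)" by (rule embed_sum[symmetric])
      finally have eq: "\<beta> W (y B) = (\<Oplus>\<^bsub>R\<^esub>u\<in>T \<inter> B. \<beta> (x (cyc u)) (y B)) \<oplus>\<^bsub>R\<^esub> embed (\<Sum>u\<in>T - B. 1) \<otimes>\<^bsub>R\<^esub> f1" .
      have "int p dvd (\<Sum>u\<in>T - B. 1)"
        using card_torsion_outside[OF p Q B(1) cB] by (simp add: T_def)
      then show ?thesis unfolding eq
        using inner finT f1c by (intro pR_add pR_sum pR_embed) auto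
    qed
  qed

  define \<gamma> where "\<gamma> = \<beta> W (y Q)"
  have \<gamma>c: "\<gamma> \<in> carrier R" unfolding \<gamma>_def using right(1)[OF Uc[OF WU] yc[OF QQ]] .
  \<comment> \<open>Only the pairing with \<open>y Q\<close> is not under control. As
    \<open>x {\<one>}\<close> pairs with \<open>y Q\<close> to \<open>f1\<close>, this combination
    cancels it without dividing by \<open>f1\<close>.\<close>
  define z where "z = f1 \<odot>\<^bsub>MA\<^esub> W \<oplus>\<^bsub>MA\<^esub> (\<ominus>\<^bsub>R\<^esub> \<gamma>) \<odot>\<^bsub>MA\<^esub> x {\<one>\<^bsub>G\<^esub>}"
  have zU: "z \<in> U" unfolding z_def using WU Ux[OF one] f1c \<gamma>c by (intro Uadd Usmult) auto
  have zL: "L z = f1 \<otimes>\<^bsub>R\<^esub> L W \<oplus>\<^bsub>R\<^esub> (\<ominus>\<^bsub>R\<^esub> \<gamma>) \<otimes>\<^bsub>R\<^esub> L (x {\<one>\<^bsub>G\<^esub>})"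
    if L: "L \<in> module_hom R MA (regular_module R)" for L
    unfolding z_def using MA.functional_simps[OF L] Uc[OF WU] xc[OF one] f1c \<gamma>c by simp
  have zB: "\<beta> z (y B) \<in> pR" if B: "B \<in> subs Q" for B
  proof (cases "B = Q")
    case True
    have "\<beta> z (y Q) = \<zero>\<^bsub>R\<^esub>"
      unfolding zL[OF hom'[OF yc[OF QQ]]] x1Q \<gamma>_def[symmetric]
      using R.m_comm[OF f1c \<gamma>c] f1c \<gamma>c by (simp add: R.l_minus R.r_neg)
    then show ?thesis using True pR_zero by simp
  next
    case False
    then show ?thesis
      unfolding zL[OF hom'[OF yc[OF B]]] using W[OF B] x1[OF B] f1c \<gamma>c by (intro pR_add pR_mult) auto
  qed
  obtain P0 where P0: "P0 \<in> subs Q" "card P0 = p"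
    using subgroup_of_prime_power_order[OF p Q(1), of 1] Q(2) by auto
  \<comment> \<open>The coordinate of \<open>z\<close> at \<open>P0\<close> is p - 1 times
    \<open>f1\<close>: the group \<open>P0\<close> has p - 1 generators, and
    \<open>x {\<one>}\<close> does not contribute there.\<close>
  have "f1 \<in> pR"
  proof -
    have "\<delta> P0 W = (\<Oplus>\<^bsub>R\<^esub>u\<in>T. embed (of_bool (cyc u = P0)))"
      unfolding Wsum[OF \<delta>_hom[OF P0(1)]]
      by (rule R.add.finprod_cong'[OF refl]) (use \<delta>_x[OF P0(1)] T in auto)
    also have "\<dots> = embed (\<Sum>u\<in>T. of_bool (cyc u = P0))" by (rule embed_sum[symmetric])
    also have "(\<Sum>u\<in>T. of_bool (cyc u = P0)) = int (card {u \<in> T. cyc u = P0})"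
      using finT by (simp add: Int_def)
    also have "{u \<in> T. cyc u = P0} = P0 - {\<one>\<^bsub>G\<^esub>}"
    proof
      show "{u \<in> T. cyc u = P0} \<subseteq> P0 - {\<one>\<^bsub>G\<^esub>}"
        using cyc(2)[OF T(2)] card_cyc[OF p T(2,3)] P0(2) p by (auto simp: prime_nat_iff)
      show "P0 - {\<one>\<^bsub>G\<^esub>} \<subseteq> {u \<in> T. cyc u = P0}"
      proof
        fix u assume u: "u \<in> P0 - {\<one>\<^bsub>G\<^esub>}"
        then have up: "u [^]\<^bsub>G\<^esub> p = \<one>\<^bsub>G\<^esub>" using pow_prime_in_sub[OF p subc(2)[OF P0(1)] P0(2)] by blast
        then have uT: "u \<in> T" using u subsD(2)[OF P0(1)] by (auto simp: T_def torsion_def)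
        have "cyc u \<subseteq> P0" using cyc(3)[OF T(2)[OF uT] subc(2)[OF P0(1)]] u by blast
        moreover have "card (cyc u) = card P0" using card_cyc[OF p T(2,3)[OF uT]] u P0(2) by simp
        ultimately show "u \<in> {u \<in> T. cyc u = P0}"
          using uT card_subset_eq[OF sub_finite[OF subc(2)[OF P0(1)]]] by simp
      qed
    qed
    also have "int (card (P0 - {\<one>\<^bsub>G\<^esub>})) = int p - 1"
      using subgroup.one_closed[OF subc(2)[OF P0(1)]] sub_finite[OF subc(2)[OF P0(1)]] P0(2) p0
      by (simp add: card_Diff_subset of_nat_diff)
    finally have dW: "\<delta> P0 W = embed (int p - 1)" .
    have "P0 \<noteq> {\<one>\<^bsub>G\<^esub>}" using P0(2) p by (auto simp: prime_nat_iff)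
    then have d1: "\<delta> P0 (x {\<one>\<^bsub>G\<^esub>}) = \<zero>\<^bsub>R\<^esub>" using \<delta>_x[OF P0(1) one] by simp
    have multiple: "f1 \<otimes>\<^bsub>R\<^esub> embed (int p - 1) \<in> pR"
      using transfer[OF P0(1) zU zB] zL[OF \<delta>_hom[OF P0(1)]] dW d1 f1c \<gamma>c by simp
    \<comment> \<open>Modulo \<open>p\<close> the factor p - 1 is a unit, namely -1.\<close>
    then have "embed (int p) \<otimes>\<^bsub>R\<^esub> f1 \<oplus>\<^bsub>R\<^esub> embed (-1) \<otimes>\<^bsub>R\<^esub> (f1 \<otimes>\<^bsub>R\<^esub> embed (int p - 1)) \<in> pR"
      using f1c by (intro pR_add pRI pR_mult[OF multiple]) auto
    moreover have "embed (int p) \<otimes>\<^bsub>R\<^esub> f1 \<oplus>\<^bsub>R\<^esub> embed (-1) \<otimes>\<^bsub>R\<^esub> (f1 \<otimes>\<^bsub>R\<^esub> embed (int p - 1)) = f1"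
    proof -
      have "embed (-1) \<otimes>\<^bsub>R\<^esub> (f1 \<otimes>\<^bsub>R\<^esub> embed (int p - 1)) = (embed (-1) \<otimes>\<^bsub>R\<^esub> embed (int p - 1)) \<otimes>\<^bsub>R\<^esub> f1"
        using f1c by (simp add: R.m_assoc R.m_comm[of f1])
      also have "\<dots> = embed (- 1 * (int p - 1)) \<otimes>\<^bsub>R\<^esub> f1" by (simp only: embed_simps)
      finally have "embed (int p) \<otimes>\<^bsub>R\<^esub> f1 \<oplus>\<^bsub>R\<^esub> embed (-1) \<otimes>\<^bsub>R\<^esub> (f1 \<otimes>\<^bsub>R\<^esub> embed (int p - 1))
        = (embed (int p) \<oplus>\<^bsub>R\<^esub> embed (- 1 * (int p - 1))) \<otimes>\<^bsub>R\<^esub> f1"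
        using f1c by (simp only: R.l_distr embed_simps(1))
      also have "\<dots> = embed (int p + - 1 * (int p - 1)) \<otimes>\<^bsub>R\<^esub> f1" by (simp only: embed_simps)
      also have "\<dots> = f1" using f1c by simp
      finally show ?thesis .
    qed
    ultimately show ?thesis by simp
  qed
  \<comment> \<open>Now \<open>x {\<one>}\<close> itself is degenerate modulo \<open>p\<close>,
    although one of its coordinates is 1.\<close>
  then have "\<beta> (x {\<one>\<^bsub>G\<^esub>}) (y B) \<in> pR" if "B \<in> subs Q" for B
    using x1[OF that] x1Q by (cases "B = Q") auto
  then have "\<delta> {\<one>\<^bsub>G\<^esub>} (x {\<one>\<^bsub>G\<^esub>}) \<in> pR" by (intro transfer[OF one Ux[OF one]])
  then have "\<one>\<^bsub>R\<^esub> \<in> pR" using \<delta>_x[OF one one] by simp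
  then obtain r where "r \<in> carrier R" "embed (int p) \<otimes>\<^bsub>R\<^esub> r = \<one>\<^bsub>R\<^esub>" by (auto simp: pR_def)
  then have "embed (int p) \<in> Units R" using R.m_comm[of r "embed (int p)"] by (auto simp: Units_def)
  then show False using np by contradiction
qed

end

lemma (in cring) embed_nat: "embed (int k) = [k] \<cdot> \<one>"
  by (simp add: add_pow_int_ge)

lemma (in cring) embed_Units:
  assumes "\<And>q. \<lbrakk>prime q; q dvd m\<rbrakk> \<Longrightarrow> [q] \<cdot> \<one> \<in> Units R" "m > 0"
  shows "embed (int m) \<in> Units R"
  using assms
proof (induction m rule: less_induct)
  case (less m)
  show ?case
  proof (cases "m = 1")
    case True
    then show ?thesis by simp
  next
    case False
    then obtain q k where q: "prime q" "m = q * k" using prime_factor_nat by blast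
    then have "k < m" "k > 0" using less.prems(2) prime_gt_1_nat[OF q(1)] by auto
    then have "embed (int k) \<in> Units R" using less.IH[of k] less.prems(1) q(2) by simp
    moreover have "embed (int q) \<in> Units R" using less.prems(1)[OF q(1)] q(2) by (simp add: embed_nat)
    ultimately show ?thesis unfolding q(2) of_nat_mult embed_simps by (rule Units_m_closed[rotated])
  qed
qed

theorem corollary4p8:
  fixes G :: "('g, 'n) monoid_scheme" and R :: "('r, 'm) ring_scheme" and p :: nat
  assumes "group G" and "finite (carrier G)"
    and "prime p" and "p dvd order G"
    and "cring R"
    and "\<And>q::nat. \<lbrakk>prime q; q dvd order G; q \<noteq> p\<rbrakk> \<Longrightarrow> [q] \<cdot>\<^bsub>R\<^esub> \<one>\<^bsub>R\<^esub> \<in> Units R"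
    and "[p] \<cdot>\<^bsub>R\<^esub> \<one>\<^bsub>R\<^esub> \<notin> Units R"
  shows "symmetric_algebra R (mackey_algebra R G) \<longleftrightarrow> \<not> p\<^sup>2 dvd order G"
proof -
  interpret R: cring R by fact
  have fg: "fin_group G"
    using assms(1,2) by (intro fin_group.intro fin_group_axioms.intro)
  have mf: "mackey_free G R"
    by (intro mackey_free.intro fg assms(5) R.free_algebra_assoc_algebra)
  have mc: "mackey_context G R"
    by (intro mackey_context.intro fg assms(5) mackey_free.assoc_algebra_MA[OF mf])
  show ?thesis
  proof
    assume "symmetric_algebra R (mackey_algebra R G)"
    then show "\<not> p\<^sup>2 dvd order G"
      using mackey_context.not_symmetric[OF mc assms(3)] assms(7) by (auto simp: R.embed_nat)
  next
    assume square: "\<not> p\<^sup>2 dvd order G"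
    obtain n where n: "order G = p * n" using assms(4) by blast
    then have exact: "\<not> p dvd n" using square by (simp add: power2_eq_square)
    have "order G > 0" 
      using fin_group.sub_card_nz(2)[OF fg fin_group.sub_carrier[OF fg]] by (simp add: order_def)
    then have "n > 0" using n by simp
    \<comment> \<open>The prime divisors of \<open>n\<close> divide the group order and differ from
      \<open>p\<close>, because \<open>p\<close> does not divide \<open>n\<close>.\<close>
    then have unit: "R.embed (int n) \<in> Units R"
      using assms(6) n exact by (intro R.embed_Units) (metis dvd_mult, simp)
    have "\<one>\<^bsub>R\<^esub> \<noteq> \<zero>\<^bsub>R\<^esub>"
    proof
      assume "\<one>\<^bsub>R\<^esub> = \<zero>\<^bsub>R\<^esub>"
      then have "carrier R = {\<zero>\<^bsub>R\<^esub>}" by (rule R.one_zeroD)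
      then have "[p] \<cdot>\<^bsub>R\<^esub> \<one>\<^bsub>R\<^esub> = \<one>\<^bsub>R\<^esub>" using R.add.nat_pow_closed[OF R.one_closed, of p] R.one_closed by auto
      then show False using assms(7) by simp
    qed
    then have "mackey_exact G R p n"
      using mc fg assms(3) n exact unit
      by (intro mackey_exact.intro exact_p_group.intro exact_p_group_axioms.intro mackey_exact_axioms.intro)
    then show "symmetric_algebra R (mackey_algebra R G)"
      by (rule mackey_exact.symmetric_mackey_algebra)
  qed
qed

end
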